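(* Let $F=\mathbb{R}$ or $\mathbb{C}$ and $G=\mathrm{SL}(2,F)$, with Levi component $L\simeq F^\times$. Let $(\sigma,\nu)\in\widehat{L}_r$ be Weyl-fixed, i.e. $w.(\sigma,\nu)=(\sigma,\nu)$, and let $T_w$ be the residual distribution on $L$ associated to the residual part of the global intertwining integral $\mathcal{I}_w$. Then the principal series representation $\pi^{\sigma,\nu}$ is reducible if and only if $\mathcal{F}_L T_w(\sigma,\nu)=0$.
   Context: Let $P=MAN\subset G$ be the subgroup of upper triangular matrices, where $M=\{\mathrm{diag}(m,m^{-1}):|m|_F=1\}$, $A=\{\mathrm{diag}(a,a^{-1}):a>0\}$, and $N$ is the group of unipotent upper triangular matrices; $L=MA$ is identified with $F^\times$ via $\mathrm{diag}(l,l^{-1})\leftrightarrow l$. Here $|\cdot|_F$ is the usual modulus. Let $d_F=\dim_{\mathbb{R}}F$ and $d^\times t=dt/|t|_F^{d_F}$, a Haar measure on $F^\times$. Principal series. For $\sigma\in\widehat M$ and a unitary character $\nu$ of $A$, $\pi^{\sigma,\nu}=\mathrm{Ind}_P^G(\sigma\otimes\nu\otimes1_N)$ (unitary parabolic induction). $\widehat L_r=\widehat L=\widehat M\times\widehat A$. For $F=\mathbb{R}$, $\widehat M=\{\mathbf 1,\varepsilon\}$ with $\mathbf 1$ trivial and $\varepsilon(\pm I_2)=\pm1$; for $F=\mathbb{C}$, $\widehat M=\{\varphi_n:n\in\mathbb{Z}\}$ with $\varphi_n(z)=z^n$. In both cases $\widehat A=\{\nu_t:t\in\mathbb{R}\}$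 with $\nu_t(a)=a^{2i\pi t}$. The non-trivial Weyl element, represented by $w=\begin{pmatrix}0&-1\\1&0\end{pmatrix}$, acts by $w.\mathbf 1=\mathbf 1$, $w.\varepsilon=\varepsilon$, $w.\varphi_n=\varphi_{-n}$, $w.\nu_t=\nu_{-t}$. Residual distribution. Let $\bar n_t=\begin{pmatrix}1&0\\t&1\end{pmatrix}$ for $t\in F$, forming the group $\bar N\simeq F$. For $g=\begin{pmatrix}a&b\\c&d\end{pmatrix}$ with $a\neq0$ let $\boldsymbol l(g)=a\in F^\times\simeq L$ be its component in the decomposition $\bar NLN$. The global intertwining integral is $\mathcal{I}_wf(g)=\int_{\bar N}f(gw\bar n)\,d\bar n$ for $f\in C_c(G/N)$; written in coordinates on $\bar NL$, its singular (residual) part is convolution on $L$ by the Radon measure $T_w$ defined, for a test function $\varphi$ on $L$, by $$T_w(\varphi)=\int_{|t|_F<1}\varphi\big(\boldsymbol l(w^{-1}\bar n_t)^{-1}\big)\,d^\times t=\int_{|t|_F>1}\varphi(t)\,d^\times t,$$ i.e. $T_w$ is the function $\mathbf 1_{\{|x|_F>1\}}$ with respect to Haar measure on $L$. Fourier transform. $\mathcal{F}_L$ is the Fourier transform on characters of the abelian group $L$, given for functions $S$ by $$\mathcal{F}_{\mathbb{R}^\times}S(\mathbf 1,\nu_t)=\int_{\mathbb{R}}S(x)|x|^{-2i\pi t}\frac{dx}{|x|},\qquad \mathcal{F}_{\mathbb{R}^\times}S(\varepsilon,\nu_t)=\int_{\mathbb{R}}S(x)\,\mathrm{sign}(x)|x|^{-2i\pi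 t}\frac{dx}{|x|},$$ $$\mathcal{F}_{\mathbb{C}^\times}S(\varphi_n,\nu_t)=\int_{\mathbb{S}^1}\int_0^\infty S(\theta,r)e^{-in\theta}r^{-2i\pi t}\frac{dr}{r}\,d\theta,$$ and extended to distributions by duality. For fixed $\sigma$, $\mathcal{F}_LT_w(\sigma,\nu_t)$ is thus a tempered distribution in $t\in\mathbb{R}$; the condition $\mathcal{F}_LT_w(\sigma,\nu_{t_0})=0$ means that this distribution vanishes at $t_0$, i.e. in a neighbourhood of $t_0$ (a singularity at $t_0$ counts as non-vanishing). *)

theory Defs
  imports "HOL-Analysis.Analysis"
begin

text \<open>
  The field \<open>F\<close> is the type \<^typ>\<open>real\<close> or \<^typ>\<open>complex\<close>. Notions common to both are stated over
  a type of class \<open>{real_normed_field, euclidean_space}\<close>; there \<^term>\<open>norm\<close> is the modulus of \<open>F\<close>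
  and \<open>DIM('a)\<close> is the real dimension of \<open>F\<close>. The group \<open>L\<close> is identified with the nonzero
  elements of \<open>F\<close>, and \<open>M\<close> with the elements of norm 1.
\<close>

definition mat2 :: "'a::zero \<Rightarrow> 'a \<Rightarrow> 'a \<Rightarrow> 'a \<Rightarrow> 'a^2^2" where
  "mat2 a b c d = vector [vector [a, b], vector [c, d]]"

definition SL2 :: "('a::comm_ring_1^2^2) set" where
  "SL2 = {g. det g = 1}"

definition upper_P :: "('a::comm_ring_1^2^2) set" where
  "upper_P = {p \<in> SL2. p $ 2 $ 1 = 0}"

definition diag_L :: "'a::field \<Rightarrow> 'a^2^2" where
  "diag_L l = mat2 l 0 0 (inverse l)"

definition nbar :: "'a::field \<Rightarrow> 'a^2^2" where
  "nbar t = mat2 1 0 t 1"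

definition weyl_w :: "'a::field^2^2" where
  "weyl_w = mat2 0 (- 1) 1 0"

text \<open>
  The \<open>L\<close>-component of \<open>g\<close> in the decomposition \<open>Nbar L N\<close>; meaningful for nonzero upper left
  entry. It is also the \<open>L\<close>-component of an element of \<open>P = L N\<close>.
\<close>
definition levi :: "'a^2^2 \<Rightarrow> 'a" where
  "levi g = g $ 1 $ 1"


subsection \<open>Unitary characters\<close>

text \<open>
  Elements of the dual of \<open>M\<close> are given by functions on \<open>F\<close>, of which only the values on \<open>M\<close> matter.
\<close>
definition M_dual_real :: "(real \<Rightarrow> complex) set" where
  "M_dual_real = {(\<lambda>_. 1), (\<lambda>m. complex_of_real m)}"

definition M_dual_complex :: "(complex \<Rightarrow> complex) set" where
  "M_dual_complex = {(\<lambda>z. z powi n) | n :: int. True}"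

definition nu :: "real \<Rightarrow> real \<Rightarrow> complex" where
  "nu t a = complex_of_real a powr (2 * \<i> * complex_of_real pi * complex_of_real t)"

text \<open>The character \<open>(\<sigma>, \<nu>\<^sub>t)\<close> of \<open>L = M A\<close>, using \<open>l = sgn l * of_real (norm l)\<close>.\<close>
definition L_char :: "('a::real_normed_field \<Rightarrow> complex) \<Rightarrow> real \<Rightarrow> 'a \<Rightarrow> complex" where
  "L_char \<sigma> t l = \<sigma> (sgn l) * nu t (norm l)"

definition weyl_act :: "('a::field \<Rightarrow> complex) \<Rightarrow> 'a \<Rightarrow> complex" where
  "weyl_act \<eta> l = \<eta> (levi (matrix_inv weyl_w ** diag_L l ** weyl_w))"

definition weyl_fixed :: "('a::field \<Rightarrow> complex) \<Rightarrow> bool" where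
  "weyl_fixed \<eta> \<longleftrightarrow> (\<forall>l. l \<noteq> 0 \<longrightarrow> weyl_act \<eta> l = \<eta> l)"


lemma matrix_inv_weyl_w: "matrix_inv weyl_w = mat2 0 1 (- 1) (0 :: 'a::field)"
proof -
  have 1: "weyl_w ** mat2 0 1 (- 1) 0 = (mat 1 :: 'a^2^2)"
    and 2: "mat2 0 1 (- 1) 0 ** weyl_w = (mat 1 :: 'a^2^2)"
    by (simp_all add: weyl_w_def mat2_def matrix_matrix_mult_def mat_def vec_eq_iff sum_2 forall_2)
  have "B = mat2 0 1 (- 1) 0" if "weyl_w ** B = mat 1 \<and> B ** weyl_w = mat 1" for B :: "'a^2^2"
  proof -
    have "B = (mat2 0 1 (- 1) 0 ** weyl_w) ** B"
      by (simp only: 2 matrix_mul_lid)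
    also have "\<dots> = mat2 0 1 (- 1) 0 ** (weyl_w ** B)"
      by (rule matrix_mul_assoc[symmetric])
    also have "\<dots> = mat2 0 1 (- 1) 0"
      using that by simp
    finally show ?thesis .
  qed
  note uniq = this
  show ?thesis
    unfolding matrix_inv_def
  proof (rule some_equality)
    show "weyl_w ** mat2 0 1 (- 1) 0 = (mat 1 :: 'a^2^2) \<and> mat2 0 1 (- 1) 0 ** weyl_w = (mat 1 :: 'a^2^2)"
      by (rule conjI[OF 1 2])
  qed (rule uniq)
qed

lemma weyl_act_eq: "weyl_act \<eta> l = \<eta> (inverse l)"
  unfolding weyl_act_def matrix_inv_weyl_w
  by (simp add: weyl_w_def diag_L_def levi_def mat2_def matrix_matrix_mult_def sum_2)


subsection \<open>Haar measure on the maximal compact subgroup\<close>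

text \<open>The conjugation of \<open>F\<close>: the identity for the reals and \<^term>\<open>cnj\<close> for the complex numbers.\<close>
definition conj_F :: "'a::real_normed_field \<Rightarrow> 'a" where
  "conj_F x = of_real ((norm x)\<^sup>2) * inverse x"

lemma conj_F_real [simp]: "conj_F (x::real) = x"
  by (cases "x = 0") (simp_all add: conj_F_def power2_eq_square)

lemma conj_F_complex [simp]: "conj_F (z::complex) = cnj z"
proof (cases "z = 0")
  case False
  have "conj_F z = (z * cnj z) * inverse z"
    unfolding conj_F_def complex_norm_square ..
  with False show ?thesis
    by simp
qed (simp add: conj_F_def)

text \<open>
  For \<open>v\<close> in the unit sphere of \<open>F\<^sup>2\<close>, \<open>K_elt v\<close> is the unique element of \<open>K\<close>, that is of \<open>SO(2)\<close> or
  \<open>SU(2)\<close>, with first column \<open>v\<close>.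
\<close>
definition K_elt :: "'a::real_normed_field^2 \<Rightarrow> 'a^2^2" where
  "K_elt v = mat2 (v $ 1) (- conj_F (v $ 2)) (v $ 2) (conj_F (v $ 1))"

lemma K_elt_in_SL2:
  assumes "norm v = 1"
  shows "K_elt v \<in> SL2"
proof -
  have c: "x * conj_F x = of_real ((norm x)\<^sup>2)" for x :: 'a
    by (cases "x = 0") (simp_all add: conj_F_def)
  have "(norm (v $ 1))\<^sup>2 + (norm (v $ 2))\<^sup>2 = 1"
    using assms by (simp add: norm_vec_def L2_set_def sum_2)
  then have "(of_real ((norm (v $ 1))\<^sup>2) + of_real ((norm (v $ 2))\<^sup>2) :: 'a) = 1"
    by (metis of_real_1 of_real_add)
  then show ?thesis
    by (simp add: SL2_def K_elt_def mat2_def det_2 c mult.commute[of "conj_F _"])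
qed

text \<open>
  \<open>K\<close> acts simply transitively on the unit sphere of \<open>F\<^sup>2\<close>, and it preserves the unit ball and its
  Lebesgue measure. Hence the image of the uniform distribution on the unit ball under radial
  projection to the sphere is the normalised Haar measure on \<open>K\<close>. (The origin is a null set.)
\<close>
definition haar_K :: "('a::{real_normed_field, euclidean_space}^2^2) measure" where
  "haar_K = distr (uniform_measure lborel (ball (0 :: 'a^2) 1)) borel (\<lambda>v. K_elt (sgn v))"


lemma K_elt_measurable:
  "(\<lambda>v :: 'a::{real_normed_field, euclidean_space}^2. K_elt (sgn v)) \<in> borel_measurable borel"
proof -
  have conj: "conj_F \<in> borel_measurable (borel :: 'a measure)"
    unfolding conj_F_def by measurable
  have sgn: "(\<lambda>v :: 'a^2. sgn v) \<in> borel_measurable borel"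
    unfolding sgn_div_norm by measurable
  have comp: "(\<lambda>v :: 'a^2. sgn v $ i) \<in> borel_measurable borel" for i
    by (rule measurable_compose[OF sgn borel_measurable_continuous_onI])
      (intro continuous_on_component continuous_on_id)
  have mat: "(\<lambda>(a, b, c, d). mat2 a b c d) \<in> borel_measurable (borel :: ('a \<times> 'a \<times> 'a \<times> 'a) measure)"
  proof (rule borel_measurable_continuous_onI)
    have "(\<lambda>(a, b, c, d). mat2 a b c d) = (\<lambda>x :: 'a \<times> 'a \<times> 'a \<times> 'a. \<chi> i j.
        if i = 1 then if j = 1 then fst x else fst (snd x)
        else if j = 1 then fst (snd (snd x)) else snd (snd (snd x)))"
      by (auto simp: mat2_def vec_eq_iff forall_2)
    moreover have "continuous_on UNIV \<dots>"
    proof (intro continuous_on_vec_lambda)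
      fix i j :: 2
      show "continuous_on UNIV (\<lambda>x :: 'a \<times> 'a \<times> 'a \<times> 'a.
          if i = 1 then if j = 1 then fst x else fst (snd x)
          else if j = 1 then fst (snd (snd x)) else snd (snd (snd x)))"
        by (cases "i = 1"; cases "j = 1"; simp only: simp_thms if_True if_False)
          (intro continuous_on_fst continuous_on_snd continuous_on_id)+
    qed
    ultimately show "continuous_on UNIV (\<lambda>(a, b, c, d). mat2 a b c d :: 'a^2^2)"
      by (simp only:)
  qed
  have tuple: "(\<lambda>v :: 'a^2. (sgn v $ 1, - conj_F (sgn v $ 2), sgn v $ 2, conj_F (sgn v $ 1)))
      \<in> borel_measurable borel"
    by (intro borel_measurable_Pair borel_measurable_uminus comp measurable_compose[OF comp conj])
  show ?thesis
    using measurable_compose[OF tuple mat] by (simp add: K_elt_def)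
qed


subsection \<open>Principal series\<close>

text \<open>
  The induced picture of unitary parabolic induction from \<open>P\<close>: functions on \<open>G\<close> with
  \<open>f (g p) = \<delta>\<^sub>P(p) powr (-1/2) * \<eta>(l)\<^sup>-\<^sup>1 * f g\<close> for \<open>p\<close> in \<open>P\<close> with \<open>L\<close>-component \<open>l\<close>, square integrable
  over \<open>K\<close>, with \<open>G\<close> acting by left translation. Conjugation by \<open>l\<close> multiplies the coordinate of \<open>N\<close>
  by \<open>l\<^sup>2\<close>, so \<open>\<delta>\<^sub>P(p) = norm l ^ (2 * DIM('a))\<close>. Functions on \<open>G\<close> are extended by zero to all
  matrices. Functions at distance zero are not identified; see \<open>reducible_rep\<close>.
\<close>
definition ps_space ::
    "('a::{real_normed_field, euclidean_space} \<Rightarrow> complex) \<Rightarrow> ('a^2^2 \<Rightarrow> complex) set" where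
  "ps_space \<eta> = {f \<in> borel_measurable borel.
     (\<forall>g. g \<notin> SL2 \<longrightarrow> f g = 0) \<and>
     (\<forall>g\<in>SL2. \<forall>p\<in>upper_P.
        f (g ** p) = inverse (of_real (norm (levi p) ^ DIM('a))) * inverse (\<eta> (levi p)) * f g) \<and>
     integrable haar_K (\<lambda>k. (norm (f k))\<^sup>2)}"

definition ps_norm :: "('a::{real_normed_field, euclidean_space}^2^2 \<Rightarrow> complex) \<Rightarrow> real" where
  "ps_norm f = sqrt (\<integral>k. (norm (f k))\<^sup>2 \<partial>haar_K)"

definition left_translate :: "'a::field^2^2 \<Rightarrow> ('a^2^2 \<Rightarrow> complex) \<Rightarrow> 'a^2^2 \<Rightarrow> complex" where
  "left_translate h f = (\<lambda>g. f (matrix_inv h ** g))"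

text \<open>
  Topological reducibility of a representation \<open>\<pi>\<close> of \<open>G\<close> on a space \<open>V\<close> of complex functions with
  seminorm \<open>N\<close>: existence of a closed invariant subspace that is neither zero nor everything. A
  closed \<open>W\<close> contains every element of seminorm zero, so such subspaces \<open>W\<close> correspond to the closed
  invariant subspaces of the quotient of \<open>V\<close> by the elements of seminorm zero.
\<close>
definition reducible_rep ::
    "'g set \<Rightarrow> ('g \<Rightarrow> ('x \<Rightarrow> complex) \<Rightarrow> 'x \<Rightarrow> complex) \<Rightarrow> ('x \<Rightarrow> complex) set
      \<Rightarrow> (('x \<Rightarrow> complex) \<Rightarrow> real) \<Rightarrow> bool" where
  "reducible_rep G \<pi> V N \<longleftrightarrow> (\<exists>W \<subseteq> V.
     (\<lambda>_. 0) \<in> W \<and>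
     (\<forall>f\<in>W. \<forall>g\<in>W. (\<lambda>x. f x + g x) \<in> W) \<and>
     (\<forall>c. \<forall>f\<in>W. (\<lambda>x. c * f x) \<in> W) \<and>
     (\<forall>f\<in>V. (\<forall>e>0. \<exists>g\<in>W. N (\<lambda>x. f x - g x) < e) \<longrightarrow> f \<in> W) \<and>
     (\<forall>h\<in>G. \<forall>f\<in>W. \<pi> h f \<in> W) \<and>
     (\<exists>f\<in>W. N f \<noteq> 0) \<and>
     W \<noteq> V)"

definition principal_series_reducible ::
    "('a::{real_normed_field, euclidean_space} \<Rightarrow> complex) \<Rightarrow> real \<Rightarrow> bool" where
  "principal_series_reducible \<sigma> t \<longleftrightarrow>
     reducible_rep SL2 left_translate (ps_space (L_char \<sigma> t)) ps_norm"


subsection \<open>The residual distribution and its Fourier transform\<close>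

text \<open>Haar measure on \<open>L\<close>, as a measure on \<open>F\<close> for which the origin is a null set.\<close>
definition haar_L :: "('a::{real_normed_field, euclidean_space}) measure" where
  "haar_L = density lborel (\<lambda>t. ennreal (1 / norm t ^ DIM('a)))"

definition T_w :: "('a::{real_normed_field, euclidean_space} \<Rightarrow> complex) \<Rightarrow> complex" where
  "T_w \<phi> = (LINT t:{t. norm t < 1}|haar_L. \<phi> (inverse (levi (matrix_inv weyl_w ** nbar t))))"

lemma T_w_eq: "T_w \<phi> = (LINT t:{t. norm t < 1}|haar_L. \<phi> (inverse t))"
  by (simp add: T_w_def matrix_inv_weyl_w nbar_def levi_def mat2_def matrix_matrix_mult_def sum_2)

text \<open>
  For a function \<open>S\<close> on \<open>L\<close>, the Fourier transform at \<open>(\<sigma>, \<nu>\<^sub>t)\<close> is the integral of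
  \<open>S(l) * cnj (L_char \<sigma> t l)\<close> against \<^const>\<open>haar_L\<close>; over the complex numbers, the Haar measure is
  \<open>dr/r d\<theta>\<close> in polar coordinates. For fixed \<open>\<sigma>\<close>, its transpose maps a test function \<open>\<psi>\<close> of \<open>t\<close> to
  the following function on \<open>L\<close>.
\<close>
definition fourier_L_transpose ::
    "('a::real_normed_field \<Rightarrow> complex) \<Rightarrow> (real \<Rightarrow> complex) \<Rightarrow> 'a \<Rightarrow> complex" where
  "fourier_L_transpose \<sigma> \<psi> l = (\<integral>t. \<psi> t * cnj (L_char \<sigma> t l) \<partial>lborel)"

definition fourier_L_Tw ::
    "('a::{real_normed_field, euclidean_space} \<Rightarrow> complex) \<Rightarrow> (real \<Rightarrow> complex) \<Rightarrow> complex" where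
  "fourier_L_Tw \<sigma> \<psi> = T_w (fourier_L_transpose \<sigma> \<psi>)"

definition smooth_fun :: "(real \<Rightarrow> complex) \<Rightarrow> bool" where
  "smooth_fun \<psi> \<longleftrightarrow> (\<exists>D :: nat \<Rightarrow> real \<Rightarrow> complex. D 0 = \<psi> \<and>
     (\<forall>n x. (D n has_vector_derivative D (Suc n) x) (at x)))"

definition test_fun_on :: "real set \<Rightarrow> (real \<Rightarrow> complex) \<Rightarrow> bool" where
  "test_fun_on U \<psi> \<longleftrightarrow> smooth_fun \<psi> \<and> compact (closure {x. \<psi> x \<noteq> 0}) \<and> closure {x. \<psi> x \<noteq> 0} \<subseteq> U"

text \<open>A distribution on the real line, as a functional on test functions, vanishes at \<open>t0\<close> if it
  vanishes in a neighbourhood of \<open>t0\<close>.\<close>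
definition distribution_vanishes_at :: "((real \<Rightarrow> complex) \<Rightarrow> complex) \<Rightarrow> real \<Rightarrow> bool" where
  "distribution_vanishes_at u t0 \<longleftrightarrow>
     (\<exists>U. open U \<and> t0 \<in> U \<and> (\<forall>\<psi>. test_fun_on U \<psi> \<longrightarrow> u \<psi> = 0))"

end

theory Submission
  imports Defs "HOL-Computational_Algebra.Polynomial"
begin

text \<open>
  A Weyl-fixed character is quadratic, so \<open>t = 0\<close> and \<open>\<sigma>\<close> is trivial or, over the reals, the sign.

  For the sign character the residual distribution is even and pairs to zero with odd functions.
  The functions \<open>1 / (a x + b y)\<close> of the first column \<open>(x, y)\<close>, with \<open>b / a\<close> in the upper half-plane,
  are permuted by the group, and the bilinear pairing over \<open>K\<close> is invariant; their annihilator is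
  a proper closed invariant subspace (a Hardy space).

  For trivial \<open>\<sigma>\<close> the Fourier transform of the indicator function of the half-line is singular at 0:
  it does not vanish on \<open>s \<beta>(s)\<close>, where \<open>\<beta>\<close> is a bump. On the other side, every
  closed invariant subspace is stable under averaging over \<open>K\<close>, hence contains the \<open>K\<close>-fixed vector
  or is orthogonal to it and to all its translates. The \<open>K\<close>-fixed vector is cyclic: its
  translates by \<open>k diag(r, 1/r)\<close> are kernels \<open>(s + (1 - s) \<bar>u \<and> v\<bar>\<^sup>2)\<close> to the power
  \<open>- d/2\<close> on the projective line, with \<open>s = r\<close> to the power \<open>-4\<close>. As \<open>s\<close> tends to 0
  their mass diverges, so that after normalisation they form an approximate identity.
\<close>

subsection \<open>Linear algebra over \<open>F\<close>\<close>

text \<open>The exponent is decisive at \<open>t = 0\<close>. The projective line has real dimension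
  \<open>d\<close>, and the limit of the kernels, \<open>norm (wedge u v)\<close> to the power
  \<open>- d\<close>, only just fails to be integrable: it diverges logarithmically at the line of
  \<open>u\<close> and is bounded away from it, so the normalised mass must concentrate there.
  Averaging \<open>f\<close> over \<open>K\<close> gives the spherical vector times the integral of
  \<open>f\<close>, which is the Hermitian product of \<open>f\<close> with the spherical vector. By
  unitarity, if it vanishes for all translates of \<open>f\<close>, then \<open>f\<close> is
  orthogonal to all translates of the spherical vector; cyclicity excludes this for nonzero
  \<open>f\<close>. For the sign character, functions from the same half-plane pair to zero because
  their product has only positive frequencies, while functions from opposite half-planes can pair to
  a nonzero number. On the half-line the transform is formally half a point mass at 0 plus a
  multiple of \<open>1/s\<close>. The factor \<open>s\<close> of the test function kills the first
  and cancels the pole of the second, leaving the integral of \<open>\<beta>\<close>.\<close>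

lemma inner_mult_left_conj_F:
  fixes a x y :: "'a::{real_normed_field, euclidean_space}"
  shows "(a * x) \<bullet> y = x \<bullet> (conj_F a * y)"
proof (cases "a = 0")
  case True
  then show ?thesis by (simp add: conj_F_def)
next
  case False
  \<comment> \<open>The norm of the field is both Euclidean and multiplicative, so polarization
    shows that multiplication by \<open>a\<close> multiplies inner products by
    \<open>(norm a)\<^sup>2\<close>. This treats both fields at once, without coordinates.\<close>
  have polar: "u \<bullet> v = ((norm (u + v))\<^sup>2 - (norm (u - v))\<^sup>2) / 4" for u v :: 'a
    by (simp add: power2_norm_eq_inner inner_simps inner_commute)
  have mult: "(a * u) \<bullet> (a * v) = (norm a)\<^sup>2 * (u \<bullet> v)" for u v :: 'a
    unfolding polar distrib_left[symmetric] right_diff_distrib[symmetric] norm_mult power_mult_distrib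
    by (simp add: algebra_simps)
  have "(a * x) \<bullet> y = (a * x) \<bullet> (a * (inverse a * y))"
    using False by (simp add: mult.assoc[symmetric])
  also have "\<dots> = (norm a)\<^sup>2 * (x \<bullet> (inverse a * y))"
    by (rule mult)
  also have "\<dots> = x \<bullet> (conj_F a * y)"
    by (simp only: conj_F_def scaleR_conv_of_real[symmetric] scaleR_scaleR mult_scaleR_left inner_scaleR_right)
  finally show ?thesis .
qed

lemma conj_F_inner: "x \<bullet> conj_F a = (a * x) \<bullet> 1" for a x :: "'a::{real_normed_field, euclidean_space}"
  using inner_mult_left_conj_F[of a x 1] by simp

text \<open>Additivity is hidden by the inverse in \<open>conj_F\<close>. It appears once
  \<open>conj_F a\<close> is characterised as the vector representing the functional that maps
  \<open>x\<close> to \<open>(a * x) \<bullet> 1\<close>, which depends linearly on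
  \<open>a\<close>.\<close>

lemma conj_F_add: "conj_F (x + y) = conj_F x + conj_F y"
  for x y :: "'a::{real_normed_field, euclidean_space}"
proof -
  have "z \<bullet> conj_F (x + y) = z \<bullet> (conj_F x + conj_F y)" for z
    by (simp add: conj_F_inner inner_simps distrib_right)
  then show ?thesis
    by (metis vector_eq_rdot inner_commute)
qed

lemma conj_F_minus: "conj_F (- x) = - conj_F x" for x :: "'a::real_normed_field"
  by (simp add: conj_F_def)

lemma conj_F_diff: "conj_F (x - y) = conj_F x - conj_F y"
  for x y :: "'a::{real_normed_field, euclidean_space}"
  using conj_F_add[of x "- y"] by (simp add: conj_F_minus)

lemma conj_F_mult: "conj_F (x * y) = conj_F x * conj_F y" for x y :: "'a::real_normed_field"
  by (simp add: conj_F_def norm_mult power_mult_distrib)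

lemma norm_conj_F [simp]: "norm (conj_F x) = norm x" for x :: "'a::real_normed_field"
proof (cases "x = 0")
  case False
  then show ?thesis
    unfolding conj_F_def by (simp add: norm_mult norm_inverse power2_eq_square del: of_real_power)
qed (simp add: conj_F_def)

lemma conj_F_conj_F [simp]: "conj_F (conj_F x) = x" for x :: "'a::real_normed_field"
proof (cases "x = 0")
  case False
  have "conj_F (conj_F x) = of_real ((norm x)\<^sup>2) * inverse (of_real ((norm x)\<^sup>2) * inverse x)"
    unfolding conj_F_def[of "conj_F x"] norm_conj_F unfolding conj_F_def ..
  also have "\<dots> = x"
    using False by simp
  finally show ?thesis .
qed (simp add: conj_F_def)

lemma mult_conj_F: "x * conj_F x = of_real ((norm x)\<^sup>2)" for x :: "'a::real_normed_field"
  by (cases "x = 0") (simp_all add: conj_F_def)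

lemma vec2_eq_iff: "v = w \<longleftrightarrow> v $ 1 = w $ 1 \<and> v $ 2 = w $ 2" for v w :: "'a^2"
  by (simp add: vec_eq_iff forall_2)

lemma norm_vec2: "(norm v)\<^sup>2 = (norm (v $ 1))\<^sup>2 + (norm (v $ 2))\<^sup>2"
  for v :: "'a::real_normed_vector^2"
  by (simp add: norm_vec_def L2_set_def sum_2)

lemma matrix_vector_mult_2:
  "(A *v v) $ 1 = A $ 1 $ 1 * v $ 1 + A $ 1 $ 2 * v $ 2"
  "(A *v v) $ 2 = A $ 2 $ 1 * v $ 1 + A $ 2 $ 2 * v $ 2"
  for A :: "'a::semiring_1^2^2"
  by (simp_all add: matrix_vector_mult_def sum_2)

lemma matrix_matrix_mult_2:
  "(A ** B) $ i $ j = A $ i $ 1 * B $ 1 $ j + A $ i $ 2 * B $ 2 $ j"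
  for A B :: "'a::semiring_1^2^2"
  by (simp add: matrix_matrix_mult_def sum_2)

lemma mat2_nth [simp]:
  "mat2 a b c d $ 1 $ 1 = a" "mat2 a b c d $ 1 $ 2 = b"
  "mat2 a b c d $ 2 $ 1 = c" "mat2 a b c d $ 2 $ 2 = d"
  by (simp_all add: mat2_def)

lemma SL2_iff: "g \<in> SL2 \<longleftrightarrow> g $ 1 $ 1 * g $ 2 $ 2 - g $ 1 $ 2 * g $ 2 $ 1 = 1"
  by (simp add: SL2_def det_2)

lemma mat2_in_SL2: "mat2 a b c d \<in> SL2 \<longleftrightarrow> a * d - b * c = 1"
  by (simp add: SL2_iff)

lemma SL2_mult: "g \<in> SL2 \<Longrightarrow> h \<in> SL2 \<Longrightarrow> g ** h \<in> SL2"
  by (simp add: SL2_def det_mul)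

lemma SL2_mult_inv:
  fixes g :: "'a::field^2^2"
  assumes "g \<in> SL2"
  shows "g ** matrix_inv g = mat 1" "matrix_inv g ** g = mat 1"
proof -
  have "invertible g"
    using assms by (simp add: SL2_def invertible_det_nz)
  then have "\<exists>B. g ** B = mat 1 \<and> B ** g = mat 1"
    by (simp add: invertible_def)
  from someI_ex[OF this] show "g ** matrix_inv g = mat 1" "matrix_inv g ** g = mat 1"
    by (simp_all add: matrix_inv_def)
qed

lemma SL2_inv_eq:
  fixes g :: "'a::field^2^2"
  assumes "g \<in> SL2"
  shows "matrix_inv g = mat2 (g $ 2 $ 2) (- (g $ 1 $ 2)) (- (g $ 2 $ 1)) (g $ 1 $ 1)"
proof -
  have "mat2 (g $ 2 $ 2) (- (g $ 1 $ 2)) (- (g $ 2 $ 1)) (g $ 1 $ 1) ** g = mat 1"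
    using assms unfolding SL2_iff
    by (simp add: vec2_eq_iff matrix_matrix_mult_2 mat_def algebra_simps)
  then have "mat2 (g $ 2 $ 2) (- (g $ 1 $ 2)) (- (g $ 2 $ 1)) (g $ 1 $ 1) ** (g ** matrix_inv g) = matrix_inv g"
    by (simp add: matrix_mul_assoc)
  then show ?thesis
    by (simp add: SL2_mult_inv(1)[OF assms])
qed

lemma SL2_inv: "g \<in> SL2 \<Longrightarrow> matrix_inv g \<in> SL2" for g :: "'a::field^2^2"
  using SL2_inv_eq[of g] by (simp add: SL2_iff algebra_simps)

lemma SL2_inv_mult:
  fixes g h :: "'a::field^2^2"
  assumes "g \<in> SL2" "h \<in> SL2"
  shows "matrix_inv (g ** h) = matrix_inv h ** matrix_inv g"
  unfolding SL2_inv_eq[OF assms(1)] SL2_inv_eq[OF assms(2)] SL2_inv_eq[OF SL2_mult[OF assms]]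
  by (simp add: vec2_eq_iff matrix_matrix_mult_2 algebra_simps)

lemma SL2_mult_cancel:
  fixes g :: "'a::field^2^2"
  assumes "g \<in> SL2"
  shows "matrix_inv g ** (g ** x) = x" "g ** (matrix_inv g ** x) = x"
  by (simp_all add: matrix_mul_assoc SL2_mult_inv[OF assms])

lemma SL2_inv_inv: "g \<in> SL2 \<Longrightarrow> matrix_inv (matrix_inv g) = g" for g :: "'a::field^2^2"
  using SL2_mult_cancel(2)[of g "matrix_inv (matrix_inv g)"] by (simp add: SL2_mult_inv(1)[OF SL2_inv])

lemma SL2_mult_vec_cancel:
  fixes g :: "'a::field^2^2"
  assumes "g \<in> SL2"
  shows "matrix_inv g *v (g *v x) = x" "g *v (matrix_inv g *v x) = x"
  by (simp_all add: matrix_vector_mul_assoc SL2_mult_inv[OF assms])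

lemma SL2_mult_vec_eq_0: "g \<in> SL2 \<Longrightarrow> g *v v = 0 \<longleftrightarrow> v = 0" for g :: "'a::field^2^2"
  by (metis SL2_mult_vec_cancel(1) matrix_vector_mult_0_right)

lemma column_mult: "column j (A ** B) = A *v column j B" for A B :: "'a::semiring_1^2^2"
  by (simp add: vec_eq_iff forall_2 column_def matrix_matrix_mult_2 matrix_vector_mult_2)

lemma column_1_nonzero: "g \<in> SL2 \<Longrightarrow> column 1 g \<noteq> 0" for g :: "'a::field^2^2"
  by (auto simp: vec_eq_iff forall_2 column_def SL2_iff)

lemma column_K_elt [simp]: "column 1 (K_elt v) = v"
  by (simp add: vec_eq_iff forall_2 column_def K_elt_def)

text \<open>\<open>K\<close> acts by isometries, by the adjointness of multiplication by \<open>a\<close> and by \<open>conj_F a\<close>.\<close>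
lemma norm_K_elt_mult:
  fixes u v :: "'a::{real_normed_field, euclidean_space}^2"
  assumes "norm u = 1"
  shows "norm (K_elt u *v v) = norm v"
proof -
  let ?a = "u $ 1" and ?b = "u $ 2" and ?x = "v $ 1" and ?y = "v $ 2"
  have 1: "(norm ?a)\<^sup>2 + (norm ?b)\<^sup>2 = 1"
    using assms norm_vec2[of u] by simp
  have "(conj_F ?b * ?y) \<bullet> (?a * ?x) = (?a * ?x) \<bullet> (conj_F ?b * ?y)"
    by (rule inner_commute)
  also have "\<dots> = (?b * (?a * ?x)) \<bullet> ?y"
    by (rule inner_mult_left_conj_F[symmetric])
  also have "\<dots> = (?a * (?b * ?x)) \<bullet> ?y"
    by (simp add: mult.left_commute)
  also have "\<dots> = (?b * ?x) \<bullet> (conj_F ?a * ?y)"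
    by (rule inner_mult_left_conj_F)
  finally have cross: "(?a * ?x) \<bullet> (conj_F ?b * ?y) = (?b * ?x) \<bullet> (conj_F ?a * ?y)"
    by (simp add: inner_commute)
  have dif: "(norm (p - q))\<^sup>2 = (norm p)\<^sup>2 - 2 * (p \<bullet> q) + (norm q)\<^sup>2"
    and sm: "(norm (p + q))\<^sup>2 = (norm p)\<^sup>2 + 2 * (p \<bullet> q) + (norm q)\<^sup>2" for p q :: 'a
    by (simp_all add: power2_norm_eq_inner inner_simps inner_commute)
  have "(norm (K_elt u *v v))\<^sup>2 = (norm (?a * ?x - conj_F ?b * ?y))\<^sup>2 + (norm (?b * ?x + conj_F ?a * ?y))\<^sup>2"
    by (simp add: norm_vec2 matrix_vector_mult_2 K_elt_def)
  also have "\<dots> = ((norm ?a)\<^sup>2 + (norm ?b)\<^sup>2) * ((norm ?x)\<^sup>2 + (norm ?y)\<^sup>2)"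
    unfolding dif sm cross norm_mult power_mult_distrib norm_conj_F by algebra
  also have "\<dots> = (norm v)\<^sup>2"
    by (simp add: 1 norm_vec2)
  finally show ?thesis
    by simp
qed

text \<open>An element of \<open>K\<close> is determined by its first column, so multiplication in
  \<open>K\<close> is the linear action on unit columns. All later computations in \<open>K\<close>
  go through this identification.\<close>

lemma K_elt_mult:
  fixes u v :: "'a::{real_normed_field, euclidean_space}^2"
  shows "K_elt u ** K_elt v = K_elt (K_elt u *v v)"
  by (simp add: vec2_eq_iff matrix_matrix_mult_2 matrix_vector_mult_2 K_elt_def conj_F_add conj_F_diff conj_F_mult conj_F_minus algebra_simps)

lemma K_elt_inv:
  fixes u :: "'a::{real_normed_field, euclidean_space}^2"
  assumes "norm u = 1"
  shows "matrix_inv (K_elt u) = K_elt (vector [conj_F (u $ 1), - (u $ 2)])"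
  unfolding SL2_inv_eq[OF K_elt_in_SL2[OF assms]] by (simp add: vec2_eq_iff K_elt_def conj_F_minus)

subsection \<open>Lebesgue measure on \<open>F\<^sup>2\<close> and Haar measure on \<open>K\<close>\<close>

lemma borel_measurable_vec_nth [measurable (raw)]:
  fixes f :: "'b \<Rightarrow> 'a::{second_countable_topology, real_normed_vector}^'n"
  assumes "f \<in> borel_measurable M"
  shows "(\<lambda>x. f x $ i) \<in> borel_measurable M"
  by (rule measurable_compose[OF assms borel_measurable_continuous_onI])
    (intro continuous_on_component continuous_on_id)

lemma borel_measurable_vector2 [measurable (raw)]:
  fixes f g :: "'b \<Rightarrow> 'a::{euclidean_space}"
  assumes "f \<in> borel_measurable M" "g \<in> borel_measurable M"
  shows "(\<lambda>x. vector [f x, g x] :: 'a^2) \<in> borel_measurable M"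
proof -
  have "continuous_on UNIV (\<lambda>p :: 'a \<times> 'a. vector [fst p, snd p] :: 'a^2)"
  proof -
    have "(\<lambda>p :: 'a \<times> 'a. vector [fst p, snd p] :: 'a^2) = (\<lambda>p. \<chi> i. if i = 1 then fst p else snd p)"
      by (simp add: vec2_eq_iff fun_eq_iff)
    moreover have "continuous_on UNIV \<dots>"
    proof (intro continuous_on_vec_lambda)
      fix i :: 2
      show "continuous_on UNIV (\<lambda>p :: 'a \<times> 'a. if i = 1 then fst p else snd p)"
        by (cases "i = 1") (simp_all only: simp_thms if_True if_False continuous_on_fst continuous_on_snd continuous_on_id)
    qed
    ultimately show ?thesis
      by (simp only:)
  qed
  from measurable_compose[OF borel_measurable_Pair[OF assms] borel_measurable_continuous_onI[OF this]]
  show ?thesis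
    by simp
qed

lemma borel_measurable_vector2_prod [measurable]:
  "(\<lambda>p. vector [fst p, snd p] :: 'a^2) \<in> borel_measurable (borel :: ('a::euclidean_space \<times> 'a) measure)"
  by (rule borel_measurable_vector2)
    (auto intro!: borel_measurable_continuous_onI continuous_on_fst continuous_on_snd continuous_on_id)

lemma matrix_vector_mult_vector:
  "A *v v = vector [A $ 1 $ 1 * v $ 1 + A $ 1 $ 2 * v $ 2, A $ 2 $ 1 * v $ 1 + A $ 2 $ 2 * v $ 2]"
  for A :: "'a::semiring_1^2^2"
  by (simp add: vec2_eq_iff matrix_vector_mult_2)

lemma borel_measurable_matrix_vector_mult [measurable (raw)]:
  fixes A :: "'b \<Rightarrow> 'a::{real_normed_field, euclidean_space}^2^2"
  assumes "A \<in> borel_measurable M" "f \<in> borel_measurable M"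
  shows "(\<lambda>x. A x *v f x) \<in> borel_measurable M"
  unfolding matrix_vector_mult_vector using assms by measurable

lemma borel_measurable_mat2 [measurable (raw)]:
  fixes a b c d :: "'b \<Rightarrow> 'a::{real_normed_field, euclidean_space}"
  assumes "a \<in> borel_measurable M" "b \<in> borel_measurable M" "c \<in> borel_measurable M" "d \<in> borel_measurable M"
  shows "(\<lambda>x. mat2 (a x) (b x) (c x) (d x)) \<in> borel_measurable M"
proof (rule borel_measurable_euclidean_space[THEN iffD2], rule ballI)
  fix e :: "'a^2^2" assume "e \<in> Basis"
  have "(\<lambda>x. mat2 (a x) (b x) (c x) (d x) \<bullet> e) =
     (\<lambda>x. a x \<bullet> (e $ 1 $ 1) + b x \<bullet> (e $ 1 $ 2) + c x \<bullet> (e $ 2 $ 1) + d x \<bullet> (e $ 2 $ 2))"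
    by (simp add: inner_vec_def sum_2 fun_eq_iff)
  then show "(\<lambda>x. mat2 (a x) (b x) (c x) (d x) \<bullet> e) \<in> borel_measurable M"
    using assms by simp
qed

lemma borel_measurable_conj_F [measurable (raw)]:
  fixes f :: "'b \<Rightarrow> 'a::{real_normed_field, euclidean_space}"
  assumes "f \<in> borel_measurable M"
  shows "(\<lambda>x. conj_F (f x)) \<in> borel_measurable M"
  unfolding conj_F_def using assms by measurable

lemma borel_measurable_K_elt [measurable (raw)]:
  fixes f :: "'b \<Rightarrow> 'a::{real_normed_field, euclidean_space}^2"
  assumes "f \<in> borel_measurable M"
  shows "(\<lambda>x. K_elt (f x)) \<in> borel_measurable M"
  unfolding K_elt_def using assms by measurable

lemma borel_measurable_matrix_matrix_mult [measurable (raw)]: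
  fixes A B :: "'b \<Rightarrow> 'a::{real_normed_field, euclidean_space}^2^2"
  assumes "A \<in> borel_measurable M" "B \<in> borel_measurable M"
  shows "(\<lambda>x. A x ** B x) \<in> borel_measurable M"
proof -
  have "A x ** B x = mat2 (A x $ 1 $ 1 * B x $ 1 $ 1 + A x $ 1 $ 2 * B x $ 2 $ 1)
      (A x $ 1 $ 1 * B x $ 1 $ 2 + A x $ 1 $ 2 * B x $ 2 $ 2)
      (A x $ 2 $ 1 * B x $ 1 $ 1 + A x $ 2 $ 2 * B x $ 2 $ 1)
      (A x $ 2 $ 1 * B x $ 1 $ 2 + A x $ 2 $ 2 * B x $ 2 $ 2)" for x
    by (simp add: vec2_eq_iff matrix_matrix_mult_2)
  then show ?thesis
    using assms by simp
qed

lemma borel_measurable_matrix_matrix_mult' [measurable]: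
  "(**) (A :: 'a::{real_normed_field, euclidean_space}^2^2) \<in> borel_measurable (borel :: ('a^2^2) measure)"
  by (rule borel_measurable_matrix_matrix_mult[OF measurable_const measurable_ident_sets[OF refl]]) simp

lemma borel_measurable_sgn [measurable (raw)]:
  fixes f :: "'b \<Rightarrow> 'a::{real_normed_vector, second_countable_topology}"
  assumes "f \<in> borel_measurable M"
  shows "(\<lambda>x. sgn (f x)) \<in> borel_measurable M"
  unfolding sgn_div_norm using assms by measurable

text \<open>Comparison on boxes. Its purpose is Tonelli's theorem in either order on pairs of field
  elements, where the coordinates are themselves Euclidean spaces.\<close>

lemma lborel_vector2:
  "distr lborel borel (\<lambda>p. vector [fst p, snd p]) = (lborel :: ('a::euclidean_space^2) measure)"
proof (rule lborel_eqI[symmetric])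
  fix l u :: "'a^2"
  assume le: "\<And>b. b \<in> Basis \<Longrightarrow> l \<bullet> b \<le> u \<bullet> b"
  have Basis2: "(Basis :: ('a^2) set) = axis 1 ` Basis \<union> axis 2 ` Basis"
    unfolding Basis_vec_def UNIV_2 by auto
  have ax: "v \<bullet> axis i b = (v $ i) \<bullet> b" for v :: "'a^2" and i b
    by (simp add: inner_axis)
  have pre: "(\<lambda>p :: 'a \<times> 'a. vector [fst p, snd p] :: 'a^2) -` box l u = box (l $ 1) (u $ 1) \<times> box (l $ 2) (u $ 2)"
    unfolding box_def Basis2 by (auto simp: ball_Un ax)
  have 1: "\<And>b. b \<in> Basis \<Longrightarrow> l $ i \<bullet> b \<le> u $ i \<bullet> b" for i
    using le[of "axis i _"] by (auto simp: ax)
  have "emeasure (distr lborel borel (\<lambda>p :: 'a \<times> 'a. vector [fst p, snd p] :: 'a^2)) (box l u)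
     = emeasure (lborel \<Otimes>\<^sub>M lborel) (box (l $ 1) (u $ 1) \<times> box (l $ 2) (u $ 2))"
    by (subst emeasure_distr) (simp_all add: pre lborel_prod)
  also have "\<dots> = emeasure lborel (box (l $ 1) (u $ 1)) * emeasure lborel (box (l $ 2) (u $ 2))"
    by (rule lborel.emeasure_pair_measure_Times) simp_all
  also have "\<dots> = (\<Prod>b\<in>Basis. (u - l) $ 1 \<bullet> b) * (\<Prod>b\<in>Basis. (u - l) $ 2 \<bullet> b)"
    using 1 by (simp add: prod_nonneg inner_diff_left ennreal_mult)
  also have "\<dots> = (\<Prod>b\<in>Basis. (u - l) \<bullet> b)"
    unfolding Basis2
    by (subst prod.union_disjoint)
      (auto simp: prod.reindex inj_on_def axis_eq_axis ax)
  finally show "emeasure (distr lborel borel (\<lambda>p :: 'a \<times> 'a. vector [fst p, snd p] :: 'a^2)) (box l u)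
     = (\<Prod>b\<in>Basis. (u - l) \<bullet> b)" .
qed simp

lemma nn_integral_lborel_vector2:
  fixes f :: "'a::euclidean_space^2 \<Rightarrow> ennreal"
  assumes [measurable]: "f \<in> borel_measurable borel"
  shows "(\<integral>\<^sup>+v. f v \<partial>lborel) = (\<integral>\<^sup>+y. \<integral>\<^sup>+x. f (vector [x, y]) \<partial>lborel \<partial>lborel)"
    and "(\<integral>\<^sup>+v. f v \<partial>lborel) = (\<integral>\<^sup>+x. \<integral>\<^sup>+y. f (vector [x, y]) \<partial>lborel \<partial>lborel)"
proof -
  have m: "(\<lambda>p. f (vector [fst p, snd p])) \<in> borel_measurable (lborel \<Otimes>\<^sub>M lborel)"
    unfolding lborel_prod by measurable
  have "(\<integral>\<^sup>+v. f v \<partial>lborel) = (\<integral>\<^sup>+p. f (vector [fst p, snd p]) \<partial>(lborel \<Otimes>\<^sub>M lborel))"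
    unfolding lborel_vector2[symmetric] lborel_prod by (rule nn_integral_distr) simp_all
  note eq = this
  show "(\<integral>\<^sup>+v. f v \<partial>lborel) = (\<integral>\<^sup>+x. \<integral>\<^sup>+y. f (vector [x, y]) \<partial>lborel \<partial>lborel)"
    unfolding eq lborel.nn_integral_fst[OF m, symmetric] by simp
  show "(\<integral>\<^sup>+v. f v \<partial>lborel) = (\<integral>\<^sup>+y. \<integral>\<^sup>+x. f (vector [x, y]) \<partial>lborel \<partial>lborel)"
    unfolding eq by (subst lborel_pair.nn_integral_snd[symmetric]) (use m in \<open>simp_all add: case_prod_beta\<close>)
qed

lemma nn_integral_lborel_translate:
  fixes f :: "'a::euclidean_space \<Rightarrow> ennreal"
  assumes [measurable]: "f \<in> borel_measurable borel"
  shows "(\<integral>\<^sup>+x. f (x + t) \<partial>lborel) = (\<integral>\<^sup>+x. f x \<partial>lborel)"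
  by (subst (2) lborel_distr_plus[symmetric, of t], subst nn_integral_distr) (simp_all add: add.commute)

lemma nn_integral_lborel_scale:
  fixes f :: "'a::euclidean_space \<Rightarrow> ennreal"
  assumes [measurable]: "f \<in> borel_measurable borel" and "c > 0"
  shows "(\<integral>\<^sup>+x. f x \<partial>lborel) = ennreal (c ^ DIM('a)) * (\<integral>\<^sup>+x. f (c *\<^sub>R x) \<partial>lborel)"
  using \<open>c > 0\<close>
  by (subst lborel_affine[of c 0])
    (simp_all add: nn_integral_density nn_integral_distr nn_integral_cmult)

text \<open>For a fixed value of one coordinate a shear is a translation in the other one, and
  shears generate the group. No determinant formula over the real numbers has to be matched with the
  determinant over the field.\<close>

lemma nn_integral_lborel_SL2:
  fixes f :: "'a::{real_normed_field, euclidean_space}^2 \<Rightarrow> ennreal"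
  assumes g: "g \<in> SL2" and f: "f \<in> borel_measurable borel"
  shows "(\<integral>\<^sup>+v. f (g *v v) \<partial>lborel) = (\<integral>\<^sup>+v. f v \<partial>lborel)"
proof -
  define P where "P g \<longleftrightarrow> (\<forall>f :: 'a^2 \<Rightarrow> ennreal. f \<in> borel_measurable borel \<longrightarrow>
    (\<integral>\<^sup>+v. f (g *v v) \<partial>lborel) = (\<integral>\<^sup>+v. f v \<partial>lborel))" for g :: "'a^2^2"
  have mult: "P (g ** h)" if "P g" "P h" for g h
    unfolding P_def
  proof (intro allI impI)
    fix f :: "'a^2 \<Rightarrow> ennreal" assume [measurable]: "f \<in> borel_measurable borel"
    have "(\<integral>\<^sup>+v. f (g ** h *v v) \<partial>lborel) = (\<integral>\<^sup>+v. f (g *v (h *v v)) \<partial>lborel)"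
      by (simp add: matrix_vector_mul_assoc)
    also have "\<dots> = (\<integral>\<^sup>+v. f (g *v v) \<partial>lborel)"
      using \<open>P h\<close> unfolding P_def by (elim allE[of _ "\<lambda>v. f (g *v v)"] impE) simp_all
    also have "\<dots> = (\<integral>\<^sup>+v. f v \<partial>lborel)"
      using \<open>P g\<close> unfolding P_def by simp
    finally show "(\<integral>\<^sup>+v. f (g ** h *v v) \<partial>lborel) = (\<integral>\<^sup>+v. f v \<partial>lborel)" .
  qed
  have upper: "P (mat2 1 x 0 1)" for x
    unfolding P_def
  proof (intro allI impI)
    fix f :: "'a^2 \<Rightarrow> ennreal" assume [measurable]: "f \<in> borel_measurable borel"
    show "(\<integral>\<^sup>+v. f (mat2 1 x 0 1 *v v) \<partial>lborel) = (\<integral>\<^sup>+v. f v \<partial>lborel)"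
      using nn_integral_lborel_translate[of "\<lambda>z. f (vector [z, y])" "x * y" for y]
      by (simp add: nn_integral_lborel_vector2(1) matrix_vector_mult_vector)
  qed
  have lower: "P (mat2 1 0 x 1)" for x
    unfolding P_def
  proof (intro allI impI)
    fix f :: "'a^2 \<Rightarrow> ennreal" assume [measurable]: "f \<in> borel_measurable borel"
    show "(\<integral>\<^sup>+v. f (mat2 1 0 x 1 *v v) \<partial>lborel) = (\<integral>\<^sup>+v. f v \<partial>lborel)"
      using nn_integral_lborel_translate[of "\<lambda>z. f (vector [y, z])" "x * y" for y]
      by (simp add: nn_integral_lborel_vector2(2) matrix_vector_mult_vector add.commute)
  qed
  have P1: "P g" if "g \<in> SL2" "g $ 2 $ 1 \<noteq> 0" for g
  proof -
    let ?c = "g $ 2 $ 1"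
    \<comment> \<open>The two outer shears are solved from the diagonal entries; the upper right
      entry then agrees because the determinant is 1.\<close>
    have "g = mat2 1 ((g $ 1 $ 1 - 1) / ?c) 0 1 ** (mat2 1 0 ?c 1 ** mat2 1 ((g $ 2 $ 2 - 1) / ?c) 0 1)"
      using that unfolding SL2_iff by (simp add: vec2_eq_iff matrix_matrix_mult_2 field_simps)
    then show ?thesis
      using mult upper lower by metis
  qed
  have "P g"
  proof (cases "g $ 2 $ 1 = 0")
    case True
    \<comment> \<open>One lower shear moves the nonzero entry \<open>g $ 1 $ 1\<close> into the
      lower left corner, which reduces to the case already treated.\<close>
    have "g = mat2 1 0 (- 1) 1 ** (mat2 1 0 1 1 ** g)"
      by (simp add: vec2_eq_iff matrix_matrix_mult_2)
    moreover have "P (mat2 1 0 1 1 ** g)"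
    proof (rule P1)
      show "mat2 1 0 1 1 ** g \<in> SL2"
        by (rule SL2_mult[OF _ g]) (simp add: mat2_in_SL2)
      show "(mat2 1 0 1 1 ** g) $ 2 $ 1 \<noteq> 0"
        using True g by (auto simp: matrix_matrix_mult_2 SL2_iff)
    qed
    ultimately show ?thesis
      using mult lower by metis
  qed (rule P1[OF g])
  then show ?thesis
    using f unfolding P_def by blast
qed

text \<open>
  Both sides equal \<open>\<integral>\<integral> H(v) \<phi>(\<rho>\<^sub>1 v) \<phi>(e\<^sup>t \<rho>\<^sub>2 v) dv dt\<close> up to the constant \<open>\<integral> \<phi>(e\<^sup>t) dt\<close>, where
  \<open>\<phi>(r) = r\<^sup>D\<close> for \<open>r < 1\<close> and \<open>\<phi>(r) = 0\<close> otherwise: substitute \<open>e\<^sup>-\<^sup>t v\<close> for \<open>v\<close>.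
\<close>
lemma nn_integral_homogeneous_gauge:
  fixes H :: "'b::euclidean_space \<Rightarrow> ennreal" and \<rho>1 \<rho>2 :: "'b \<Rightarrow> real"
  assumes [measurable]: "H \<in> borel_measurable borel" "\<rho>1 \<in> borel_measurable borel" "\<rho>2 \<in> borel_measurable borel"
    and H: "\<And>r v. r > 0 \<Longrightarrow> v \<noteq> 0 \<Longrightarrow> H v = ennreal (r ^ DIM('b)) * H (r *\<^sub>R v)"
    and \<rho>1: "\<And>r v. r > 0 \<Longrightarrow> \<rho>1 (r *\<^sub>R v) = r * \<rho>1 v" "\<And>v. v \<noteq> 0 \<Longrightarrow> \<rho>1 v > 0"
    and \<rho>2: "\<And>r v. r > 0 \<Longrightarrow> \<rho>2 (r *\<^sub>R v) = r * \<rho>2 v" "\<And>v. v \<noteq> 0 \<Longrightarrow> \<rho>2 v > 0"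
  shows "(\<integral>\<^sup>+v. H v * ennreal (\<rho>1 v ^ DIM('b)) * indicator {v. \<rho>1 v < 1} v \<partial>lborel)
       = (\<integral>\<^sup>+v. H v * ennreal (\<rho>2 v ^ DIM('b)) * indicator {v. \<rho>2 v < 1} v \<partial>lborel)"
proof -
  let ?D = "DIM('b)"
  define \<phi> :: "real \<Rightarrow> ennreal" where "\<phi> r = ennreal (r ^ ?D) * indicator {..<1} r" for r
  have \<phi>[measurable]: "\<phi> \<in> borel_measurable borel"
    unfolding \<phi>_def[abs_def] by measurable
  define C where "C = (\<integral>\<^sup>+t. \<phi> (exp t) \<partial>lborel)"
  have C1: "(\<integral>\<^sup>+t. \<phi> (exp t * a) \<partial>lborel) = C" if "a > 0" for a
  proof -
    have "(\<integral>\<^sup>+t. \<phi> (exp t * a) \<partial>lborel) = (\<integral>\<^sup>+t. \<phi> (exp (t + ln a)) \<partial>lborel)"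
      using that by (simp add: exp_add)
    also have "\<dots> = C"
      unfolding C_def by (rule nn_integral_lborel_translate[of "\<lambda>t. \<phi> (exp t)"]) measurable
    finally show ?thesis .
  qed
  have C2: "(\<integral>\<^sup>+t. \<phi> (exp (- t) * a) \<partial>lborel) = C" if "a > 0" for a
  proof -
    have "(\<integral>\<^sup>+t. \<phi> (exp t * a) \<partial>lborel) = (\<integral>\<^sup>+t. \<phi> (exp (- t) * a) \<partial>lborel)"
      by (subst lborel_distr_uminus[symmetric], subst nn_integral_distr) simp_all
    then show ?thesis
      using C1[OF that] by simp
  qed
  have D: "?D \<ge> 1"
    using DIM_positive[where 'a='b] by linarith
  \<comment> \<open>Cancelling \<open>C\<close> at the end requires it to be positive and finite:
    \<open>\<phi> (exp t)\<close> is positive for every negative \<open>t\<close>, and there it is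
    at most \<open>exp t\<close> because the dimension is at least 1.\<close>
  have "C \<noteq> 0"
  proof
    assume "C = 0"
    then have "AE t in lborel. \<phi> (exp t) = 0"
      unfolding C_def by (subst (asm) nn_integral_0_iff_AE) auto
    then have "AE t in lborel. \<not> t < (0::real)"
      by eventually_elim (auto simp: \<phi>_def indicator_def split: if_splits)
    then have "emeasure lborel {..<0::real} = 0"
      by (subst (asm) AE_iff_measurable[of "{..<0::real}"]) auto
    moreover have "emeasure lborel {-1<..<0::real} \<le> emeasure lborel {..<0::real}"
      by (rule emeasure_mono) auto
    ultimately show False
      by simp
  qed
  have "C \<noteq> \<infinity>"
  proof -
    have "C \<le> (\<integral>\<^sup>+t. ennreal (exp t) * indicator {..0} t \<partial>lborel)"
      unfolding C_def
    proof (rule nn_integral_mono)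
      fix t :: real
      have "exp t ^ ?D \<le> exp t" if "t < 0"
        using power_decreasing[of 1 ?D "exp t"] that D by simp
      then show "\<phi> (exp t) \<le> ennreal (exp t) * indicator {..0} t"
        by (auto simp: \<phi>_def indicator_def ennreal_leI)
    qed
    also have "\<dots> = (\<integral>\<^sup>+t. ennreal (exp (- t)) * indicator {0..} t \<partial>lborel)"
      by (subst (2) lborel_distr_uminus[symmetric], subst nn_integral_distr)
        (auto intro!: nn_integral_cong simp: indicator_def)
    also have "\<dots> = ennreal (0 - (- exp (- 0)))"
    proof (rule nn_integral_FTC_atLeast)
      show "((\<lambda>t::real. - exp (- t)) \<longlongrightarrow> 0) at_top"
        using tendsto_minus[OF filterlim_compose[OF exp_at_bot filterlim_uminus_at_bot_at_top]] by simp
    qed (auto intro!: derivative_eq_intros)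
    finally show ?thesis
      by (auto simp: top_unique)
  qed
  have swap: "(\<integral>\<^sup>+v. H v * \<phi> (\<rho>1 v) * (\<integral>\<^sup>+t. \<phi> (exp t * \<rho>2 v) \<partial>lborel) \<partial>lborel)
      = (\<integral>\<^sup>+v. H v * \<phi> (\<rho>2 v) * (\<integral>\<^sup>+t. \<phi> (exp (- t) * \<rho>1 v) \<partial>lborel) \<partial>lborel)"
  proof -
    have "(\<integral>\<^sup>+v. H v * \<phi> (\<rho>1 v) * (\<integral>\<^sup>+t. \<phi> (exp t * \<rho>2 v) \<partial>lborel) \<partial>lborel)
      = (\<integral>\<^sup>+v. \<integral>\<^sup>+t. H v * \<phi> (\<rho>1 v) * \<phi> (exp t * \<rho>2 v) \<partial>lborel \<partial>lborel)"
      by (subst nn_integral_cmult) simp_all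
    also have "\<dots> = (\<integral>\<^sup>+t. \<integral>\<^sup>+v. H v * \<phi> (\<rho>1 v) * \<phi> (exp t * \<rho>2 v) \<partial>lborel \<partial>lborel)"
      by (rule lborel_pair.Fubini') simp
    also have "\<dots> = (\<integral>\<^sup>+t. \<integral>\<^sup>+v. H v * \<phi> (\<rho>2 v) * \<phi> (exp (- t) * \<rho>1 v) \<partial>lborel \<partial>lborel)"
    proof (rule nn_integral_cong)
      fix t :: real
      have "(\<integral>\<^sup>+v. H v * \<phi> (\<rho>1 v) * \<phi> (exp t * \<rho>2 v) \<partial>lborel)
        = ennreal (exp (- t) ^ ?D) * (\<integral>\<^sup>+v. H (exp (- t) *\<^sub>R v) * \<phi> (\<rho>1 (exp (- t) *\<^sub>R v)) * \<phi> (exp t * \<rho>2 (exp (- t) *\<^sub>R v)) \<partial>lborel)"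
        by (rule nn_integral_lborel_scale) simp_all
      also have "\<dots> = (\<integral>\<^sup>+v. ennreal (exp (- t) ^ ?D) * (H (exp (- t) *\<^sub>R v) * \<phi> (\<rho>1 (exp (- t) *\<^sub>R v)) * \<phi> (exp t * \<rho>2 (exp (- t) *\<^sub>R v))) \<partial>lborel)"
        by (rule nn_integral_cmult[symmetric]) simp
      also have "\<dots> = (\<integral>\<^sup>+v. H v * \<phi> (\<rho>2 v) * \<phi> (exp (- t) * \<rho>1 v) \<partial>lborel)"
      proof (rule nn_integral_cong_AE)
        have "AE v in lborel. v \<noteq> (0::'b)"
          by (rule AE_lborel_singleton)
        then show "AE v in lborel. ennreal (exp (- t) ^ ?D) * (H (exp (- t) *\<^sub>R v) * \<phi> (\<rho>1 (exp (- t) *\<^sub>R v)) * \<phi> (exp t * \<rho>2 (exp (- t) *\<^sub>R v)))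
          = H v * \<phi> (\<rho>2 v) * \<phi> (exp (- t) * \<rho>1 v)"
        proof eventually_elim
          case (elim v)
          have "exp t * \<rho>2 (exp (- t) *\<^sub>R v) = \<rho>2 v"
            by (simp add: \<rho>2 exp_minus)
          moreover have "\<rho>1 (exp (- t) *\<^sub>R v) = exp (- t) * \<rho>1 v"
            by (simp add: \<rho>1)
          ultimately show ?case
            using H[of "exp (- t)" v] elim by (simp add: ac_simps)
        qed
      qed
      finally show "(\<integral>\<^sup>+v. H v * \<phi> (\<rho>1 v) * \<phi> (exp t * \<rho>2 v) \<partial>lborel) = (\<integral>\<^sup>+v. H v * \<phi> (\<rho>2 v) * \<phi> (exp (- t) * \<rho>1 v) \<partial>lborel)" .
    qed
    also have "\<dots> = (\<integral>\<^sup>+v. \<integral>\<^sup>+t. H v * \<phi> (\<rho>2 v) * \<phi> (exp (- t) * \<rho>1 v) \<partial>lborel \<partial>lborel)"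
      by (rule lborel_pair.Fubini') simp
    also have "\<dots> = (\<integral>\<^sup>+v. H v * \<phi> (\<rho>2 v) * (\<integral>\<^sup>+t. \<phi> (exp (- t) * \<rho>1 v) \<partial>lborel) \<partial>lborel)"
      by (subst nn_integral_cmult) simp_all
    finally show ?thesis .
  qed
  have ae: "AE v in lborel. v \<noteq> (0::'b)"
    by (rule AE_lborel_singleton)
  have "(\<integral>\<^sup>+v. H v * \<phi> (\<rho>1 v) * (\<integral>\<^sup>+t. \<phi> (exp t * \<rho>2 v) \<partial>lborel) \<partial>lborel) = (\<integral>\<^sup>+v. H v * \<phi> (\<rho>1 v) * C \<partial>lborel)"
    by (rule nn_integral_cong_AE, use ae in eventually_elim) (simp add: C1 \<rho>2)
  moreover have "(\<integral>\<^sup>+v. H v * \<phi> (\<rho>2 v) * (\<integral>\<^sup>+t. \<phi> (exp (- t) * \<rho>1 v) \<partial>lborel) \<partial>lborel) = (\<integral>\<^sup>+v. H v * \<phi> (\<rho>2 v) * C \<partial>lborel)"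
    by (rule nn_integral_cong_AE, use ae in eventually_elim) (simp add: C2 \<rho>1)
  ultimately have "(\<integral>\<^sup>+v. H v * \<phi> (\<rho>1 v) \<partial>lborel) * C = (\<integral>\<^sup>+v. H v * \<phi> (\<rho>2 v) \<partial>lborel) * C"
    using swap by (simp add: nn_integral_multc)
  then have "(\<integral>\<^sup>+v. H v * \<phi> (\<rho>1 v) \<partial>lborel) = (\<integral>\<^sup>+v. H v * \<phi> (\<rho>2 v) \<partial>lborel)"
    using \<open>C \<noteq> 0\<close> \<open>C \<noteq> \<infinity>\<close> by (metis ennreal_mult_cancel_left mult.commute infinity_ennreal_def)
  then show ?thesis
    unfolding \<phi>_def by (simp add: mult.assoc indicator_def)
qed

section \<open>Products of square-integrable functions\<close>

lemma integrable_mult_square: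
  fixes f g :: "'b \<Rightarrow> complex"
  assumes "f \<in> borel_measurable M" "g \<in> borel_measurable M"
    and "integrable M (\<lambda>x. (norm (f x))\<^sup>2)" "integrable M (\<lambda>x. (norm (g x))\<^sup>2)"
  shows "integrable M (\<lambda>x. f x * g x)"
proof (rule Bochner_Integration.integrable_bound)
  show "integrable M (\<lambda>x. (norm (f x))\<^sup>2 + (norm (g x))\<^sup>2)"
    using assms by simp
  show "AE x in M. norm (f x * g x) \<le> norm ((norm (f x))\<^sup>2 + (norm (g x))\<^sup>2)"
  proof (rule AE_I2)
    fix x
    have "2 * (norm (f x) * norm (g x)) \<le> (norm (f x))\<^sup>2 + (norm (g x))\<^sup>2"
      using sum_squares_bound[of "norm (f x)" "norm (g x)"] by simp
    moreover have "0 \<le> norm (f x) * norm (g x)"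
      by simp
    ultimately have "norm (f x) * norm (g x) \<le> (norm (f x))\<^sup>2 + (norm (g x))\<^sup>2"
      by linarith
    then show "norm (f x * g x) \<le> norm ((norm (f x))\<^sup>2 + (norm (g x))\<^sup>2)"
      by (simp add: norm_mult)
  qed
qed (use assms in simp)

lemma norm_integral_mult_le:
  fixes f g :: "'b \<Rightarrow> complex"
  assumes [measurable]: "f \<in> borel_measurable M" "g \<in> borel_measurable M"
    and int: "integrable M (\<lambda>x. (norm (f x))\<^sup>2)" "integrable M (\<lambda>x. (norm (g x))\<^sup>2)"
  shows "norm (\<integral>x. f x * g x \<partial>M) \<le> sqrt (\<integral>x. (norm (f x))\<^sup>2 \<partial>M) * sqrt (\<integral>x. (norm (g x))\<^sup>2 \<partial>M)"
proof -
  let ?A = "\<integral>x. (norm (f x))\<^sup>2 \<partial>M" and ?B = "\<integral>x. (norm (g x))\<^sup>2 \<partial>M" and ?C = "\<integral>x. norm (f x * g x) \<partial>M"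
  have fg: "integrable M (\<lambda>x. norm (f x * g x))"
    using integrable_mult_square[OF assms] by simp
  have "(\<integral>\<^sup>+x. ennreal (norm (f x)) * ennreal (norm (g x)) \<partial>M)\<^sup>2
      \<le> (\<integral>\<^sup>+x. (ennreal (norm (f x)))\<^sup>2 \<partial>M) * (\<integral>\<^sup>+x. (ennreal (norm (g x)))\<^sup>2 \<partial>M)"
    by (rule Cauchy_Schwarz_nn_integral) measurable
  then have "(ennreal ?C)\<^sup>2 \<le> ennreal ?A * ennreal ?B"
    using fg int by (simp add: nn_integral_eq_integral ennreal_mult[symmetric] ennreal_power norm_mult)
  then have "?C\<^sup>2 \<le> ?A * ?B"
    by (simp add: ennreal_mult[symmetric] ennreal_power)
  then have "?C \<le> sqrt (?A * ?B)"
    by (rule real_le_rsqrt)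
  with integral_norm_bound have "norm (\<integral>x. f x * g x \<partial>M) \<le> sqrt (?A * ?B)"
    by (rule order_trans)
  then show ?thesis
    by (simp only: real_sqrt_mult)
qed

lemma borel_measurable_cnj [measurable (raw), simp]:
  "f \<in> borel_measurable M \<Longrightarrow> (\<lambda>x. cnj (f x)) \<in> borel_measurable M"
  by (erule measurable_compose) (intro borel_measurable_continuous_onI continuous_intros)

lemma integrable_norm_add_square:
  fixes f g :: "'b \<Rightarrow> complex"
  assumes "f \<in> borel_measurable M" "g \<in> borel_measurable M"
    and "integrable M (\<lambda>x. (norm (f x))\<^sup>2)" "integrable M (\<lambda>x. (norm (g x))\<^sup>2)"
  shows "integrable M (\<lambda>x. (norm (f x + g x))\<^sup>2)"
proof (rule Bochner_Integration.integrable_bound)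
  show "integrable M (\<lambda>x. 2 * (norm (f x))\<^sup>2 + 2 * (norm (g x))\<^sup>2)"
    using assms by simp
  show "AE x in M. norm ((norm (f x + g x))\<^sup>2) \<le> norm (2 * (norm (f x))\<^sup>2 + 2 * (norm (g x))\<^sup>2)"
  proof (rule AE_I2)
    fix x
    have "(norm (f x + g x))\<^sup>2 \<le> (norm (f x) + norm (g x))\<^sup>2"
      by (simp add: norm_triangle_ineq power_mono)
    also have "\<dots> \<le> 2 * (norm (f x))\<^sup>2 + 2 * (norm (g x))\<^sup>2"
      using sum_squares_bound[of "norm (f x)" "norm (g x)"] by (simp add: power2_sum)
    finally show "norm ((norm (f x + g x))\<^sup>2) \<le> norm (2 * (norm (f x))\<^sup>2 + 2 * (norm (g x))\<^sup>2)"
      by simp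
  qed
qed (use assms in simp)

lemma borel_measurable_column_1 [measurable (raw)]:
  fixes A :: "'b \<Rightarrow> 'a::{real_normed_field, euclidean_space}^2^2"
  assumes "A \<in> borel_measurable M"
  shows "(\<lambda>x. column 1 (A x)) \<in> borel_measurable M"
proof -
  have "column 1 (A x) = vector [A x $ 1 $ 1, A x $ 2 $ 1]" for x
    by (simp add: vec2_eq_iff column_def)
  then show ?thesis
    using assms by simp
qed

lemma borel_measurable_column_1' [measurable]:
  "column 1 \<in> borel_measurable (borel :: ('a::{real_normed_field, euclidean_space}^2^2) measure)"
  using borel_measurable_column_1[of "\<lambda>x. x" borel] by simp

section \<open>Haar measure on \<open>K\<close> and its transformation under the group\<close>

abbreviation unif_ball :: "('a::{real_normed_field, euclidean_space}^2) measure" where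
  "unif_ball \<equiv> uniform_measure lborel (ball 0 1)"

lemma emeasure_unit_ball: "emeasure lborel (ball (0 :: 'b::euclidean_space) 1) \<noteq> 0"
  "emeasure lborel (ball (0 :: 'b::euclidean_space) 1) < \<infinity>"
  using emeasure_lborel_ball_finite[of "0 :: 'b" 1]
  by (simp_all add: emeasure_ball unit_ball_vol_pos less_imp_neq[symmetric])

lemma emeasure_unif_ball_UNIV: "emeasure (unif_ball :: ('a::{real_normed_field, euclidean_space}^2) measure) UNIV = 1"
  using emeasure_uniform_measure_1[of lborel "ball (0 :: 'a^2) 1"] emeasure_unit_ball[where 'b="'a^2"] by simp

lemma AE_unif_ball: "AE v in (unif_ball :: ('a::{real_normed_field, euclidean_space}^2) measure). P v"
  if "AE v in lborel. P v"
  using that by (auto simp: AE_uniform_measure[OF emeasure_unit_ball] elim: eventually_mono)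

lemma AE_unif_ball_nonzero: "AE v in (unif_ball :: ('a::{real_normed_field, euclidean_space}^2) measure). v \<noteq> 0"
  by (rule AE_unif_ball[OF AE_lborel_singleton])

lemma sets_haar_K [measurable_cong, simp]: "sets haar_K = sets borel"
  by (simp add: haar_K_def)

lemma borel_measurable_haar_K [simp]: "borel_measurable haar_K = borel_measurable borel"
  by (rule measurable_cong_sets) simp_all

lemma space_haar_K [simp]: "space haar_K = UNIV"
  by (simp add: haar_K_def)

lemma nn_integral_haar_K:
  fixes f :: "'a::{real_normed_field, euclidean_space}^2^2 \<Rightarrow> ennreal"
  assumes [measurable]: "f \<in> borel_measurable borel"
  shows "(\<integral>\<^sup>+k. f k \<partial>haar_K) = (\<integral>\<^sup>+v. f (K_elt (sgn v)) \<partial>unif_ball)"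
  unfolding haar_K_def by (rule nn_integral_distr) simp_all

lemma emeasure_haar_K_UNIV: "emeasure (haar_K :: ('a::{real_normed_field, euclidean_space}^2^2) measure) UNIV = 1"
  unfolding haar_K_def by (subst emeasure_distr) (simp_all add: emeasure_unif_ball_UNIV)

lemma finite_measure_haar_K: "finite_measure (haar_K :: ('a::{real_normed_field, euclidean_space}^2^2) measure)"
  by (rule finite_measureI) (simp add: emeasure_haar_K_UNIV)

lemma measure_haar_K_UNIV [simp]: "measure (haar_K :: ('a::{real_normed_field, euclidean_space}^2^2) measure) UNIV = 1"
  by (simp add: measure_def emeasure_haar_K_UNIV)

lemma AE_haar_K:
  fixes P :: "'a::{real_normed_field, euclidean_space}^2^2 \<Rightarrow> bool"
  assumes "\<And>v. norm v = 1 \<Longrightarrow> P (K_elt v)" and [measurable]: "Measurable.pred borel P"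
  shows "AE k in haar_K. P k"
  unfolding haar_K_def
proof (subst AE_distr_iff)
  show "AE v in unif_ball. P (K_elt (sgn v))"
    using AE_unif_ball_nonzero by eventually_elim (auto intro!: assms simp: norm_sgn)
qed simp_all

lemma measurable_SL2 [measurable]: "Measurable.pred borel (\<lambda>g :: 'a::{real_normed_field, euclidean_space}^2^2. g \<in> SL2)"
  unfolding SL2_iff by measurable

text \<open>\<open>haar_K\<close> is a measure on all matrices. This fact concentrates it on
  \<open>K\<close> and reduces almost-everywhere claims to unit vectors
  \<open>column 1 k\<close>.\<close>

lemma AE_haar_K_SL2: "AE k in (haar_K :: ('a::{real_normed_field, euclidean_space}^2^2) measure).
    k \<in> SL2 \<and> norm (column 1 k) = 1 \<and> k = K_elt (column 1 k)"
  by (rule AE_haar_K) (simp_all add: K_elt_in_SL2)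

text \<open>The Jacobian of the action of \<open>h\<close> on \<open>K = G/AN\<close> is \<open>norm (h *v v) ^ - (2 * DIM('a))\<close>.\<close>
lemma nn_integral_haar_K_SL2:
  fixes P :: "'a::{real_normed_field, euclidean_space}^2^2 \<Rightarrow> ennreal"
  assumes [measurable]: "P \<in> borel_measurable borel" and h: "h \<in> SL2"
  shows "(\<integral>\<^sup>+k. ennreal (inverse (norm (h *v column 1 k) ^ (2 * DIM('a)))) * P (K_elt (sgn (h *v column 1 k))) \<partial>haar_K)
     = (\<integral>\<^sup>+k. P k \<partial>haar_K)"
proof -
  let ?D = "2 * DIM('a)"
  define p where "p v = P (K_elt (sgn v))" for v
  have [measurable]: "p \<in> borel_measurable borel"
    unfolding p_def[abs_def] by measurable
  \<comment> \<open>The density is extended from the sphere to a homogeneous function of degree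
    \<open>- 2 * DIM('a)\<close>, minus the real dimension of the plane. For this degree, integrals
    over a ball weighted by the matching power of the radius depend only on the angular
    part.\<close>
  define H where "H v = ennreal (inverse (norm v ^ ?D)) * p v" for v
  have [measurable]: "H \<in> borel_measurable borel"
    unfolding H_def[abs_def] by measurable
  have Hs: "H v = ennreal (r ^ DIM('a^2)) * H (r *\<^sub>R v)" if "r > 0" "v \<noteq> 0" for r v
  proof -
    have "r ^ ?D * inverse ((r * norm v) ^ ?D) = inverse (norm v ^ ?D)"
      using that by (simp add: power_mult_distrib)
    moreover have "sgn (r *\<^sub>R v) = sgn v"
      using that by (simp add: sgn_scaleR)
    ultimately show ?thesis
      using that by (simp add: H_def p_def mult.assoc[symmetric] ennreal_mult[symmetric])
  qed
  define h' where "h' = matrix_inv h"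
  have h': "h' \<in> SL2" "h' *v (h *v v) = v" for v
    using h by (simp_all add: h'_def SL2_inv SL2_mult_vec_cancel)
  have lin: "A *v (r *\<^sub>R v) = r *\<^sub>R (A *v v)" for A :: "'a^2^2" and r v
    by (simp add: vec2_eq_iff matrix_vector_mult_2 scaleR_add_right)
  have "(\<integral>\<^sup>+k. ennreal (inverse (norm (h *v column 1 k) ^ ?D)) * P (K_elt (sgn (h *v column 1 k))) \<partial>haar_K)
    = (\<integral>\<^sup>+v. H (h *v sgn v) \<partial>unif_ball)"
    by (subst nn_integral_haar_K) (simp_all add: H_def p_def)
  also have "\<dots> = (\<integral>\<^sup>+v. H (h *v sgn v) * indicator (ball 0 1) v \<partial>lborel) / emeasure lborel (ball (0::'a^2) 1)"
    by (rule nn_integral_uniform_measure) simp_all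
  also have "(\<integral>\<^sup>+v. H (h *v sgn v) * indicator (ball 0 1) v \<partial>lborel)
     = (\<integral>\<^sup>+v. H (h *v v) * ennreal (norm v ^ DIM('a^2)) * indicator {v. norm v < 1} v \<partial>lborel)"
  proof (rule nn_integral_cong_AE)
    show "AE v in lborel. H (h *v sgn v) * indicator (ball 0 1) v = H (h *v v) * ennreal (norm v ^ DIM('a^2)) * indicator {v. norm v < 1} v"
      using AE_lborel_singleton[of 0]
    proof eventually_elim
      case (elim v)
      have "h *v sgn v = inverse (norm v) *\<^sub>R (h *v v)" "h *v v = norm v *\<^sub>R (h *v sgn v)"
        using elim by (simp_all add: sgn_div_norm lin)
      then show ?case
        using Hs[of "norm v" "h *v sgn v"] elim h
        by (simp add: indicator_def SL2_mult_vec_eq_0 sgn_zero_iff mult.commute)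
    qed
  qed
  also have "\<dots> = (\<integral>\<^sup>+v. H (h *v v) * ennreal (norm (h' *v (h *v v)) ^ DIM('a^2)) * indicator {v. norm (h' *v v) < 1} (h *v v) \<partial>lborel)"
    by (rule nn_integral_cong) (simp add: h' indicator_def)
  also have "\<dots> = (\<integral>\<^sup>+v. H v * ennreal (norm (h' *v v) ^ DIM('a^2)) * indicator {v. norm (h' *v v) < 1} v \<partial>lborel)"
    by (rule nn_integral_lborel_SL2[OF h, of "\<lambda>v. H v * ennreal (norm (h' *v v) ^ DIM('a^2)) * indicator {v. norm (h' *v v) < 1} v"]) measurable
  \<comment> \<open>After the linear substitution the ball is measured by the gauge
    \<open>norm (h' *v v)\<close> instead of the norm. For a density of this homogeneity the two
    gauges give the same integral, and this exchange is where the Jacobian is absorbed.\<close>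
  also have "\<dots> = (\<integral>\<^sup>+v. H v * ennreal (norm v ^ DIM('a^2)) * indicator {v. norm v < 1} v \<partial>lborel)"
    by (rule nn_integral_homogeneous_gauge[OF _ _ _ Hs]) (use h' in \<open>simp_all add: lin SL2_mult_vec_eq_0\<close>)
  also have "\<dots> = (\<integral>\<^sup>+v. p v * indicator (ball 0 1) v \<partial>lborel)"
  proof (rule nn_integral_cong_AE)
    show "AE v in lborel. H v * ennreal (norm v ^ DIM('a^2)) * indicator {v. norm v < 1} v = p v * indicator (ball 0 1) v"
      using AE_lborel_singleton[of 0]
    proof eventually_elim
      case (elim v)
      have "ennreal (inverse (norm v ^ ?D)) * ennreal (norm v ^ ?D) = 1"
        using elim by (simp add: ennreal_mult[symmetric])
      then show ?case
        by (simp add: H_def indicator_def mult.assoc mult.left_commute mult.commute)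
    qed
  qed
  also have "\<dots> / emeasure lborel (ball (0::'a^2) 1) = (\<integral>\<^sup>+v. p v \<partial>unif_ball)"
    by (rule nn_integral_uniform_measure[symmetric]) simp_all
  also have "\<dots> = (\<integral>\<^sup>+k. P k \<partial>haar_K)"
    by (subst nn_integral_haar_K) (simp_all add: p_def[abs_def])
  finally show ?thesis .
qed

text \<open>Testing the preceding identity on indicator functions turns it into an equality of
  measures, from which the rules for complex-valued integrals follow without splitting into positive
  parts.\<close>

lemma haar_K_SL2_action:
  fixes h :: "'a::{real_normed_field, euclidean_space}^2^2"
  assumes "h \<in> SL2"
  shows "distr (density haar_K (\<lambda>k. ennreal (inverse (norm (h *v column 1 k) ^ (2 * DIM('a))))))
      borel (\<lambda>k. K_elt (sgn (h *v column 1 k))) = haar_K"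
proof (rule measure_eqI)
  fix A :: "('a^2^2) set"
  assume "A \<in> sets (distr (density haar_K (\<lambda>k. ennreal (inverse (norm (h *v column 1 k) ^ (2 * DIM('a))))))
      borel (\<lambda>k. K_elt (sgn (h *v column 1 k))))"
  then have [measurable]: "A \<in> sets borel"
    by simp
  let ?T = "\<lambda>k :: 'a^2^2. K_elt (sgn (h *v column 1 k))"
  have "?T \<in> borel_measurable borel"
    by measurable
  from measurable_sets[OF this, of A] have [measurable]: "?T -` A \<in> sets borel"
    by simp
  have "emeasure (distr (density haar_K (\<lambda>k. ennreal (inverse (norm (h *v column 1 k) ^ (2 * DIM('a))))))
      borel ?T) A
    = (\<integral>\<^sup>+k. ennreal (inverse (norm (h *v column 1 k) ^ (2 * DIM('a)))) * indicator A (?T k) \<partial>haar_K)"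
    by (simp add: emeasure_distr emeasure_density indicator_vimage)
  also have "\<dots> = emeasure haar_K A"
    by (subst nn_integral_haar_K_SL2) (simp_all add: assms)
  finally show "emeasure (distr (density haar_K (\<lambda>k. ennreal (inverse (norm (h *v column 1 k) ^ (2 * DIM('a))))))
      borel ?T) A = emeasure haar_K A" .
qed simp

text \<open>In the Iwasawa decomposition of \<open>g\<close>,
  \<open>K_elt (sgn (column 1 g))\<close> is the \<open>K\<close>-part and
  \<open>norm (column 1 g)\<close> the \<open>A\<close>-part. The condition is therefore covariance
  under \<open>A N\<close>, with exponent \<open>n\<close>; half-densities have
  \<open>n = DIM('a)\<close> and densities twice that.\<close>

definition K_homogeneous :: "nat \<Rightarrow> ('a::{real_normed_field, euclidean_space}^2^2 \<Rightarrow> 'b::real_vector) \<Rightarrow> bool" where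
  "K_homogeneous n P \<longleftrightarrow> (\<forall>g\<in>SL2. P g = inverse (norm (column 1 g) ^ n) *\<^sub>R P (K_elt (sgn (column 1 g))))"

text \<open>Degree \<open>2 * DIM('a)\<close> cancels the Jacobian of the action exactly, so
  integration over \<open>K\<close> is a functional on densities that is invariant under the whole
  group, not only under \<open>K\<close>. Unitarity and the invariance of the bilinear pairing are
  both instances.\<close>

lemma K_homogeneous_translate:
  fixes P :: "'a::{real_normed_field, euclidean_space}^2^2 \<Rightarrow> 'b::{banach, second_countable_topology}"
  assumes P: "K_homogeneous (2 * DIM('a)) P" and [measurable]: "P \<in> borel_measurable borel" and h: "h \<in> SL2"
  shows "integrable haar_K (\<lambda>k. P (h ** k)) \<longleftrightarrow> integrable haar_K P"
    and "(\<integral>k. P (h ** k) \<partial>haar_K) = (\<integral>k. P k \<partial>haar_K)"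
proof -
  let ?w = "\<lambda>k :: 'a^2^2. inverse (norm (h *v column 1 k) ^ (2 * DIM('a)))"
  let ?T = "\<lambda>k :: 'a^2^2. K_elt (sgn (h *v column 1 k))"
  have ae: "AE k in haar_K. ?w k *\<^sub>R P (?T k) = P (h ** k)"
    using AE_haar_K_SL2
  proof eventually_elim
    case (elim k)
    then show ?case
      using P SL2_mult[OF h, of k] unfolding K_homogeneous_def by (metis column_mult)
  qed
  have "integrable haar_K P \<longleftrightarrow> integrable (distr (density haar_K (\<lambda>k. ennreal (?w k))) borel ?T) P"
    unfolding haar_K_SL2_action[OF h] ..
  also have "\<dots> \<longleftrightarrow> integrable haar_K (\<lambda>k. ?w k *\<^sub>R P (?T k))"
    by (subst integrable_distr_eq, simp, simp, subst integrable_density) simp_all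
  also have "\<dots> \<longleftrightarrow> integrable haar_K (\<lambda>k. P (h ** k))"
    by (rule integrable_cong_AE) (use ae in simp_all)
  finally show "integrable haar_K (\<lambda>k. P (h ** k)) \<longleftrightarrow> integrable haar_K P" ..
  have "(\<integral>k. P k \<partial>haar_K) = (\<integral>k. P k \<partial>distr (density haar_K (\<lambda>k. ennreal (?w k))) borel ?T)"
    unfolding haar_K_SL2_action[OF h] ..
  also have "\<dots> = (\<integral>k. ?w k *\<^sub>R P (?T k) \<partial>haar_K)"
    by (subst integral_distr, simp, simp, subst integral_density) simp_all
  also have "\<dots> = (\<integral>k. P (h ** k) \<partial>haar_K)"
    by (rule integral_cong_AE) (use ae in simp_all)
  finally show "(\<integral>k. P (h ** k) \<partial>haar_K) = (\<integral>k. P k \<partial>haar_K)" ..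
qed

subsection \<open>The induced representation\<close>

text \<open>Weyl-fixed characters are trivial on the positive reals. This common property of the
  trivial and the sign character is what makes the functions of the space homogeneous, so both cases
  share the Hilbert space arguments.\<close>

locale ps_char =
  fixes \<eta> :: "'a::{real_normed_field, euclidean_space} \<Rightarrow> complex"
  assumes \<eta>_of_real: "\<And>r. r > 0 \<Longrightarrow> \<eta> (of_real r) = 1"
begin

lemma ps_spaceD:
  assumes "f \<in> ps_space \<eta>"
  shows ps_space_measurable: "f \<in> borel_measurable borel"
    and ps_space_outside: "\<And>g. g \<notin> SL2 \<Longrightarrow> f g = 0"
    and ps_space_cov: "\<And>g p. g \<in> SL2 \<Longrightarrow> p \<in> upper_P \<Longrightarrow>
        f (g ** p) = inverse (of_real (norm (levi p) ^ DIM('a))) * inverse (\<eta> (levi p)) * f g"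
    and ps_space_integrable: "integrable haar_K (\<lambda>k. (norm (f k))\<^sup>2)"
  using assms unfolding ps_space_def by blast+

text \<open>Removing the \<open>K\<close>-part of \<open>g\<close> leaves an element
  \<open>p\<close> of the upper triangular group whose diagonal entry is the positive real
  \<open>norm v\<close>. There \<open>\<eta>\<close> equals 1, and the covariance reduces to the
  modulus factor.\<close>

lemma ps_space_K_homogeneous:
  assumes f: "f \<in> ps_space \<eta>"
  shows "K_homogeneous DIM('a) f"
  unfolding K_homogeneous_def
proof
  fix g :: "'a^2^2" assume g: "g \<in> SL2"
  define v where "v = column 1 g"
  define k where "k = K_elt (sgn v)"
  have v: "v \<noteq> 0"
    using column_1_nonzero[OF g] by (simp add: v_def)
  have k: "k \<in> SL2"
    unfolding k_def by (rule K_elt_in_SL2) (simp add: norm_sgn v)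
  define p where "p = matrix_inv k ** g"
  have "column 1 p = matrix_inv k *v (norm v *\<^sub>R column 1 k)"
    using v by (simp add: p_def column_mult v_def k_def sgn_div_norm)
  also have "\<dots> = norm v *\<^sub>R (matrix_inv k *v column 1 k)"
    by (simp add: vec2_eq_iff matrix_vector_mult_2 scaleR_add_right)
  also have "matrix_inv k *v column 1 k = column 1 (mat 1)"
    by (simp add: column_mult[symmetric] SL2_mult_inv[OF k])
  finally have c: "column 1 p = norm v *\<^sub>R column 1 (mat 1)" .
  have "p $ 2 $ 1 = 0" "p $ 1 $ 1 = of_real (norm v)"
    using arg_cong[OF c, of "\<lambda>x. x $ 2"] arg_cong[OF c, of "\<lambda>x. x $ 1"]
    by (simp_all add: column_def mat_def of_real_def)
  moreover have "p \<in> SL2"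
    unfolding p_def by (intro SL2_mult SL2_inv k g)
  ultimately have "p \<in> upper_P" "levi p = of_real (norm v)"
    by (simp_all add: upper_P_def levi_def)
  moreover have "g = k ** p"
    by (simp add: p_def SL2_mult_cancel k)
  ultimately have "f g = inverse (of_real (norm v ^ DIM('a))) * f k"
    using ps_space_cov[OF f k, of p] v \<eta>_of_real[of "norm v"] by simp
  then show "f g = inverse (norm (column 1 g) ^ DIM('a)) *\<^sub>R f (K_elt (sgn (column 1 g)))"
    by (simp add: v_def k_def scaleR_conv_of_real)
qed

lemma ps_space_zero: "(\<lambda>_. 0) \<in> ps_space \<eta>"
  by (simp add: ps_space_def)

lemma ps_space_scale: "f \<in> ps_space \<eta> \<Longrightarrow> (\<lambda>x. c * f x) \<in> ps_space \<eta>"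
  by (auto simp: ps_space_def norm_mult power_mult_distrib)

lemma ps_space_add:
  assumes "f \<in> ps_space \<eta>" "g \<in> ps_space \<eta>"
  shows "(\<lambda>x. f x + g x) \<in> ps_space \<eta>"
proof -
  have "integrable haar_K (\<lambda>k. (norm (f k + g k))\<^sup>2)"
    by (rule integrable_norm_add_square) (use assms in \<open>simp_all add: ps_space_def\<close>)
  then show ?thesis
    using assms by (auto simp: ps_space_def distrib_left)
qed

lemma ps_space_diff:
  assumes "f \<in> ps_space \<eta>" "g \<in> ps_space \<eta>"
  shows "(\<lambda>x. f x - g x) \<in> ps_space \<eta>"
  using ps_space_add[OF assms(1) ps_space_scale[OF assms(2), of "-1"]] by simp

end

lemma K_homogeneous_norm_square:
  "K_homogeneous n f \<Longrightarrow> K_homogeneous (2 * n) (\<lambda>g. (norm (f g :: complex))\<^sup>2)"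
  unfolding K_homogeneous_def by (auto simp: power_mult_distrib power_mult[symmetric] power_inverse mult.commute)

lemma K_homogeneous_mult:
  "K_homogeneous n f \<Longrightarrow> K_homogeneous n g \<Longrightarrow> K_homogeneous (2 * n) (\<lambda>x. f x * g x :: complex)"
  unfolding K_homogeneous_def by (auto simp: mult_2 power_add)

lemma K_homogeneous_cnj: "K_homogeneous n f \<Longrightarrow> K_homogeneous n (\<lambda>x. cnj (f x))"
  unfolding K_homogeneous_def by auto

lemma left_translate_inv:
  fixes h :: "'a::field^2^2"
  assumes "h \<in> SL2"
  shows "left_translate (matrix_inv h) (left_translate h f) = f"
    and "left_translate h (left_translate (matrix_inv h) f) = f"
  by (simp_all add: left_translate_def SL2_mult_cancel SL2_inv assms SL2_inv_inv)

lemma (in ps_char) ps_space_left_translate: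
  assumes f: "f \<in> ps_space \<eta>" and h: "h \<in> SL2"
  shows "left_translate h f \<in> ps_space \<eta>"
proof -
  have h': "matrix_inv h \<in> SL2"
    by (rule SL2_inv[OF h])
  have [measurable]: "f \<in> borel_measurable borel"
    by (rule ps_space_measurable[OF f])
  have "integrable haar_K (\<lambda>k. (norm (f (matrix_inv h ** k)))\<^sup>2)"
    using K_homogeneous_translate(1)[OF K_homogeneous_norm_square[OF ps_space_K_homogeneous[OF f]] _ h']
      ps_space_integrable[OF f] by simp
  moreover have "f (matrix_inv h ** g) = 0" if "g \<notin> SL2" for g
  proof -
    have "matrix_inv h ** g \<notin> SL2"
      using that SL2_mult[OF h, of "matrix_inv h ** g"] by (auto simp: SL2_mult_cancel h)
    then show ?thesis
      by (rule ps_space_outside[OF f])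
  qed
  moreover have "f (matrix_inv h ** (g ** p)) =
      inverse (of_real (norm (levi p) ^ DIM('a))) * inverse (\<eta> (levi p)) * f (matrix_inv h ** g)"
    if "g \<in> SL2" "p \<in> upper_P" for g p
    using ps_space_cov[OF f SL2_mult[OF h' that(1)] that(2)] by (simp add: matrix_mul_assoc)
  moreover have "(\<lambda>g. f (matrix_inv h ** g)) \<in> borel_measurable borel"
    by measurable
  ultimately show ?thesis
    by (simp add: ps_space_def left_translate_def)
qed

text \<open>Bilinear on purpose: the Hermitian product is recovered by conjugating the second
  argument, while the Hardy space for the sign character is an annihilator for the bilinear form
  itself.\<close>

definition pairing :: "('a::{real_normed_field, euclidean_space}^2^2 \<Rightarrow> complex) \<Rightarrow> ('a^2^2 \<Rightarrow> complex) \<Rightarrow> complex" where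
  "pairing f g = (\<integral>k. f k * g k \<partial>haar_K)"

lemma pairing_left_translate:
  fixes f g :: "'a::{real_normed_field, euclidean_space}^2^2 \<Rightarrow> complex"
  assumes "K_homogeneous DIM('a) f" "K_homogeneous DIM('a) g"
    and [measurable]: "f \<in> borel_measurable borel" "g \<in> borel_measurable borel" and h: "h \<in> SL2"
  shows "pairing (left_translate h f) (left_translate h g) = pairing f g"
  unfolding pairing_def left_translate_def
  using K_homogeneous_translate(2)[OF K_homogeneous_mult[OF assms(1,2)] _ SL2_inv[OF h]] by simp

lemma ps_norm_nonneg [simp]: "ps_norm f \<ge> 0"
  by (simp add: ps_norm_def)

lemma ps_norm_square: "(ps_norm f)\<^sup>2 = (\<integral>k. (norm (f k))\<^sup>2 \<partial>haar_K)"
  by (simp add: ps_norm_def)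

lemma ps_norm_scale: "ps_norm (\<lambda>x. c * f x) = norm c * ps_norm f"
  by (simp add: ps_norm_def norm_mult power_mult_distrib real_sqrt_mult)

lemma ps_norm_cong_AE:
  assumes "AE k in haar_K. f k = g k" "f \<in> borel_measurable borel" "g \<in> borel_measurable borel"
  shows "ps_norm f = ps_norm g"
  unfolding ps_norm_def
  by (subst integral_cong_AE[of _ _ "\<lambda>k. (norm (g k))\<^sup>2"]) (use assms in auto)

lemma pairing_cnj_self: "pairing f (\<lambda>x. cnj (f x)) = of_real ((ps_norm f)\<^sup>2)"
  unfolding pairing_def ps_norm_square complex_norm_square[symmetric] by (rule integral_complex_of_real)

context ps_char
begin

lemma ps_space_integrable_mult:
  assumes "f \<in> ps_space \<eta>" "g \<in> ps_space \<eta>"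
  shows "integrable haar_K (\<lambda>k. f k * g k)" "integrable haar_K (\<lambda>k. f k * cnj (g k))"
proof -
  show "integrable haar_K (\<lambda>k. f k * g k)"
    by (rule integrable_mult_square) (use assms in \<open>simp_all add: ps_space_def\<close>)
  show "integrable haar_K (\<lambda>k. f k * cnj (g k))"
    by (rule integrable_mult_square) (use assms in \<open>simp_all add: ps_space_def\<close>)
qed

lemma pairing_le:
  assumes "f \<in> ps_space \<eta>" "g \<in> ps_space \<eta>"
  shows "norm (pairing f g) \<le> ps_norm f * ps_norm g"
    and "norm (pairing f (\<lambda>x. cnj (g x))) \<le> ps_norm f * ps_norm g"
proof -
  show "norm (pairing f g) \<le> ps_norm f * ps_norm g"
    unfolding pairing_def ps_norm_def
    by (rule norm_integral_mult_le) (use assms in \<open>simp_all add: ps_space_def\<close>)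
  have "norm (\<integral>k. f k * cnj (g k) \<partial>haar_K) \<le> sqrt (\<integral>k. (norm (f k))\<^sup>2 \<partial>haar_K) * sqrt (\<integral>k. (norm (cnj (g k)))\<^sup>2 \<partial>haar_K)"
    by (rule norm_integral_mult_le) (use assms in \<open>simp_all add: ps_space_def\<close>)
  then show "norm (pairing f (\<lambda>x. cnj (g x))) \<le> ps_norm f * ps_norm g"
    unfolding pairing_def ps_norm_def by simp
qed

lemma ps_norm_add_square:
  assumes "f \<in> ps_space \<eta>" "g \<in> ps_space \<eta>"
  shows "(ps_norm (\<lambda>x. f x + g x))\<^sup>2 = (ps_norm f)\<^sup>2 + (ps_norm g)\<^sup>2 + 2 * Re (pairing g (\<lambda>x. cnj (f x)))"
proof -
  have int: "integrable haar_K (\<lambda>k. g k * cnj (f k))"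
    by (rule ps_space_integrable_mult[OF assms(2,1)])
  define R where "R k = Re (g k * cnj (f k))" for k
  have R: "integrable haar_K R" "(\<integral>k. R k \<partial>haar_K) = Re (pairing g (\<lambda>x. cnj (f x)))"
    unfolding R_def[abs_def] pairing_def using int by (rule integrable_Re, rule integral_Re)
  have eq: "(norm (f k + g k))\<^sup>2 = (norm (f k))\<^sup>2 + (norm (g k))\<^sup>2 + 2 * R k" for k
    unfolding cmod_power2 R_def by (simp add: power2_eq_square algebra_simps)
  show ?thesis
    unfolding ps_norm_square eq
    using R ps_space_integrable[OF assms(1)] ps_space_integrable[OF assms(2)] by simp
qed

definition closed_subspace :: "('a^2^2 \<Rightarrow> complex) set \<Rightarrow> bool" where
  "closed_subspace W \<longleftrightarrow> W \<subseteq> ps_space \<eta> \<and> (\<lambda>_. 0) \<in> W \<and>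
     (\<forall>f\<in>W. \<forall>g\<in>W. (\<lambda>x. f x + g x) \<in> W) \<and>
     (\<forall>c. \<forall>f\<in>W. (\<lambda>x. c * f x) \<in> W) \<and>
     (\<forall>f\<in>ps_space \<eta>. (\<forall>e>0. \<exists>g\<in>W. ps_norm (\<lambda>x. f x - g x) < e) \<longrightarrow> f \<in> W)"

lemma reducible_rep_iff:
  "reducible_rep SL2 left_translate (ps_space \<eta>) ps_norm \<longleftrightarrow>
    (\<exists>W. closed_subspace W \<and> (\<forall>h\<in>SL2. \<forall>f\<in>W. left_translate h f \<in> W) \<and> (\<exists>f\<in>W. ps_norm f \<noteq> 0) \<and> W \<noteq> ps_space \<eta>)"
  unfolding reducible_rep_def closed_subspace_def by (rule iff_exI) blast

text \<open>By the Cauchy-Schwarz inequality each functional is continuous for the seminorm. The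
  bilinear version yields the Hardy space, the Hermitian one the orthogonal complement used for
  irreducibility; \<open>j\<close> in the proof stands for either choice.\<close>

lemma closed_subspace_annihilator:
  assumes "S \<subseteq> ps_space \<eta>"
  shows "closed_subspace {f \<in> ps_space \<eta>. \<forall>g\<in>S. pairing f g = 0}"
    and "closed_subspace {f \<in> ps_space \<eta>. \<forall>g\<in>S. pairing f (\<lambda>x. cnj (g x)) = 0}"
proof -
  have gen: "closed_subspace {f \<in> ps_space \<eta>. \<forall>g\<in>S. pairing f (j g) = 0}"
    if int: "\<And>f g. f \<in> ps_space \<eta> \<Longrightarrow> g \<in> ps_space \<eta> \<Longrightarrow> integrable haar_K (\<lambda>k. f k * j g k)"
    and le: "\<And>f g. f \<in> ps_space \<eta> \<Longrightarrow> g \<in> ps_space \<eta> \<Longrightarrow> norm (pairing f (j g)) \<le> ps_norm f * ps_norm g"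
    for j :: "('a^2^2 \<Rightarrow> complex) \<Rightarrow> 'a^2^2 \<Rightarrow> complex"
  proof -
    have closed: "pairing f (j g) = 0"
      if f: "f \<in> ps_space \<eta>" and g: "g \<in> S"
        and ap: "\<And>e. e > 0 \<Longrightarrow> \<exists>f'\<in>{f \<in> ps_space \<eta>. \<forall>g\<in>S. pairing f (j g) = 0}. ps_norm (\<lambda>x. f x - f' x) < e" for f g
    proof (rule ccontr)
      assume nz: "pairing f (j g) \<noteq> 0"
      \<comment> \<open>The summand 1 keeps the denominator positive when \<open>g\<close> has
        seminorm zero.\<close>
      define e where "e = norm (pairing f (j g)) / (ps_norm g + 1)"
      have e: "e > 0"
        using nz by (simp add: e_def add_nonneg_pos)
      have g': "g \<in> ps_space \<eta>"
        using g assms by auto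
      obtain f' where f': "f' \<in> ps_space \<eta>" "pairing f' (j g) = 0" "ps_norm (\<lambda>x. f x - f' x) < e"
        using ap[OF e] g by auto
      have "pairing f (j g) = pairing (\<lambda>x. f x - f' x) (j g)"
        using int[OF f g'] int[OF f'(1) g'] f'(2) by (simp add: pairing_def left_diff_distrib)
      also have "norm \<dots> \<le> ps_norm (\<lambda>x. f x - f' x) * ps_norm g"
        by (rule le[OF ps_space_diff[OF f f'(1)] g'])
      also have "\<dots> \<le> e * ps_norm g"
        using f'(3) by (intro mult_right_mono) auto
      also have "\<dots> < e * (ps_norm g + 1)"
        using e by simp
      also have "\<dots> = norm (pairing f (j g))"
        using ps_norm_nonneg[of g] by (simp add: e_def add_nonneg_eq_0_iff)
      finally show False
        by simp
    qed
    have add: "pairing (\<lambda>x. f x + f' x) (j g) = pairing f (j g) + pairing f' (j g)"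
      if "f \<in> ps_space \<eta>" "f' \<in> ps_space \<eta>" "g \<in> S" for f f' g
      using int[OF that(1), of g] int[OF that(2), of g] that(3) assms by (auto simp: pairing_def distrib_right)
    have scale: "pairing (\<lambda>x. c * f x) (j g) = c * pairing f (j g)" for c f g
      by (simp add: pairing_def mult.assoc)
    show ?thesis
      unfolding closed_subspace_def
      using closed add scale ps_space_zero ps_space_add ps_space_scale
      by (auto simp: pairing_def)
  qed
  show "closed_subspace {f \<in> ps_space \<eta>. \<forall>g\<in>S. pairing f g = 0}"
    by (rule gen[of "\<lambda>g. g"]) (use ps_space_integrable_mult pairing_le in auto)
  show "closed_subspace {f \<in> ps_space \<eta>. \<forall>g\<in>S. pairing f (\<lambda>x. cnj (g x)) = 0}"
    by (rule gen[of "\<lambda>g x. cnj (g x)"]) (use ps_space_integrable_mult pairing_le in auto)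
qed

text \<open>Dominated convergence for squares: both \<open>F n\<close> and its limit are bounded by
  \<open>w\<close>, so the squared difference is bounded by four times the integrable function
  \<open>(w k)\<^sup>2\<close>.\<close>

lemma closed_subspace_limit:
  assumes W: "closed_subspace W" and F: "\<And>n. F n \<in> W" and f: "f \<in> ps_space \<eta>"
    and w: "integrable haar_K (\<lambda>k. (w k)\<^sup>2)"
    and lim: "AE k in haar_K. (\<lambda>n. F n k) \<longlonglongrightarrow> f k"
    and dom: "\<And>n. AE k in haar_K. norm (F n k) \<le> w k"
  shows "f \<in> W"
proof -
  have FV: "F n \<in> ps_space \<eta>" for n
    using W F unfolding closed_subspace_def by auto
  note [measurable] = ps_space_measurable[OF FV] ps_space_measurable[OF f]
  have domf: "AE k in haar_K. norm (f k) \<le> w k"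
  proof -
    have "AE k in haar_K. \<forall>n. norm (F n k) \<le> w k"
      using dom by (simp add: AE_all_countable)
    with lim show ?thesis
      by eventually_elim (auto intro: Lim_bounded[OF tendsto_norm])
  qed
  have "(\<lambda>n. \<integral>k. (norm (f k - F n k))\<^sup>2 \<partial>haar_K) \<longlonglongrightarrow> integral\<^sup>L haar_K (\<lambda>k::'a^2^2. 0)"
  proof (rule integral_dominated_convergence)
    show "integrable haar_K (\<lambda>k. 4 * (w k)\<^sup>2)"
      using w by simp
    show "AE k in haar_K. (\<lambda>n. (norm (f k - F n k))\<^sup>2) \<longlonglongrightarrow> 0"
      using lim
    proof eventually_elim
      case (elim k)
      have "(\<lambda>n. (norm (f k - F n k))\<^sup>2) \<longlonglongrightarrow> (norm (f k - f k))\<^sup>2"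
        by (intro tendsto_intros elim)
      then show ?case
        by simp
    qed
    show "AE k in haar_K. norm ((norm (f k - F n k))\<^sup>2) \<le> 4 * (w k)\<^sup>2" for n
      using domf dom[of n]
    proof eventually_elim
      case (elim k)
      have "norm (f k - F n k) \<le> 2 * w k"
        using norm_triangle_ineq4[of "f k" "F n k"] elim by linarith
      then have "(norm (f k - F n k))\<^sup>2 \<le> (2 * w k)\<^sup>2"
        by (rule power_mono) simp
      then show ?case
        by (simp add: power_mult_distrib)
    qed
  qed measurable
  then have "(\<lambda>n. sqrt (\<integral>k. (norm (f k - F n k))\<^sup>2 \<partial>haar_K)) \<longlonglongrightarrow> sqrt 0"
    by (intro tendsto_real_sqrt) simp
  then have "(\<lambda>n. ps_norm (\<lambda>x. f x - F n x)) \<longlonglongrightarrow> 0"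
    by (simp add: ps_norm_def)
  then have "\<exists>g\<in>W. ps_norm (\<lambda>x. f x - g x) < e" if "e > 0" for e
    using order_tendstoD(2)[of _ 0 sequentially e] that F
    by (meson eventually_sequentially le_refl)
  then show ?thesis
    using W f unfolding closed_subspace_def by blast
qed

text \<open>
  If \<open>m\<close> is never strictly separated from the bounded family \<open>X\<close> by a functional, then greedily chosen
  members satisfy \<open>norm (X\<^sub>1 + \<dots> + X\<^sub>n - n m)\<^sup>2 \<le> n C\<close>, so their averages tend to \<open>m\<close>. This
  replaces integration of vector-valued functions: \<open>m\<close> will be an average of \<open>X\<close>.
\<close>
lemma closed_subspace_average:
  assumes W: "closed_subspace W" and X: "\<And>i. i \<in> I \<Longrightarrow> X i \<in> W" and m: "m \<in> ps_space \<eta>"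
    and C: "\<And>i. i \<in> I \<Longrightarrow> (ps_norm (\<lambda>x. X i x - m x))\<^sup>2 \<le> C"
    and sep: "\<And>g. g \<in> ps_space \<eta> \<Longrightarrow> \<exists>i\<in>I. Re (pairing (\<lambda>x. X i x - m x) (\<lambda>x. cnj (g x))) \<le> 0"
  shows "m \<in> W"
proof -
  have WV: "W \<subseteq> ps_space \<eta>"
    and add: "\<And>f g. f \<in> W \<Longrightarrow> g \<in> W \<Longrightarrow> (\<lambda>x. f x + g x) \<in> W"
    and scale: "\<And>c f. f \<in> W \<Longrightarrow> (\<lambda>x. c * f x) \<in> W"
    and zero: "(\<lambda>_. 0) \<in> W"
    and cl: "\<And>f. f \<in> ps_space \<eta> \<Longrightarrow> (\<And>e. e > 0 \<Longrightarrow> \<exists>g\<in>W. ps_norm (\<lambda>x. f x - g x) < e) \<Longrightarrow> f \<in> W"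
    using W unfolding closed_subspace_def by auto
  have S: "\<exists>S\<in>W. (ps_norm (\<lambda>x. S x - of_nat n * m x))\<^sup>2 \<le> real n * C" for n
  proof (induction n)
    case 0
    show ?case
      by (rule bexI[OF _ zero]) (simp add: ps_norm_def)
  next
    case (Suc n)
    then obtain S where S: "S \<in> W" "(ps_norm (\<lambda>x. S x - of_nat n * m x))\<^sup>2 \<le> real n * C"
      by auto
    have SV: "(\<lambda>x. S x - of_nat n * m x) \<in> ps_space \<eta>"
      using S(1) WV by (intro ps_space_diff ps_space_scale m) auto
    \<comment> \<open>The separation hypothesis is applied to the current error itself. The cross
      term in the expansion of the new squared error is then nonpositive, so one more summand costs
      at most \<open>C\<close>.\<close>
    then obtain i where i: "i \<in> I" "Re (pairing (\<lambda>x. X i x - m x) (\<lambda>x. cnj (S x - of_nat n * m x))) \<le> 0"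
      using sep by blast
    have XV: "(\<lambda>x. X i x - m x) \<in> ps_space \<eta>"
      using X[OF i(1)] WV by (intro ps_space_diff m) auto
    have "(\<lambda>x. S x + X i x - of_nat (Suc n) * m x) = (\<lambda>x. (S x - of_nat n * m x) + (X i x - m x))"
      by (simp add: fun_eq_iff algebra_simps)
    then have "(ps_norm (\<lambda>x. S x + X i x - of_nat (Suc n) * m x))\<^sup>2 \<le> real n * C + C"
      using ps_norm_add_square[OF SV XV] i S(2) C[OF i(1)] by simp
    then have "(ps_norm (\<lambda>x. S x + X i x - of_nat (Suc n) * m x))\<^sup>2 \<le> real (Suc n) * C"
      by (simp add: algebra_simps)
    then show ?case
      by (rule bexI[of _ "\<lambda>x. S x + X i x"]) (rule add[OF S(1) X[OF i(1)]])
  qed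
  show ?thesis
  proof (rule cl[OF m])
    fix e :: real assume e: "e > 0"
    obtain n :: nat where "C / e\<^sup>2 < real n"
      using reals_Archimedean2 by blast
    then obtain n :: nat where n: "n > 0" "C / e\<^sup>2 < real n"
      by (metis gr0I less_Suc_eq of_nat_less_iff order_less_trans zero_less_Suc)
    obtain S where S: "S \<in> W" "(ps_norm (\<lambda>x. S x - of_nat n * m x))\<^sup>2 \<le> real n * C"
      using S by blast
    let ?S = "\<lambda>x. inverse (of_nat n) * S x"
    have "(\<lambda>x. m x - ?S x) = (\<lambda>x. - inverse (of_nat n) * (S x - of_nat n * m x))"
      using n by (auto simp: fun_eq_iff field_simps)
    then have "ps_norm (\<lambda>x. m x - ?S x) = ps_norm (\<lambda>x. S x - of_nat n * m x) / real n"
      unfolding \<open>_ = _\<close> ps_norm_scale by (simp add: norm_inverse divide_inverse mult.commute)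
    then have "(ps_norm (\<lambda>x. m x - ?S x))\<^sup>2 \<le> real n * C / (real n)\<^sup>2"
      using S(2) by (simp add: power_divide divide_right_mono)
    also have "\<dots> = C / real n"
      using n by (simp add: power2_eq_square)
    also have "\<dots> < e\<^sup>2"
      using n e by (simp add: field_simps)
    finally have "ps_norm (\<lambda>x. m x - ?S x) < e"
      using e by (simp add: power2_less_imp_less)
    then show "\<exists>g\<in>W. ps_norm (\<lambda>x. m x - g x) < e"
      by (rule bexI[of _ ?S]) (rule scale[OF S(1)])
  qed
qed

end

subsection \<open>Concentration of the translated spherical vectors\<close>

text \<open>The tail beyond \<open>x\<close> is the volume of the ball of radius
  \<open>exp (- x)\<close>. This is the radial half of polar coordinates, valid in every dimension,
  and it is all that radial integrands require.\<close>

lemma distr_lborel_ln_norm: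
  "distr lborel borel (\<lambda>t :: 'b::euclidean_space. - ln (norm t))
     = density lborel (\<lambda>x. ennreal (unit_ball_vol DIM('b) * DIM('b) * exp (- (DIM('b) * x))))"
proof (rule measure_eqI_lessThan)
  let ?d = "real DIM('b)" and ?V = "unit_ball_vol (real DIM('b))"
  have V: "?V > 0"
    by simp
  fix x :: real
  have "emeasure (distr lborel borel (\<lambda>t :: 'b. - ln (norm t))) {x<..} = emeasure lborel {t :: 'b. x < - ln (norm t)}"
    by (subst emeasure_distr) (auto simp: vimage_def)
  also have "\<dots> = emeasure lborel (ball (0 :: 'b) (exp (- x)))"
  proof (rule emeasure_eq_AE)
    show "AE t in lborel. t \<in> {t :: 'b. x < - ln (norm t)} \<longleftrightarrow> t \<in> ball (0 :: 'b) (exp (- x))"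
      using AE_lborel_singleton[of "0 :: 'b"]
    proof eventually_elim
      case (elim t)
      have "x < - ln (norm t) \<longleftrightarrow> ln (norm t) < - x"
        by linarith
      also have "\<dots> \<longleftrightarrow> norm t < exp (- x)"
        using elim by (metis exp_less_cancel_iff exp_ln zero_less_norm_iff)
      finally show ?case
        by simp
    qed
  qed simp_all
  also have "\<dots> = ennreal (?V * exp (- (?d * x)))"
    by (simp add: emeasure_ball exp_of_nat_mult[symmetric])
  finally have 1: "emeasure (distr lborel borel (\<lambda>t :: 'b. - ln (norm t))) {x<..} = ennreal (?V * exp (- (?d * x)))" .
  have "emeasure (density lborel (\<lambda>x. ennreal (?V * ?d * exp (- (?d * x))))) {x<..}
      = (\<integral>\<^sup>+y. ennreal (?V * ?d * exp (- (?d * y))) * indicator {x<..} y \<partial>lborel)"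
    by (rule emeasure_density) simp_all
  also have "\<dots> = (\<integral>\<^sup>+y. ennreal (?V * ?d * exp (- (?d * y))) * indicator {x..} y \<partial>lborel)"
    by (rule nn_integral_cong_AE, use AE_lborel_singleton[of x] in eventually_elim) (auto simp: indicator_def)
  also have "\<dots> = ennreal (0 - (- (?V * exp (- (?d * x)))))"
  proof (rule nn_integral_FTC_atLeast)
    show "((\<lambda>y. - (?V * exp (- (?d * y)))) has_real_derivative ?V * ?d * exp (- (?d * y))) (at y)" for y
      by (auto intro!: derivative_eq_intros)
    have "((\<lambda>y::real. exp (- (?d * y))) \<longlongrightarrow> 0) at_top"
      by (rule filterlim_compose[OF exp_at_bot])
        (auto simp: filterlim_uminus_at_bot intro!: filterlim_tendsto_pos_mult_at_top[OF tendsto_const] filterlim_ident)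
    from tendsto_mult_left[OF this, of "- ?V"] show "((\<lambda>y. - (?V * exp (- (?d * y)))) \<longlongrightarrow> 0) at_top"
      by simp
  qed (use V in auto)
  finally show "emeasure (distr lborel borel (\<lambda>t :: 'b. - ln (norm t))) {x<..}
      = emeasure (density lborel (\<lambda>x. ennreal (?V * ?d * exp (- (?d * x))))) {x<..}"
    by (simp add: 1)
  show "emeasure (distr lborel borel (\<lambda>t :: 'b. - ln (norm t))) {x<..} < \<infinity>"
    by (simp add: 1)
qed simp_all

lemma sets_haar_L [measurable_cong, simp]: "sets haar_L = sets borel"
  by (simp add: haar_L_def)

text \<open>The weight of the Haar measure, \<open>norm t\<close> to the power
  \<open>- DIM('a)\<close>, is the inverse of the exponential density found above. The logarithm
  thus carries \<open>haar_L\<close> to a multiple of Lebesgue measure; this gives the divergence of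
  the kernels as well as the reduction of the residual distribution to a half-line.\<close>

lemma distr_haar_L:
  "distr haar_L borel (\<lambda>t :: 'a::{real_normed_field, euclidean_space}. - ln (norm t))
     = density lborel (\<lambda>_. ennreal (unit_ball_vol DIM('a) * DIM('a)))"
proof (rule measure_eqI)
  fix A :: "real set" assume "A \<in> sets (distr haar_L borel (\<lambda>t :: 'a. - ln (norm t)))"
  then have [measurable]: "A \<in> sets borel"
    by simp
  let ?d = "real DIM('a)" and ?V = "unit_ball_vol (real DIM('a))"
  have "emeasure (distr haar_L borel (\<lambda>t :: 'a. - ln (norm t))) A
      = (\<integral>\<^sup>+t. indicator A t \<partial>distr haar_L borel (\<lambda>t :: 'a. - ln (norm t)))"
    by simp
  also have "\<dots> = (\<integral>\<^sup>+t. indicator A (- ln (norm (t :: 'a))) \<partial>haar_L)"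
    by (rule nn_integral_distr) (simp_all add: haar_L_def)
  also have "\<dots> = (\<integral>\<^sup>+t. ennreal (1 / norm (t :: 'a) ^ DIM('a)) * indicator A (- ln (norm t)) \<partial>lborel)"
    unfolding haar_L_def by (rule nn_integral_density) simp_all
  also have "\<dots> = (\<integral>\<^sup>+t. ennreal (exp (?d * (- ln (norm (t :: 'a))))) * indicator A (- ln (norm t)) \<partial>lborel)"
  proof (rule nn_integral_cong_AE, use AE_lborel_singleton[of "0 :: 'a"] in eventually_elim)
    case (elim t)
    then have "exp (?d * (- ln (norm t))) = 1 / norm t ^ DIM('a)"
      by (simp add: exp_minus exp_of_nat_mult inverse_eq_divide)
    then show ?case
      by simp
  qed
  also have "\<dots> = (\<integral>\<^sup>+x. ennreal (exp (?d * x)) * indicator A x \<partial>distr lborel borel (\<lambda>t :: 'a. - ln (norm t)))"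
    by (rule nn_integral_distr[symmetric]) simp_all
  also have "\<dots> = (\<integral>\<^sup>+x. ennreal (?V * ?d * exp (- (?d * x))) * (ennreal (exp (?d * x)) * indicator A x) \<partial>lborel)"
    unfolding distr_lborel_ln_norm by (rule nn_integral_density) simp_all
  also have "\<dots> = (\<integral>\<^sup>+x. ennreal (?V * ?d) * indicator A x \<partial>lborel)"
  proof (rule nn_integral_cong)
    fix x
    have "ennreal (?V * ?d * exp (- (?d * x))) * ennreal (exp (?d * x)) = ennreal (?V * ?d)"
      by (simp add: ennreal_mult[symmetric] exp_minus mult.assoc)
    then show "ennreal (?V * ?d * exp (- (?d * x))) * (ennreal (exp (?d * x)) * indicator A x) = ennreal (?V * ?d) * indicator A x"
      by (simp add: mult.assoc[symmetric])
  qed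
  also have "\<dots> = emeasure (density lborel (\<lambda>_. ennreal (?V * ?d))) A"
    by (rule emeasure_density[symmetric]) simp_all
  finally show "emeasure (distr haar_L borel (\<lambda>t :: 'a. - ln (norm t))) A
      = emeasure (density lborel (\<lambda>_. ennreal (?V * ?d))) A" .
qed simp

text \<open>Up to the null set at the origin, the ball of radius 1/2 is the half-line beyond
  \<open>ln 2\<close> in the logarithmic coordinate, which has infinite length.\<close>

lemma nn_integral_haar_L_infinite:
  "(\<integral>\<^sup>+t. ennreal (inverse (norm t ^ DIM('a))) * indicator (ball (0 :: 'a::{real_normed_field, euclidean_space}) (1/2)) t \<partial>lborel) = \<infinity>"
proof -
  let ?B = "{t :: 'a. ln 2 < - ln (norm t)}"
  have "(\<infinity> :: ennreal) = emeasure (density lborel (\<lambda>_. ennreal (unit_ball_vol DIM('a) * DIM('a)))) {ln (2::real) <..}"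
  proof -
    have "emeasure lborel {ln (2::real) <..} = (\<infinity> :: ennreal)"
    proof (rule ccontr)
      assume "emeasure lborel {ln (2::real) <..} \<noteq> \<infinity>"
      then obtain r where r: "r \<ge> 0" "emeasure lborel {ln (2::real) <..} = ennreal r"
        by (metis ennreal_cases infinity_ennreal_def)
      have "emeasure lborel {ln (2::real)<..<ln 2 + (r + 1)} \<le> emeasure lborel {ln (2::real) <..}"
        by (rule emeasure_mono) auto
      then show False
        using r by (simp del: ennreal_plus)
    qed
    then show ?thesis
      using less_imp_neq[OF unit_ball_vol_pos[of "real DIM('a)"]]
      by (subst emeasure_density) (auto simp: nn_integral_cmult ennreal_mult_top)
  qed
  also have "\<dots> = emeasure haar_L ?B"
    unfolding distr_haar_L[symmetric] by (subst emeasure_distr) (auto simp: vimage_def haar_L_def)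
  also have "\<dots> = (\<integral>\<^sup>+t. ennreal (1 / norm (t :: 'a) ^ DIM('a)) * indicator ?B t \<partial>lborel)"
    unfolding haar_L_def by (rule emeasure_density) simp_all
  also have "\<dots> \<le> (\<integral>\<^sup>+t. ennreal (inverse (norm (t :: 'a) ^ DIM('a))) * indicator (ball 0 (1/2)) t \<partial>lborel)"
  proof (rule nn_integral_mono)
    fix t :: 'a
    have "norm t < 1/2" if "ln 2 < - ln (norm t)"
    proof (cases "t = 0")
      case False
      have "ln (norm t) < ln (1/2)"
        using that by (simp add: ln_div)
      then show ?thesis
        using False by (subst (asm) ln_less_cancel_iff) auto
    qed simp
    then show "ennreal (1 / norm t ^ DIM('a)) * indicator ?B t \<le> ennreal (inverse (norm t ^ DIM('a))) * indicator (ball 0 (1/2)) t"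
      by (auto simp: indicator_def inverse_eq_divide)
  qed
  finally show ?thesis
    by (simp add: top_unique)
qed

text \<open>The excluded matrices form the point at infinity of the projective line. Almost
  everywhere the affine coordinate \<open>k $ 1 $ 1 / k $ 2 $ 1\<close> is a genuine
  quotient.\<close>

lemma AE_haar_K_nonzero:
  "AE k in (haar_K :: ('a::{real_normed_field, euclidean_space}^2^2) measure). k $ 2 $ 1 \<noteq> 0"
proof -
  have "emeasure lborel {v :: 'a^2. v $ 2 = 0} = (\<integral>\<^sup>+v. indicator {v :: 'a^2. v $ 2 = 0} v \<partial>lborel)"
    by (rule nn_integral_indicator[symmetric]) simp
  also have "\<dots> = (\<integral>\<^sup>+x. \<integral>\<^sup>+y. indicator {0 :: 'a} y \<partial>lborel \<partial>(lborel :: 'a measure))"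
    by (subst nn_integral_lborel_vector2(2), simp, intro nn_integral_cong) (simp add: indicator_def)
  also have "(\<integral>\<^sup>+y. indicator {0 :: 'a} y \<partial>lborel) = 0"
    by (rule trans[OF nn_integral_indicator]) simp_all
  also have "(\<integral>\<^sup>+x. 0 \<partial>(lborel :: 'a measure)) = 0"
    by simp
  finally have "AE v :: 'a^2 in lborel. v $ 2 \<noteq> 0"
    by (subst AE_iff_measurable[of "{v :: 'a^2. v $ 2 = 0}"]) simp_all
  then have "AE v in (unif_ball :: ('a^2) measure). v $ 2 \<noteq> 0"
    by (rule AE_unif_ball)
  then have "AE v in (unif_ball :: ('a^2) measure). K_elt (sgn v) $ 2 $ 1 \<noteq> 0"
    using AE_unif_ball_nonzero
    by eventually_elim (simp add: K_elt_def sgn_div_norm)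
  then show ?thesis
    unfolding haar_K_def by (subst AE_distr_iff) simp_all
qed

text \<open>Near the line with vanishing second coordinate, the entry \<open>k $ 2 $ 1\<close>
  behaves like a coordinate on a space of dimension \<open>DIM('a)\<close>, and the inverse power of
  exactly this order is not integrable there.\<close>

lemma nn_integral_haar_K_infinite:
  "(\<integral>\<^sup>+k. ennreal (inverse (norm (k $ 2 $ 1 :: 'a::{real_normed_field, euclidean_space}) ^ DIM('a))) \<partial>haar_K) = \<infinity>"
proof -
  let ?d = "DIM('a)"
  have [measurable]: "ball (0 :: 'a) r \<in> sets borel" "ball (0 :: 'a^2) r \<in> sets borel" for r
    by simp_all
  \<comment> \<open>With \<open>x\<close> in this annulus and \<open>norm y < 1/2\<close>, the
    vector \<open>[x, y]\<close> stays in the unit ball and has norm at least 1/4. Normalising it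
    therefore enlarges the second coordinate by a factor of at most 4, which is the constant
    \<open>(1/4) ^ ?d\<close> below.\<close>
  let ?S = "{x :: 'a. norm x \<ge> 1/4 \<and> norm x < 1/2}"
  have pos: "emeasure lborel ?S \<noteq> 0"
  proof
    assume 0: "emeasure lborel ?S = 0"
    have "emeasure lborel (ball (of_real (3/8) :: 'a) (1/8)) \<le> emeasure lborel ?S"
    proof (rule emeasure_mono)
      show "ball (of_real (3/8) :: 'a) (1/8) \<subseteq> ?S"
      proof
        fix x :: 'a assume "x \<in> ball (of_real (3/8)) (1/8)"
        then have "norm (x - of_real (3/8)) < 1/8"
          by (simp add: dist_norm norm_minus_commute)
        then show "x \<in> ?S"
          using norm_triangle_ineq2[of x "of_real (3/8)"] norm_triangle_ineq3[of x "of_real (3/8)"]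
          by (simp add: norm_of_real)
      qed
    qed simp
    with 0 show False
      using unit_ball_vol_pos[of "real DIM('a)"] by (simp add: emeasure_ball)
  qed
  have "(\<infinity>::ennreal) = ennreal ((1/4) ^ ?d) * emeasure lborel ?S * \<infinity>"
    using pos by (simp add: ennreal_mult_top ennreal_top_mult ennreal_mult_eq_top_iff)
  also have "\<dots> = (\<integral>\<^sup>+x. ennreal ((1/4) ^ ?d) * indicator ?S x * \<infinity> \<partial>lborel)"
    by (simp add: nn_integral_cmult nn_integral_multc)
  also have "\<dots> = (\<integral>\<^sup>+x. \<integral>\<^sup>+y. ennreal ((1/4) ^ ?d) * indicator ?S x * (ennreal (inverse (norm y ^ ?d)) * indicator (ball (0 :: 'a) (1/2)) y) \<partial>lborel \<partial>lborel)"
  proof (rule nn_integral_cong)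
    fix x :: 'a
    have "(\<integral>\<^sup>+y. c * (ennreal (inverse (norm y ^ ?d)) * indicator (ball (0 :: 'a) (1/2)) y) \<partial>lborel) = c * \<infinity>" for c
      by (subst nn_integral_cmult, measurable) (simp only: nn_integral_haar_L_infinite)
    then show "ennreal ((1/4) ^ ?d) * indicator ?S x * \<infinity> = (\<integral>\<^sup>+y. ennreal ((1/4) ^ ?d) * indicator ?S x *
        (ennreal (inverse (norm y ^ ?d)) * indicator (ball (0 :: 'a) (1/2)) y) \<partial>lborel)"
      by metis
  qed
  also have "\<dots> \<le> (\<integral>\<^sup>+x. \<integral>\<^sup>+y. ennreal (inverse (norm (sgn (vector [x, y] :: 'a^2) $ 2) ^ ?d)) * indicator (ball 0 1) (vector [x, y] :: 'a^2) \<partial>lborel \<partial>lborel)"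
  proof (intro nn_integral_mono)
    fix x y :: 'a
    let ?v = "vector [x, y] :: 'a^2"
    show "ennreal ((1/4) ^ ?d) * indicator ?S x * (ennreal (inverse (norm y ^ ?d)) * indicator (ball 0 (1/2)) y)
      \<le> ennreal (inverse (norm (sgn ?v $ 2) ^ ?d)) * indicator (ball 0 1) ?v"
    proof (cases "x \<in> ?S \<and> norm y < 1/2")
      case True
      have n: "(norm ?v)\<^sup>2 = (norm x)\<^sup>2 + (norm y)\<^sup>2"
        by (simp add: norm_vec2)
      have "(norm x)\<^sup>2 \<le> (1/2)\<^sup>2" "(norm y)\<^sup>2 \<le> (1/2)\<^sup>2"
        using True by (auto intro!: power_mono)
      then have "(norm ?v)\<^sup>2 < 1\<^sup>2"
        unfolding n by (simp add: power2_eq_square)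
      then have 1: "norm ?v < 1"
        by (rule power2_less_imp_less) simp
      have "(norm x)\<^sup>2 \<le> (norm ?v)\<^sup>2"
        unfolding n by simp
      then have "norm x \<le> norm ?v"
        by (rule power2_le_imp_le) simp
      then have "1/4 \<le> norm ?v"
        using True by auto
      then have "(1/4) ^ ?d * inverse (norm y ^ ?d) \<le> norm ?v ^ ?d * inverse (norm y ^ ?d)"
        by (intro mult_right_mono power_mono) auto
      also have "\<dots> = inverse (norm (sgn ?v $ 2) ^ ?d)"
        by (simp add: sgn_div_norm norm_inverse power_mult_distrib power_inverse)
      finally show ?thesis
        using True 1 by (simp add: ennreal_mult[symmetric] ennreal_leI)
    next
      case False
      then show ?thesis
        by (auto simp: indicator_def)
    qed
  qed
  also have "\<dots> = (\<integral>\<^sup>+v. ennreal (inverse (norm (sgn v $ 2) ^ ?d)) * indicator (ball (0::'a^2) 1) v \<partial>lborel)"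
    by (rule nn_integral_lborel_vector2(2)[symmetric]) measurable
  finally have inf: "(\<integral>\<^sup>+v. ennreal (inverse (norm (sgn v $ 2) ^ ?d)) * indicator (ball (0::'a^2) 1) v \<partial>lborel) = \<infinity>"
    by (simp add: top_unique)
  have "(\<integral>\<^sup>+k. ennreal (inverse (norm (k $ 2 $ 1 :: 'a) ^ DIM('a))) \<partial>haar_K)
     = (\<integral>\<^sup>+v. ennreal (inverse (norm (sgn v $ 2) ^ ?d)) \<partial>(unif_ball :: ('a^2) measure))"
    by (subst nn_integral_haar_K) (simp_all add: K_elt_def)
  also have "\<dots> = \<infinity>"
    using emeasure_unit_ball(2)[where 'b="'a^2"]
    by (subst nn_integral_uniform_measure) (auto simp: inf ennreal_top_divide)
  finally show ?thesis .
qed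

section \<open>Invariance of Haar measure and averages of vectors over \<open>K\<close>\<close>

lemma haar_K_left_invariant:
  fixes u :: "'a::{real_normed_field, euclidean_space}^2"
  assumes u: "norm u = 1"
  shows "distr haar_K borel ((**) (K_elt u)) = haar_K"
proof (rule measure_eqI)
  fix A :: "('a^2^2) set" assume "A \<in> sets (distr haar_K borel ((**) (K_elt u)))"
  then have [measurable]: "A \<in> sets borel"
    by simp
  have "emeasure (distr haar_K borel ((**) (K_elt u))) A = (\<integral>\<^sup>+k. indicator A k \<partial>distr haar_K borel ((**) (K_elt u)))"
    by simp
  also have "\<dots> = (\<integral>\<^sup>+k. indicator A (K_elt u ** k) \<partial>haar_K)"
    by (rule nn_integral_distr) simp_all
  \<comment> \<open>Elements of \<open>K\<close> are isometries, so the Jacobian is 1 and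
    normalising the translated column changes nothing: the invariance is the special case of the
    general transformation formula.\<close>
  also have "\<dots> = (\<integral>\<^sup>+k. ennreal (inverse (norm (K_elt u *v column 1 k) ^ (2 * DIM('a)))) *
      indicator A (K_elt (sgn (K_elt u *v column 1 k))) \<partial>haar_K)"
  proof (rule nn_integral_cong_AE, use AE_haar_K_SL2 in eventually_elim)
    case (elim k)
    then have "sgn (K_elt u *v column 1 k) = K_elt u *v column 1 k"
      by (simp add: sgn_div_norm norm_K_elt_mult u)
    moreover have "K_elt (K_elt u *v column 1 k) = K_elt u ** k"
      using elim by (metis K_elt_mult)
    ultimately show ?case
      using elim by (simp add: norm_K_elt_mult u)
  qed
  also have "\<dots> = (\<integral>\<^sup>+k. indicator A k \<partial>haar_K)"
    by (rule nn_integral_haar_K_SL2) (simp_all add: K_elt_in_SL2 u)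
  finally show "emeasure (distr haar_K borel ((**) (K_elt u))) A = emeasure haar_K A"
    by simp
qed simp

lemma integral_haar_K_left:
  fixes P :: "'a::{real_normed_field, euclidean_space}^2^2 \<Rightarrow> 'b::{banach, second_countable_topology}"
  assumes [measurable]: "P \<in> borel_measurable borel" and u: "norm u = 1"
  shows "(\<integral>k. P (K_elt u ** k) \<partial>haar_K) = (\<integral>k. P k \<partial>haar_K)"
    and "integrable haar_K (\<lambda>k. P (K_elt u ** k)) \<longleftrightarrow> integrable haar_K P"
proof -
  show "(\<integral>k. P (K_elt u ** k) \<partial>haar_K) = (\<integral>k. P k \<partial>haar_K)"
    by (subst (2) haar_K_left_invariant[OF u, symmetric]) (simp add: integral_distr)
  show "integrable haar_K (\<lambda>k. P (K_elt u ** k)) \<longleftrightarrow> integrable haar_K P"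
    by (subst (2) haar_K_left_invariant[OF u, symmetric]) (simp add: integrable_distr_eq)
qed

interpretation haar_K: finite_measure "haar_K :: ('a::{real_normed_field, euclidean_space}^2^2) measure"
  by (rule finite_measure_haar_K)

lemma AE_haar_K_not_False: "\<not> (AE k in (haar_K :: ('a::{real_normed_field, euclidean_space}^2^2) measure). False)"
  by (simp add: ae_filter_eq_bot_iff trivial_limit_def[symmetric] emeasure_haar_K_UNIV)

context ps_char
begin

lemma ps_norm_triangle:
  assumes "f \<in> ps_space \<eta>" "g \<in> ps_space \<eta>"
  shows "ps_norm (\<lambda>x. f x + g x) \<le> ps_norm f + ps_norm g"
proof -
  have "Re (pairing g (\<lambda>x. cnj (f x))) \<le> norm (pairing g (\<lambda>x. cnj (f x)))"
    by (rule complex_Re_le_cmod)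
  also have "\<dots> \<le> ps_norm g * ps_norm f"
    by (rule pairing_le(2)[OF assms(2,1)])
  finally have "(ps_norm (\<lambda>x. f x + g x))\<^sup>2 \<le> (ps_norm f + ps_norm g)\<^sup>2"
    unfolding ps_norm_add_square[OF assms] power2_sum by (simp add: mult.commute)
  then show ?thesis
    by (rule power2_le_imp_le) simp
qed

text \<open>A vector that is pointwise the mean of a bounded family cannot be strictly separated
  from the whole family: integrating the separating functional over \<open>K\<close> would give a
  positive number that is also zero. The averaging lemma then applies.\<close>

lemma closed_subspace_integral:
  fixes \<Phi> :: "'a^2^2 \<Rightarrow> 'a^2^2 \<Rightarrow> complex"
  assumes W: "closed_subspace W"
    and \<Phi>m [measurable]: "(\<lambda>p. \<Phi> (fst p) (snd p)) \<in> borel_measurable (borel \<Otimes>\<^sub>M borel)"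
    and \<Phi>W: "\<And>u. norm u = 1 \<Longrightarrow> \<Phi> (K_elt u) \<in> W"
    and B: "\<And>u. norm u = 1 \<Longrightarrow> ps_norm (\<Phi> (K_elt u)) \<le> B"
    and m: "m \<in> ps_space \<eta>" "AE x in haar_K. m x = (\<integral>k. \<Phi> k x \<partial>haar_K)"
  shows "m \<in> W"
proof (rule closed_subspace_average[where X = "\<lambda>u. \<Phi> (K_elt u)" and I = "{u. norm u = 1}", OF W _ m(1)])
  have WV: "W \<subseteq> ps_space \<eta>"
    using W by (simp add: closed_subspace_def)
  have \<Phi>V: "\<Phi> (K_elt u) \<in> ps_space \<eta>" if "norm u = 1" for u
    using \<Phi>W[OF that] WV by auto
  show "(ps_norm (\<lambda>x. \<Phi> (K_elt u) x - m x))\<^sup>2 \<le> (B + ps_norm m)\<^sup>2" if "u \<in> {u. norm u = 1}" for u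
  proof (rule power_mono)
    have "ps_norm (\<lambda>x. \<Phi> (K_elt u) x + - 1 * m x) \<le> ps_norm (\<Phi> (K_elt u)) + ps_norm (\<lambda>x. - 1 * m x)"
      using that by (intro ps_norm_triangle \<Phi>V ps_space_scale m) auto
    also have "\<dots> \<le> B + ps_norm m"
      unfolding ps_norm_scale using B[of u] that by simp
    finally show "ps_norm (\<lambda>x. \<Phi> (K_elt u) x - m x) \<le> B + ps_norm m"
      by simp
  qed simp
  fix g assume g: "g \<in> ps_space \<eta>"
  have [measurable]: "g \<in> borel_measurable borel" "m \<in> borel_measurable borel"
    using g m by (auto intro: ps_space_measurable)
  define F where "F k x = \<Phi> k x * cnj (g x)" for k x
  interpret HH: pair_sigma_finite "haar_K :: ('a^2^2) measure" "haar_K :: ('a^2^2) measure" ..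
  have [measurable]: "case_prod F \<in> borel_measurable (haar_K \<Otimes>\<^sub>M haar_K)"
  proof -
    have "case_prod F \<in> borel_measurable (borel \<Otimes>\<^sub>M borel)"
      unfolding F_def[abs_def] case_prod_beta by measurable
    moreover have "sets (haar_K \<Otimes>\<^sub>M haar_K :: (('a^2^2) \<times> ('a^2^2)) measure) = sets (borel \<Otimes>\<^sub>M borel)"
      by (rule sets_pair_measure_cong) simp_all
    ultimately show ?thesis
      by (simp cong: measurable_cong_sets)
  qed
  have int: "integrable (haar_K \<Otimes>\<^sub>M haar_K) (case_prod F)"
  proof (rule HH.Fubini_integrable)
    show "integrable haar_K (\<lambda>k. \<integral>x. norm (case (k, x) of (k, x) \<Rightarrow> F k x) \<partial>haar_K)"
    proof (rule haar_K.integrable_const_bound)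
      \<comment> \<open>The product of two norms is at most the sum of their squares, so the inner
        integral has a bound independent of \<open>k\<close>; as \<open>haar_K\<close> is finite,
        this suffices for Fubini's theorem.\<close>
      show "AE k in haar_K. norm (\<integral>x. norm (case (k, x) of (k, x) \<Rightarrow> F k x) \<partial>haar_K) \<le> B\<^sup>2 + (ps_norm g)\<^sup>2"
        using AE_haar_K_SL2
      proof eventually_elim
        case (elim k)
        define u where "u = column 1 k"
        have u: "norm u = 1" "k = K_elt u"
          using elim by (auto simp: u_def)
        have "(\<integral>x. norm (F k x) \<partial>haar_K) \<le> (\<integral>x. (norm (\<Phi> k x))\<^sup>2 + (norm (g x))\<^sup>2 \<partial>haar_K)"
        proof (rule integral_mono)
          show "integrable haar_K (\<lambda>x. norm (F k x))"
            unfolding F_def u using ps_space_integrable_mult(2)[OF \<Phi>V[OF u(1)] g] by (rule integrable_norm)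
          show "integrable haar_K (\<lambda>x. (norm (\<Phi> k x))\<^sup>2 + (norm (g x))\<^sup>2)"
            unfolding u by (intro Bochner_Integration.integrable_add ps_space_integrable g \<Phi>V u)
          fix x
          have "2 * (norm (\<Phi> k x) * norm (g x)) \<le> (norm (\<Phi> k x))\<^sup>2 + (norm (g x))\<^sup>2"
            using sum_squares_bound[of "norm (\<Phi> k x)" "norm (g x)"] by simp
          moreover have "0 \<le> norm (\<Phi> k x) * norm (g x)"
            by simp
          ultimately have "norm (\<Phi> k x) * norm (g x) \<le> (norm (\<Phi> k x))\<^sup>2 + (norm (g x))\<^sup>2"
            by linarith
          then show "norm (F k x) \<le> (norm (\<Phi> k x))\<^sup>2 + (norm (g x))\<^sup>2"
            by (simp add: F_def norm_mult)
        qed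
        also have "\<dots> = (ps_norm (\<Phi> k))\<^sup>2 + (ps_norm g)\<^sup>2"
          unfolding ps_norm_square u by (intro Bochner_Integration.integral_add ps_space_integrable g \<Phi>V u)
        also have "\<dots> \<le> B\<^sup>2 + (ps_norm g)\<^sup>2"
          unfolding u using B[OF u(1)] by (auto intro!: power_mono)
        finally show ?case
          by simp
      qed
    qed (use haar_K.borel_measurable_lebesgue_integral in measurable)
    show "AE k in haar_K. integrable haar_K (\<lambda>x. case (k, x) of (k, x) \<Rightarrow> F k x)"
      using AE_haar_K_SL2
    proof eventually_elim
      case (elim k)
      then have "\<Phi> k \<in> ps_space \<eta>"
        using \<Phi>V[of "column 1 k"] by simp
      then show ?case
        using ps_space_integrable_mult(2)[OF _ g] by (simp add: F_def)
    qed
  qed measurable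
  define \<phi> where "\<phi> k = pairing (\<Phi> k) (\<lambda>x. cnj (g x))" for k
  have \<phi>: "\<phi> k = (\<integral>x. F k x \<partial>haar_K)" for k
    by (simp add: \<phi>_def pairing_def F_def)
  have \<phi>_int: "integrable haar_K \<phi>"
    unfolding \<phi>[abs_def] by (rule HH.integrable_fst[OF int])
  have "(\<integral>k. \<phi> k \<partial>haar_K) = (\<integral>x. (\<integral>k. F k x \<partial>haar_K) \<partial>haar_K)"
    unfolding \<phi> by (rule HH.Fubini_integral[OF int, symmetric])
  also have "\<dots> = (\<integral>x. m x * cnj (g x) \<partial>haar_K)"
  proof (rule integral_cong_AE)
    show "(\<lambda>x. \<integral>k. F k x \<partial>haar_K) \<in> borel_measurable haar_K"
      by (rule borel_measurable_integrable[OF HH.integrable_snd[OF int]])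
    show "AE x in haar_K. (\<integral>k. F k x \<partial>haar_K) = m x * cnj (g x)"
      using m(2) by eventually_elim (simp add: F_def)
  qed simp
  finally have \<phi>m: "(\<integral>k. \<phi> k \<partial>haar_K) = pairing m (\<lambda>x. cnj (g x))"
    by (simp add: pairing_def)
  \<comment> \<open>\<open>h\<close> is the separation as a function on \<open>K\<close>. Its
    integral is zero, so it cannot be positive almost everywhere on a space of total mass 1.\<close>
  define h where "h k = Re (\<phi> k) - Re (pairing m (\<lambda>x. cnj (g x)))" for k
  have h_int: "integrable haar_K h"
    unfolding h_def[abs_def] using \<phi>_int by (intro Bochner_Integration.integrable_diff integrable_Re) auto
  have h0: "(\<integral>k. h k \<partial>haar_K) = 0"
    unfolding h_def using \<phi>_int by (simp add: integral_Re \<phi>m)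
  show "\<exists>u\<in>{u. norm u = 1}. Re (pairing (\<lambda>x. \<Phi> (K_elt u) x - m x) (\<lambda>x. cnj (g x))) \<le> 0"
  proof (rule ccontr)
    assume neg: "\<not> ?thesis"
    have pos: "h (K_elt u) > 0" if "norm u = 1" for u
    proof -
      have "pairing (\<lambda>x. \<Phi> (K_elt u) x - m x) (\<lambda>x. cnj (g x)) = \<phi> (K_elt u) - pairing m (\<lambda>x. cnj (g x))"
        using ps_space_integrable_mult(2)[OF \<Phi>V[OF that] g] ps_space_integrable_mult(2)[OF m(1) g]
        by (simp add: \<phi>_def pairing_def left_diff_distrib)
      then show ?thesis
        using neg that by (auto simp: h_def not_le)
    qed
    have hpos: "AE k in haar_K. h k > 0"
      using AE_haar_K_SL2
    proof eventually_elim
      case (elim k)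
      then show ?case
        using pos[of "column 1 k"] by simp
    qed
    have "AE k in haar_K. 0 \<le> h k"
      using hpos by eventually_elim simp
    then have "AE k in haar_K. h k = 0"
      using integral_nonneg_eq_0_iff_AE[OF h_int] h0 by simp
    with hpos have "AE k in (haar_K :: ('a^2^2) measure). False"
      by eventually_elim simp
    then show False
      by (simp add: AE_haar_K_not_False)
  qed
qed (use \<Phi>W in auto)

end

section \<open>Gauges and kernels on the projective line\<close>

definition wedge :: "'a::comm_ring_1^2 \<Rightarrow> 'a^2 \<Rightarrow> 'a" where
  "wedge u v = u $ 1 * v $ 2 - u $ 2 * v $ 1"

lemma wedge_SL2: "g \<in> SL2 \<Longrightarrow> wedge (g *v u) (g *v v) = wedge u v"
proof -
  have "wedge (g *v u) (g *v v) = (g $ 1 $ 1 * g $ 2 $ 2 - g $ 1 $ 2 * g $ 2 $ 1) * wedge u v"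
    by (simp add: wedge_def matrix_vector_mult_2 algebra_simps)
  then show "g \<in> SL2 \<Longrightarrow> ?thesis"
    by (simp add: SL2_iff)
qed

text \<open>In the orthonormal frame whose first vector is \<open>u\<close>, the wedge is the second
  coordinate of \<open>v\<close>. Its modulus is therefore the distance of \<open>v\<close> from the
  line of \<open>u\<close>, and it is bounded by the norm.\<close>

lemma K_elt_inv_mult_2:
  fixes u v :: "'a::{real_normed_field, euclidean_space}^2"
  assumes "norm u = 1"
  shows "(matrix_inv (K_elt u) *v v) $ 2 = wedge u v" "norm (matrix_inv (K_elt u) *v v) = norm v"
proof -
  show "(matrix_inv (K_elt u) *v v) $ 2 = wedge u v"
    using assms by (simp add: K_elt_inv matrix_vector_mult_2 wedge_def) (simp add: K_elt_def)
  have "norm v = norm (K_elt u *v (matrix_inv (K_elt u) *v v))"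
    by (simp add: SL2_mult_vec_cancel K_elt_in_SL2 assms)
  then show "norm (matrix_inv (K_elt u) *v v) = norm v"
    by (simp add: norm_K_elt_mult assms)
qed

lemma norm_wedge_le:
  fixes u v :: "'a::{real_normed_field, euclidean_space}^2"
  assumes "norm u = 1"
  shows "norm (wedge u v) \<le> norm v"
  using K_elt_inv_mult_2[OF assms, of v] Finite_Cartesian_Product.norm_nth_le[of "matrix_inv (K_elt u) *v v" 2] by simp

text \<open>In the frame starting with \<open>u\<close>, with coordinates \<open>c\<close> of
  \<open>v\<close>, the radicand is
  \<open>s * (norm (c $ 1))\<^sup>2 + (norm (c $ 2))\<^sup>2\<close>: a norm that is compressed by
  \<open>sqrt s\<close> along the line of \<open>u\<close>.\<close>

definition gauge_q :: "real \<Rightarrow> 'a::{real_normed_field, euclidean_space}^2 \<Rightarrow> 'a^2 \<Rightarrow> real" where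
  "gauge_q s u v = sqrt (s * (norm v)\<^sup>2 + (1 - s) * (norm (wedge u v))\<^sup>2)"

text \<open>The translates of the spherical vector; as \<open>s\<close> tends to 0 they concentrate at the line of \<open>u\<close>.\<close>
definition kern :: "real \<Rightarrow> 'a::{real_normed_field, euclidean_space}^2 \<Rightarrow> 'a^2^2 \<Rightarrow> complex" where
  "kern s u g = (if g \<in> SL2 then of_real (inverse (gauge_q s u (column 1 g) ^ DIM('a))) else 0)"

text \<open>The half-density on the projective line given by a function of the affine coordinate.
  \<open>proj_lift (\<lambda>_. 1)\<close> is the spherical vector. At infinity division by zero
  assigns the value \<open>\<zeta> 0\<close>, on a null set.\<close>

definition proj_lift :: "('a::{real_normed_field, euclidean_space} \<Rightarrow> complex) \<Rightarrow> 'a^2^2 \<Rightarrow> complex" where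
  "proj_lift \<zeta> g = (if g \<in> SL2 then of_real (inverse (norm (column 1 g) ^ DIM('a))) * \<zeta> (g $ 1 $ 1 / g $ 2 $ 1) else 0)"

lemma column_mult_upper_P:
  fixes g p :: "'a::field^2^2"
  assumes "p \<in> upper_P"
  shows "column 1 (g ** p) = levi p *s column 1 g" "levi p \<noteq> 0" "p \<in> SL2"
  using assms by (auto simp: upper_P_def levi_def SL2_iff vec2_eq_iff column_def matrix_matrix_mult_2 mult.commute)

lemma norm_vector_smult: "norm (l *s v) = norm l * norm v"
  for v :: "'a::real_normed_field^2"
proof -
  have "(norm (l *s v))\<^sup>2 = (norm l * norm v)\<^sup>2"
    by (simp add: norm_vec2 norm_mult power_mult_distrib distrib_left)
  then show ?thesis
    by simp
qed

lemma gauge_q_smult: "gauge_q s u (l *s v) = norm l * gauge_q s u v"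
proof -
  have "wedge u (l *s v) = l * wedge u v"
    by (simp add: wedge_def algebra_simps)
  then have "s * (norm (l *s v))\<^sup>2 + (1 - s) * (norm (wedge u (l *s v)))\<^sup>2
      = (norm l)\<^sup>2 * (s * (norm v)\<^sup>2 + (1 - s) * (norm (wedge u v))\<^sup>2)"
    by (simp add: norm_vector_smult norm_mult power_mult_distrib algebra_simps)
  then show ?thesis
    by (simp add: gauge_q_def real_sqrt_mult)
qed

lemma gauge_q_K_elt: "norm w = 1 \<Longrightarrow> gauge_q s (K_elt w *v u) (K_elt w *v v) = gauge_q s u v"
  by (simp add: gauge_q_def wedge_SL2 K_elt_in_SL2 norm_K_elt_mult)

lemma gauge_q_bounds:
  assumes s: "0 < s" "s \<le> 1" and u: "norm u = 1" and v: "norm v = 1"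
  shows "sqrt s \<le> gauge_q s u v" "gauge_q s u v \<le> 1" "gauge_q s u v > 0"
proof -
  show 1: "sqrt s \<le> gauge_q s u v"
    using s by (simp add: gauge_q_def v)
  have "(norm (wedge u v))\<^sup>2 \<le> 1\<^sup>2"
    using norm_wedge_le[OF u, of v] v by (intro power_mono) auto
  then have "(1 - s) * (norm (wedge u v))\<^sup>2 \<le> 1 - s"
    using s by (intro mult_left_le) auto
  then show "gauge_q s u v \<le> 1"
    by (simp add: gauge_q_def v)
  show "gauge_q s u v > 0"
    using 1 s by (meson less_le_trans real_sqrt_gt_zero)
qed

lemma borel_measurable_wedge [measurable (raw)]:
  fixes f g :: "'b \<Rightarrow> 'a::{real_normed_field, euclidean_space}^2"
  assumes "f \<in> borel_measurable M" "g \<in> borel_measurable M"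
  shows "(\<lambda>x. wedge (f x) (g x)) \<in> borel_measurable M"
  unfolding wedge_def using assms by measurable

lemma borel_measurable_gauge_q [measurable (raw)]:
  fixes f g :: "'b \<Rightarrow> 'a::{real_normed_field, euclidean_space}^2"
  assumes [measurable]: "f \<in> borel_measurable M" "g \<in> borel_measurable M"
  shows "(\<lambda>x. gauge_q s (f x) (g x)) \<in> borel_measurable M"
  unfolding gauge_q_def by measurable

lemma borel_measurable_kern [measurable (raw)]:
  fixes f :: "'b \<Rightarrow> 'a::{real_normed_field, euclidean_space}^2" and g :: "'b \<Rightarrow> 'a^2^2"
  assumes [measurable]: "f \<in> borel_measurable M" "g \<in> borel_measurable M"
  shows "(\<lambda>x. kern s (f x) (g x)) \<in> borel_measurable M"
  unfolding kern_def by measurable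

lemma borel_measurable_proj_lift [measurable]:
  fixes \<zeta> :: "'a::{real_normed_field, euclidean_space} \<Rightarrow> complex"
  assumes [measurable]: "\<zeta> \<in> borel_measurable borel"
  shows "proj_lift \<zeta> \<in> borel_measurable borel"
  unfolding proj_lift_def[abs_def] by measurable

lemma diag_L_in_SL2: "l \<noteq> 0 \<Longrightarrow> diag_L l \<in> SL2"
  by (simp add: diag_L_def mat2_in_SL2)

lemma kern_eq_left_translate:
  fixes u :: "'a::{real_normed_field, euclidean_space}^2"
  assumes u: "norm u = 1" and r: "r > 0"
  shows "kern (inverse (r ^ 4)) u =
    (\<lambda>g. of_real (r ^ DIM('a)) * left_translate (K_elt u ** diag_L (of_real r)) (proj_lift (\<lambda>_. 1)) g)"
proof
  fix g :: "'a^2^2"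
  let ?k = "K_elt u" and ?a = "diag_L (of_real r) :: 'a^2^2"
  define s where "s = inverse (r ^ 4)"
  have a: "?a \<in> SL2"
    using r by (simp add: diag_L_in_SL2)
  have k: "?k \<in> SL2"
    by (rule K_elt_in_SL2[OF u])
  have inv: "matrix_inv (?k ** ?a) = matrix_inv ?a ** matrix_inv ?k"
    by (rule SL2_inv_mult[OF k a])
  have h: "?k ** ?a \<in> SL2"
    by (rule SL2_mult[OF k a])
  show "kern (inverse (r ^ 4)) u g = of_real (r ^ DIM('a)) * left_translate (?k ** ?a) (proj_lift (\<lambda>_. 1)) g"
  proof (cases "g \<in> SL2")
    case True
    define v where "v = column 1 g"
    define c where "c = matrix_inv ?k *v v"
    have c: "c $ 2 = wedge u v" "norm c = norm v"
      unfolding c_def by (rule K_elt_inv_mult_2[OF u])+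
    have sum: "(norm (c $ 1))\<^sup>2 = (norm v)\<^sup>2 - (norm (wedge u v))\<^sup>2"
      using norm_vec2[of c] c by simp
    have inva: "matrix_inv ?a = mat2 (of_real (inverse r)) 0 0 (of_real r)"
      unfolding SL2_inv_eq[OF a] by (simp add: vec2_eq_iff diag_L_def)
    \<comment> \<open>Here the fourth power arises: the inverse diagonal matrix scales the two
      coordinates by \<open>1/r\<close> and \<open>r\<close>, and extracting the factor
      \<open>r\<^sup>2\<close> leaves the squared first coordinate with weight
      \<open>1/r^4\<close>.\<close>
    have "(norm (matrix_inv ?a *v c))\<^sup>2 = (inverse r * norm (c $ 1))\<^sup>2 + (r * norm (c $ 2))\<^sup>2"
      unfolding inva using r by (simp add: norm_vec2 matrix_vector_mult_2 norm_mult norm_inverse)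
    also have "\<dots> = r\<^sup>2 * (s * (norm v)\<^sup>2 + (1 - s) * (norm (wedge u v))\<^sup>2)"
      unfolding power_mult_distrib sum c s_def using r by (simp add: field_simps power2_eq_square power4_eq_xxxx)
    finally have "sqrt ((norm (matrix_inv ?a *v c))\<^sup>2) = sqrt (r\<^sup>2 * (s * (norm v)\<^sup>2 + (1 - s) * (norm (wedge u v))\<^sup>2))"
      by simp
    then have "norm (matrix_inv ?a *v c) = r * gauge_q s u v"
      using r by (simp add: gauge_q_def real_sqrt_mult)
    moreover have "column 1 (matrix_inv (?k ** ?a) ** g) = matrix_inv ?a *v c"
      unfolding inv column_mult c_def v_def by (simp add: matrix_vector_mul_assoc)
    moreover have "matrix_inv (?k ** ?a) ** g \<in> SL2"
      by (intro SL2_mult SL2_inv h True)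
    ultimately show ?thesis
      using True r by (simp add: kern_def left_translate_def proj_lift_def v_def[symmetric] s_def[symmetric] power_mult_distrib)
  next
    case False
    then have "matrix_inv (?k ** ?a) ** g \<notin> SL2"
      using SL2_mult[OF h, of "matrix_inv (?k ** ?a) ** g"] by (auto simp: SL2_mult_cancel h)
    with False show ?thesis
      by (simp add: kern_def left_translate_def proj_lift_def)
  qed
qed

text \<open>The integral is taken over the centre of the kernel. The vector \<open>[1, 0]\<close> is
  only a reference point: \<open>K\<close> is transitive on unit vectors and preserves the gauge, so
  \<open>kern_mass_eq\<close> gives the same mass for any other one. The type argument records the
  field.\<close>

definition kern_mass :: "'a::{real_normed_field, euclidean_space} itself \<Rightarrow> real \<Rightarrow> real" where
  "kern_mass _ s = (\<integral>k. inverse (gauge_q s (column 1 k :: 'a^2) (vector [1, 0]) ^ DIM('a)) \<partial>haar_K)"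

lemma integrable_kern:
  fixes v :: "'a::{real_normed_field, euclidean_space}^2"
  assumes s: "0 < s" "s \<le> 1" and v: "norm v = 1"
  shows "integrable haar_K (\<lambda>k. inverse (gauge_q s (column 1 k) v ^ DIM('a)))"
proof (rule haar_K.integrable_const_bound)
  show "AE k in haar_K. norm (inverse (gauge_q s (column 1 k) v ^ DIM('a))) \<le> inverse (sqrt s ^ DIM('a))"
    using AE_haar_K_SL2
  proof eventually_elim
    case (elim k)
    have "sqrt s ^ DIM('a) \<le> gauge_q s (column 1 k) v ^ DIM('a)"
      using gauge_q_bounds(1)[OF s _ v] elim s by (intro power_mono) auto
    then have "inverse (gauge_q s (column 1 k) v ^ DIM('a)) \<le> inverse (sqrt s ^ DIM('a))"
      using s by (intro le_imp_inverse_le) auto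
    then show ?case
      using gauge_q_bounds(3)[OF s _ v, of "column 1 k"] elim by simp
  qed
qed simp

lemma kern_mass_eq:
  fixes v :: "'a::{real_normed_field, euclidean_space}^2"
  assumes v: "norm v = 1"
  shows "(\<integral>k. inverse (gauge_q s (column 1 k) v ^ DIM('a)) \<partial>haar_K) = kern_mass TYPE('a) s"
proof -
  have e: "K_elt v *v vector [1, 0] = v"
    by (simp add: vec2_eq_iff matrix_vector_mult_2 K_elt_def)
  have "(\<integral>k. inverse (gauge_q s (column 1 k) v ^ DIM('a)) \<partial>haar_K)
     = (\<integral>k. inverse (gauge_q s (column 1 (K_elt v ** k)) (K_elt v *v vector [1, 0]) ^ DIM('a)) \<partial>haar_K)"
    unfolding e by (rule integral_haar_K_left(1)[OF _ v, symmetric]) simp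
  then show ?thesis
    by (simp add: column_mult gauge_q_K_elt v kern_mass_def)
qed

lemma norm_vector_1_0 [simp]: "norm (vector [1, 0] :: 'a::real_normed_field^2) = 1"
proof -
  have "(norm (vector [1, 0] :: 'a^2))\<^sup>2 = 1\<^sup>2"
    unfolding norm_vec2 by simp
  then show ?thesis
    by (rule power2_eq_imp_eq) simp_all
qed

lemma kern_mass_ge_1:
  assumes s: "0 < s" "s \<le> 1"
  shows "kern_mass TYPE('a::{real_normed_field, euclidean_space}) s \<ge> 1"
proof -
  have "(\<integral>k. 1 \<partial>(haar_K :: ('a^2^2) measure)) \<le> kern_mass TYPE('a) s"
    unfolding kern_mass_def
  proof (rule integral_mono_AE)
    show "AE k in haar_K. 1 \<le> inverse (gauge_q s (column 1 k :: 'a^2) (vector [1, 0]) ^ DIM('a))"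
      using AE_haar_K_SL2
    proof eventually_elim
      case (elim k)
      then have "gauge_q s (column 1 k) (vector [1, 0]) ^ DIM('a) \<le> 1" "gauge_q s (column 1 k) (vector [1, 0]) > 0"
        using gauge_q_bounds[OF s, of "column 1 k" "vector [1, 0]"] by (auto intro!: power_le_one)
      then show ?case
        by (simp add: one_le_inverse)
    qed
  qed (use integrable_kern[OF s norm_vector_1_0] in auto)
  then show ?thesis
    by simp
qed

text \<open>Fourth powers make \<open>kern (eps_seq n)\<close> a multiple of a translate by a
  diagonal matrix with entry \<open>Suc n\<close>; the successor avoids inverting zero.\<close>

definition eps_seq :: "nat \<Rightarrow> real" where
  "eps_seq n = inverse (real (Suc n) ^ 4)"

lemma eps_seq: "0 < eps_seq n" "eps_seq n \<le> 1" "eps_seq \<longlonglongrightarrow> 0"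
proof -
  show "0 < eps_seq n" "eps_seq n \<le> 1"
    by (simp_all add: eps_seq_def inverse_le_1_iff)
  have "(\<lambda>n. inverse (real (Suc n)) ^ 4) \<longlonglongrightarrow> 0 ^ 4"
    by (intro tendsto_intros LIMSEQ_inverse_real_of_nat)
  then show "eps_seq \<longlonglongrightarrow> 0"
    by (simp add: eps_seq_def[abs_def] power_inverse)
qed

text \<open>Fatou's lemma: the kernels converge almost everywhere to the inverse power of
  \<open>norm (k $ 2 $ 1)\<close>, whose integral is infinite.\<close>

lemma kern_mass_at_top:
  "filterlim (\<lambda>n. kern_mass TYPE('a::{real_normed_field, euclidean_space}) (eps_seq n)) at_top sequentially"
proof -
  let ?e = "vector [1, 0] :: 'a^2"
  let ?f = "\<lambda>n (k :: 'a^2^2). ennreal (inverse (gauge_q (eps_seq n) (column 1 k) ?e ^ DIM('a)))"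
  have "(\<integral>\<^sup>+k. ennreal (inverse (norm (k $ 2 $ 1 :: 'a) ^ DIM('a))) \<partial>haar_K) = (\<integral>\<^sup>+k. liminf (\<lambda>n. ?f n k) \<partial>haar_K)"
  proof (rule nn_integral_cong_AE, use AE_haar_K_nonzero in eventually_elim)
    case (elim k)
    have w: "wedge (column 1 k) ?e = - k $ 2 $ 1"
      by (simp add: wedge_def column_def)
    have "(\<lambda>n. gauge_q (eps_seq n) (column 1 k) ?e) \<longlonglongrightarrow> sqrt (0 * (norm ?e)\<^sup>2 + (1 - 0) * (norm (wedge (column 1 k) ?e))\<^sup>2)"
      unfolding gauge_q_def by (intro tendsto_intros eps_seq(3))
    then have "(\<lambda>n. gauge_q (eps_seq n) (column 1 k) ?e) \<longlonglongrightarrow> norm (k $ 2 $ 1)"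
      by (simp add: w)
    then have "(\<lambda>n. ?f n k) \<longlonglongrightarrow> ennreal (inverse (norm (k $ 2 $ 1) ^ DIM('a)))"
      using elim by (intro tendsto_intros) auto
    then show ?case
      by (intro lim_imp_Liminf[symmetric]) auto
  qed
  also have "\<dots> \<le> liminf (\<lambda>n. \<integral>\<^sup>+k. ?f n k \<partial>haar_K)"
    by (rule nn_integral_liminf) simp
  also have "(\<lambda>n. \<integral>\<^sup>+k. ?f n k \<partial>haar_K) = (\<lambda>n. ennreal (kern_mass TYPE('a) (eps_seq n)))"
  proof
    fix n
    show "(\<integral>\<^sup>+k. ?f n k \<partial>haar_K) = ennreal (kern_mass TYPE('a) (eps_seq n))"
      unfolding kern_mass_def
    proof (rule nn_integral_eq_integral)
      show "AE k in haar_K. 0 \<le> inverse (gauge_q (eps_seq n) (column 1 k) ?e ^ DIM('a))"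
        using AE_haar_K_SL2
        by eventually_elim (use gauge_q_bounds(3)[OF eps_seq(1,2), of _ ?e n] in \<open>auto simp: less_imp_le\<close>)
    qed (rule integrable_kern[OF eps_seq(1,2)], simp)
  qed
  finally have "liminf (\<lambda>n. ennreal (kern_mass TYPE('a) (eps_seq n))) = \<infinity>"
    by (simp add: nn_integral_haar_K_infinite top_unique)
  then have ev: "\<forall>\<^sub>F n in sequentially. ennreal Z < ennreal (kern_mass TYPE('a) (eps_seq n))" for Z
    by (intro less_LiminfD) simp
  have "Z \<le> m" if "ennreal Z < ennreal m" for Z m
    using that by (meson ennreal_leI leD le_cases)
  then have "\<forall>\<^sub>F n in sequentially. Z \<le> kern_mass TYPE('a) (eps_seq n)" for Z
    by (rule eventually_mono[OF ev])
  then show ?thesis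
    unfolding filterlim_at_top by blast
qed

subsection \<open>Irreducibility of the spherical principal series\<close>

locale spherical =
  fixes \<eta> :: "'a::{real_normed_field, euclidean_space} \<Rightarrow> complex"
  assumes \<eta>_one: "\<And>l. l \<noteq> 0 \<Longrightarrow> \<eta> l = 1"

sublocale spherical \<subseteq> ps_char
  by unfold_locales (simp add: \<eta>_one)

context spherical
begin

lemma ps_spaceI:
  assumes "f \<in> borel_measurable borel" "\<And>g. g \<notin> SL2 \<Longrightarrow> f g = 0"
    and "\<And>g p. g \<in> SL2 \<Longrightarrow> p \<in> upper_P \<Longrightarrow> f (g ** p) = of_real (inverse (norm (levi p) ^ DIM('a))) * f g"
    and "integrable haar_K (\<lambda>k. (norm (f k))\<^sup>2)"
  shows "f \<in> ps_space \<eta>"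
  using assms by (auto simp: ps_space_def \<eta>_one column_mult_upper_P)

lemma ps_spaceI_bounded:
  assumes m: "f \<in> borel_measurable borel" and "\<And>g. g \<notin> SL2 \<Longrightarrow> f g = 0"
    and "\<And>g p. g \<in> SL2 \<Longrightarrow> p \<in> upper_P \<Longrightarrow> f (g ** p) = of_real (inverse (norm (levi p) ^ DIM('a))) * f g"
    and B: "\<And>u. norm u = 1 \<Longrightarrow> norm (f (K_elt u)) \<le> B"
  shows "f \<in> ps_space \<eta>" and "ps_norm f \<le> B"
proof -
  have bound: "AE k in haar_K. (norm (f k))\<^sup>2 \<le> B\<^sup>2"
    using AE_haar_K_SL2
  proof eventually_elim
    case (elim k)
    then show ?case
      using B[of "column 1 k"] by (auto intro!: power_mono)
  qed
  then have int: "integrable haar_K (\<lambda>k. (norm (f k))\<^sup>2)"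
    by (intro haar_K.integrable_const_bound[where B = "B\<^sup>2"]) (use m in auto)
  show "f \<in> ps_space \<eta>"
    by (rule ps_spaceI) (use assms int in auto)
  have "0 \<le> norm (f (K_elt (vector [1, 0])))"
    by simp
  also have "\<dots> \<le> B"
    by (rule B) simp
  finally have "0 \<le> B" .
  have "(\<integral>k. (norm (f k))\<^sup>2 \<partial>haar_K) \<le> (\<integral>k. B\<^sup>2 \<partial>(haar_K :: ('a^2^2) measure))"
    by (rule integral_mono_AE) (use int bound in auto)
  then have "(ps_norm f)\<^sup>2 \<le> B\<^sup>2"
    by (simp add: ps_norm_square)
  then show "ps_norm f \<le> B"
    using \<open>0 \<le> B\<close> by (rule power2_le_imp_le)
qed

lemma proj_lift_K_elt: "norm u = 1 \<Longrightarrow> proj_lift \<zeta> (K_elt u) = \<zeta> (u $ 1 / u $ 2)"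
  for u :: "'a^2"
  by (simp add: proj_lift_def K_elt_in_SL2) (simp add: K_elt_def)

lemma proj_lift_translate:
  fixes g p :: "'a^2^2"
  assumes "g \<in> SL2" "p \<in> upper_P"
  shows "proj_lift \<zeta> (g ** p) = of_real (inverse (norm (levi p) ^ DIM('a))) * proj_lift \<zeta> g"
proof -
  have c: "column 1 (g ** p) = levi p *s column 1 g" and l: "levi p \<noteq> 0" and p: "p \<in> SL2"
    using column_mult_upper_P[OF assms(2)] by auto
  have "(g ** p) $ i $ 1 = levi p * g $ i $ 1" for i
    using arg_cong[OF c, of "\<lambda>v. v $ i"] by (simp add: column_def)
  then show ?thesis
    using assms(1) l SL2_mult[OF assms(1) p]
    by (simp add: proj_lift_def c norm_vector_smult power_mult_distrib)
qed

lemma proj_lift_in_ps_space: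
  assumes "\<zeta> \<in> borel_measurable borel" "integrable haar_K (\<lambda>k. (norm (proj_lift \<zeta> k))\<^sup>2)"
  shows "proj_lift \<zeta> \<in> ps_space \<eta>"
  by (rule ps_spaceI[OF _ _ proj_lift_translate]) (use assms in \<open>auto simp: proj_lift_def\<close>)

lemma proj_lift_bounded_in_ps_space:
  assumes "\<zeta> \<in> borel_measurable borel" "\<And>z. norm (\<zeta> z) \<le> B"
  shows "proj_lift \<zeta> \<in> ps_space \<eta>"
  by (rule ps_spaceI_bounded(1)[where B = B, OF _ _ proj_lift_translate])
    (use assms in \<open>auto simp: proj_lift_def K_elt_in_SL2\<close>)

text \<open>A superposition of translates of the spherical vector with weights
  \<open>\<zeta>\<close>, hence a member of every closed subspace containing those translates.
  Divided by \<open>kern_mass\<close> it approximates \<open>proj_lift \<zeta>\<close>.\<close>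

definition avg :: "real \<Rightarrow> ('a \<Rightarrow> complex) \<Rightarrow> 'a^2^2 \<Rightarrow> complex" where
  "avg s \<zeta> g = (\<integral>k. \<zeta> (k $ 1 $ 1 / k $ 2 $ 1) * kern s (column 1 k) g \<partial>haar_K)"

lemma kern_translate:
  fixes g p :: "'a^2^2"
  assumes "g \<in> SL2" "p \<in> upper_P"
  shows "kern s u (g ** p) = of_real (inverse (norm (levi p) ^ DIM('a))) * kern s u g"
  using assms(1) column_mult_upper_P(1)[OF assms(2), of g] column_mult_upper_P(2)[OF assms(2)]
    SL2_mult[OF assms(1) column_mult_upper_P(3)[OF assms(2)]]
  by (simp add: kern_def gauge_q_smult power_mult_distrib)

lemma norm_kern_K_elt:
  fixes u v :: "'a^2"
  assumes "0 < s" "s \<le> 1" "norm u = 1" "norm v = 1"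
  shows "norm (kern s u (K_elt v)) = inverse (gauge_q s u v ^ DIM('a))"
    and "kern s u (K_elt v) = of_real (inverse (gauge_q s u v ^ DIM('a)))"
    and "norm (kern s u (K_elt v)) \<le> inverse (sqrt s ^ DIM('a))"
proof -
  note q = gauge_q_bounds[OF assms]
  show 1: "norm (kern s u (K_elt v)) = inverse (gauge_q s u v ^ DIM('a))"
    using q by (simp add: kern_def K_elt_in_SL2 assms norm_inverse norm_power)
  show "kern s u (K_elt v) = of_real (inverse (gauge_q s u v ^ DIM('a)))"
    by (simp add: kern_def K_elt_in_SL2 assms)
  show "norm (kern s u (K_elt v)) \<le> inverse (sqrt s ^ DIM('a))"
    unfolding 1 using q(1) assms(1) by (intro le_imp_inverse_le power_mono) auto
qed

lemma avg_bound:
  assumes s: "0 < s" "s \<le> 1" and [measurable]: "\<zeta> \<in> borel_measurable borel"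
    and B: "\<And>z. norm (\<zeta> z) \<le> B" and v: "norm v = 1"
  shows "norm (avg s \<zeta> (K_elt v)) \<le> B * kern_mass TYPE('a) s"
    and "integrable haar_K (\<lambda>k. \<zeta> (k $ 1 $ 1 / k $ 2 $ 1) * kern s (column 1 k) (K_elt v))"
proof -
  have le: "AE k in haar_K. norm (\<zeta> (k $ 1 $ 1 / k $ 2 $ 1) * kern s (column 1 k) (K_elt v)) \<le>
      B * inverse (gauge_q s (column 1 k) v ^ DIM('a))"
    using AE_haar_K_SL2
  proof eventually_elim
    case (elim k)
    then show ?case
      using norm_kern_K_elt(1)[OF s _ v, of "column 1 k"] gauge_q_bounds(3)[OF s _ v, of "column 1 k"]
      by (auto simp: norm_mult intro!: mult_right_mono B)
  qed
  have int: "integrable haar_K (\<lambda>k. B * inverse (gauge_q s (column 1 k) v ^ DIM('a)))"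
    using integrable_kern[OF s v] by simp
  have "B \<ge> 0"
    using B[of 0] norm_ge_zero[of "\<zeta> 0"] by linarith
  show 1: "integrable haar_K (\<lambda>k. \<zeta> (k $ 1 $ 1 / k $ 2 $ 1) * kern s (column 1 k) (K_elt v))"
    by (rule Bochner_Integration.integrable_bound[OF int]) (use le in \<open>auto elim!: eventually_mono intro: order_trans\<close>)
  have "norm (avg s \<zeta> (K_elt v)) \<le> (\<integral>k. norm (\<zeta> (k $ 1 $ 1 / k $ 2 $ 1) * kern s (column 1 k) (K_elt v)) \<partial>haar_K)"
    unfolding avg_def by (rule integral_norm_bound)
  also have "\<dots> \<le> (\<integral>k. B * inverse (gauge_q s (column 1 k) v ^ DIM('a)) \<partial>haar_K)"
    by (rule integral_mono_AE[OF integrable_norm[OF 1] int le])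
  also have "\<dots> = B * kern_mass TYPE('a) s"
    by (simp add: kern_mass_eq[OF v])
  finally show "norm (avg s \<zeta> (K_elt v)) \<le> B * kern_mass TYPE('a) s" .
qed

lemma avg_measurable:
  assumes [measurable]: "\<zeta> \<in> borel_measurable borel"
  shows "avg s \<zeta> \<in> borel_measurable borel"
proof -
  have "(\<lambda>p :: ('a^2^2) \<times> ('a^2^2). \<zeta> (snd p $ 1 $ 1 / snd p $ 2 $ 1) * kern s (column 1 (snd p)) (fst p)) \<in> borel_measurable (borel \<Otimes>\<^sub>M borel)"
    by measurable
  also have "borel_measurable (borel \<Otimes>\<^sub>M borel) = borel_measurable (borel \<Otimes>\<^sub>M (haar_K :: ('a^2^2) measure))"
    by (intro measurable_cong_sets sets_pair_measure_cong) simp_all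
  finally show ?thesis
    unfolding avg_def[abs_def] by (intro haar_K.borel_measurable_lebesgue_integral) (simp add: case_prod_beta)
qed

lemma avg_in_ps_space:
  assumes s: "0 < s" "s \<le> 1" and [measurable]: "\<zeta> \<in> borel_measurable borel" and B: "\<And>z. norm (\<zeta> z) \<le> B"
  shows "avg s \<zeta> \<in> ps_space \<eta>"
proof (rule ps_spaceI_bounded(1))
  show "avg s \<zeta> \<in> borel_measurable borel"
    by (rule avg_measurable) simp
  show "avg s \<zeta> g = 0" if "g \<notin> SL2" for g
    using that by (simp add: avg_def kern_def)
  show "avg s \<zeta> (g ** p) = of_real (inverse (norm (levi p) ^ DIM('a))) * avg s \<zeta> g"
    if "g \<in> SL2" "p \<in> upper_P" for g p
  proof -
    have "avg s \<zeta> (g ** p) = (\<integral>k. of_real (inverse (norm (levi p) ^ DIM('a))) * (\<zeta> (k $ 1 $ 1 / k $ 2 $ 1) * kern s (column 1 k) g) \<partial>haar_K)"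
      unfolding avg_def kern_translate[OF that] by (simp only: mult.left_commute)
    then show ?thesis
      by (simp add: avg_def del: of_real_inverse of_real_power)
  qed
  show "norm (avg s \<zeta> (K_elt v)) \<le> B * kern_mass TYPE('a) s" if "norm v = 1" for v
    by (rule avg_bound(1)[OF s _ B that]) simp
qed

lemma avg_in_closed_subspace:
  assumes W: "closed_subspace W" and f0: "\<And>h. h \<in> SL2 \<Longrightarrow> left_translate h (proj_lift (\<lambda>_. 1)) \<in> W"
    and [measurable]: "\<zeta> \<in> borel_measurable borel" and B: "\<And>z. norm (\<zeta> z) \<le> B"
  shows "avg (eps_seq n) \<zeta> \<in> W"
proof -
  let ?s = "eps_seq n"
  note s = eps_seq(1,2)[of n]
  have scale: "\<And>c f. f \<in> W \<Longrightarrow> (\<lambda>x. c * f x) \<in> W"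
    using W unfolding closed_subspace_def by blast
  have kW: "kern ?s u \<in> W" if "norm u = 1" for u
  proof -
    have "diag_L (of_real (real (Suc n)) :: 'a) \<in> SL2"
      by (rule diag_L_in_SL2) (simp del: of_nat_Suc)
    from SL2_mult[OF K_elt_in_SL2[OF that] this]
    show ?thesis
      unfolding eps_seq_def by (subst kern_eq_left_translate[OF that]) (auto intro!: scale f0)
  qed
  have cW: "(\<lambda>g. \<zeta> (K_elt u $ 1 $ 1 / K_elt u $ 2 $ 1) * kern ?s (column 1 (K_elt u)) g) \<in> W" if "norm u = 1" for u
    using scale[OF kW[OF that]] by simp
  show ?thesis
  proof (rule closed_subspace_integral[OF W, where \<Phi> = "\<lambda>k g. \<zeta> (k $ 1 $ 1 / k $ 2 $ 1) * kern ?s (column 1 k) g"])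
    show "(\<lambda>p :: ('a^2^2) \<times> ('a^2^2). \<zeta> (fst p $ 1 $ 1 / fst p $ 2 $ 1) * kern ?s (column 1 (fst p)) (snd p)) \<in> borel_measurable (borel \<Otimes>\<^sub>M borel)"
      by measurable
    show "avg ?s \<zeta> \<in> ps_space \<eta>"
      by (rule avg_in_ps_space[OF s _ B]) simp
    show "AE x in haar_K. avg ?s \<zeta> x = (\<integral>k. \<zeta> (k $ 1 $ 1 / k $ 2 $ 1) * kern ?s (column 1 k) x \<partial>haar_K)"
      by (simp add: avg_def)
    show "ps_norm (\<lambda>g. \<zeta> (K_elt u $ 1 $ 1 / K_elt u $ 2 $ 1) * kern ?s (column 1 (K_elt u)) g) \<le> B * inverse (sqrt ?s ^ DIM('a))"
      if u: "norm u = 1" for u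
    proof (rule ps_spaceI_bounded(2))
      show "norm (\<zeta> (K_elt u $ 1 $ 1 / K_elt u $ 2 $ 1) * kern ?s (column 1 (K_elt u)) (K_elt v)) \<le> B * inverse (sqrt ?s ^ DIM('a))"
        if "norm v = 1" for v
        using norm_kern_K_elt(3)[OF s u that] B unfolding norm_mult column_K_elt by (intro mult_mono) (auto intro: order_trans[OF norm_ge_zero])
    qed (simp_all add: kern_translate, simp add: kern_def)
  qed (rule cW)
qed

text \<open>Near the line of \<open>v\<close> the oscillation of \<open>\<zeta>\<close> is small and
  the kernel contributes at most its full mass. Elsewhere the kernel is bounded uniformly in
  \<open>s\<close>, so its contribution disappears after division by the diverging mass.\<close>

lemma avg_tendsto:
  assumes cont: "continuous_on UNIV \<zeta>" and B: "\<And>z. norm (\<zeta> z) \<le> B"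
    and v: "norm v = 1" "v $ 2 \<noteq> 0"
  shows "(\<lambda>n. inverse (of_real (kern_mass TYPE('a) (eps_seq n))) * avg (eps_seq n) \<zeta> (K_elt v)) \<longlonglongrightarrow> \<zeta> (v $ 1 / v $ 2)"
proof (rule tendstoI)
  have [measurable]: "\<zeta> \<in> borel_measurable borel"
    using cont by (rule borel_measurable_continuous_onI)
  define z where "z = v $ 1 / v $ 2"
  fix e :: real assume e: "e > 0"
  have "isCont \<zeta> z"
    using cont by (simp add: continuous_on_eq_continuous_at)
  then obtain r where r: "r > 0" "\<And>z'. dist z' z < r \<Longrightarrow> dist (\<zeta> z') (\<zeta> z) < e / 2"
    using e unfolding continuous_at_eps_delta by (meson half_gt_zero)
  let ?b = "norm (v $ 2)"
  have b: "?b > 0"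
    using v by simp
  \<comment> \<open>The first bound keeps \<open>u\<close> away from infinity, forcing
    \<open>norm (u $ 2)\<close> to be at least \<open>?b / 4\<close>. Given this, the second makes
    the affine coordinates differ by less than \<open>r / 2\<close>.\<close>
  define \<delta> where "\<delta> = min (?b / 2) (r * ?b\<^sup>2 / 8)"
  have \<delta>: "\<delta> > 0" "\<delta> \<le> ?b / 2" "\<delta> \<le> r * ?b\<^sup>2 / 8"
    using b r by (auto simp: \<delta>_def)
  have near: "norm (\<zeta> (u $ 1 / u $ 2) - \<zeta> z) < e / 2" if u: "norm u = 1" and w: "norm (wedge u v) < \<delta>" for u
  proof -
    have "1 \<le> norm (u $ 1) + norm (u $ 2)"
    proof -
      have "(norm (u $ 1) + norm (u $ 2))\<^sup>2 \<ge> 1\<^sup>2"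
        using norm_vec2[of u] u by (simp add: power2_sum)
      then show ?thesis
        by (rule power2_le_imp_le) simp
    qed
    have v1: "norm (v $ 1) \<le> 1" "?b \<le> 1"
      using Finite_Cartesian_Product.norm_nth_le[of v] v by auto
    have "u $ 1 * v $ 2 = wedge u v + u $ 2 * v $ 1"
      by (simp add: wedge_def)
    then have "norm (u $ 1) * ?b \<le> norm (wedge u v) + norm (u $ 2) * norm (v $ 1)"
      by (metis norm_mult norm_triangle_ineq)
    also have "\<dots> \<le> ?b / 2 + norm (u $ 2)"
      using w \<delta>(2) mult_left_le[OF v1(1), of "norm (u $ 2)"] by auto
    finally have "norm (u $ 1) * ?b \<le> ?b / 2 + norm (u $ 2)" .
    moreover have "?b \<le> (norm (u $ 1) + norm (u $ 2)) * ?b"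
      using \<open>1 \<le> norm (u $ 1) + norm (u $ 2)\<close> b by simp
    moreover have "norm (u $ 2) * ?b \<le> norm (u $ 2)"
      using v1 by (simp add: mult_left_le)
    ultimately have u2: "?b / 4 \<le> norm (u $ 2)"
      by (simp add: distrib_right)
    then have nz: "u $ 2 \<noteq> 0"
      using b by auto
    have "u $ 1 / u $ 2 - z = wedge u v / (u $ 2 * v $ 2)"
      using nz v by (simp add: z_def wedge_def field_simps)
    then have "norm (u $ 1 / u $ 2 - z) = norm (wedge u v) / (norm (u $ 2) * ?b)"
      by (simp add: norm_divide norm_mult)
    also have "\<dots> \<le> norm (wedge u v) / (?b / 4 * ?b)"
      using u2 b nz by (intro divide_left_mono mult_right_mono mult_pos_pos) auto
    also have "\<dots> < \<delta> / (?b / 4 * ?b)"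
      using w b by (intro divide_strict_right_mono) auto
    also have "\<dots> \<le> (r * ?b\<^sup>2 / 8) / (?b / 4 * ?b)"
      using \<delta>(3) b by (intro divide_right_mono) auto
    also have "\<dots> = r / 2"
      using b by (simp add: power2_eq_square)
    also have "\<dots> < r"
      using r by simp
    finally show ?thesis
      using r(2)[of "u $ 1 / u $ 2"] by (simp add: dist_norm)
  qed
  \<comment> \<open>For \<open>s\<close> at most 1/2 the coefficient \<open>1 - s\<close> is at
    least 1/2. Outside the \<open>\<delta>\<close>-neighbourhood the squared gauge is then at least
    \<open>\<delta>\<^sup>2 / 2\<close>, whatever \<open>s\<close> is.\<close>
  define c where "c = inverse (sqrt (\<delta>\<^sup>2 / 2) ^ DIM('a))"
  have c: "c \<ge> 0"
    by (simp add: c_def)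
  have B0: "B \<ge> 0"
    using B[of 0] norm_ge_zero[of "\<zeta> 0"] by linarith
  have est: "dist (inverse (of_real (kern_mass TYPE('a) s)) * avg s \<zeta> (K_elt v)) (\<zeta> z)
      \<le> e / 2 + 2 * B * c / kern_mass TYPE('a) s" if s: "0 < s" "s \<le> 1 / 2" for s
  proof -
    let ?N = "kern_mass TYPE('a) s"
    have s1: "s \<le> 1"
      using s by simp
    have N: "?N > 0"
      using kern_mass_ge_1[OF s(1) s1, where 'a = 'a] by simp
    let ?Q = "\<lambda>k :: 'a^2^2. inverse (gauge_q s (column 1 k) v ^ DIM('a))"
    have Qint: "integrable haar_K ?Q"
      by (rule integrable_kern[OF s(1) s1 v(1)])
    have pt: "norm (\<zeta> (u $ 1 / u $ 2) * kern s u (K_elt v) - \<zeta> z * of_real (inverse (gauge_q s u v ^ DIM('a))))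
        \<le> e / 2 * inverse (gauge_q s u v ^ DIM('a)) + 2 * B * c" if u: "norm u = 1" for u
    proof -
      note q = gauge_q_bounds[OF s(1) s1 u v(1)]
      let ?q = "inverse (gauge_q s u v ^ DIM('a))"
      have q0: "?q \<ge> 0"
        using q by simp
      have "\<zeta> (u $ 1 / u $ 2) * kern s u (K_elt v) - \<zeta> z * of_real ?q = (\<zeta> (u $ 1 / u $ 2) - \<zeta> z) * of_real ?q"
        unfolding norm_kern_K_elt(2)[OF s(1) s1 u v(1)] by (simp add: left_diff_distrib)
      then have "norm (\<zeta> (u $ 1 / u $ 2) * kern s u (K_elt v) - \<zeta> z * of_real ?q) = norm (\<zeta> (u $ 1 / u $ 2) - \<zeta> z) * ?q"
        using q0 by (simp only: norm_mult norm_of_real abs_of_nonneg)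
      also have "\<dots> \<le> e / 2 * ?q + 2 * B * c"
      proof (cases "norm (wedge u v) < \<delta>")
        case True
        then have "norm (\<zeta> (u $ 1 / u $ 2) - \<zeta> z) * ?q \<le> e / 2 * ?q"
          using near[OF u] q0 by (intro mult_right_mono) auto
        then show ?thesis
          using B0 c by (simp add: add_increasing2)
      next
        case False
        then have "\<delta>\<^sup>2 \<le> (norm (wedge u v))\<^sup>2"
          using \<delta>(1) by (intro power_mono) auto
        moreover have "(1/2) * (norm (wedge u v))\<^sup>2 \<le> (1 - s) * (norm (wedge u v))\<^sup>2"
          using s by (intro mult_right_mono) auto
        ultimately have "\<delta>\<^sup>2 / 2 \<le> s * (norm v)\<^sup>2 + (1 - s) * (norm (wedge u v))\<^sup>2"
          using s by (simp add: v add_increasing)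
        then have "sqrt (\<delta>\<^sup>2 / 2) \<le> gauge_q s u v"
          unfolding gauge_q_def by (rule real_sqrt_le_mono)
        then have "?q \<le> c"
          unfolding c_def using \<delta>(1) by (intro le_imp_inverse_le power_mono) auto
        moreover have "norm (\<zeta> (u $ 1 / u $ 2) - \<zeta> z) \<le> 2 * B"
          using norm_triangle_ineq4[of "\<zeta> (u $ 1 / u $ 2)" "\<zeta> z"] B[of "u $ 1 / u $ 2"] B[of z] by linarith
        ultimately have "norm (\<zeta> (u $ 1 / u $ 2) - \<zeta> z) * ?q \<le> 2 * B * c"
          using q0 B0 by (intro mult_mono) auto
        moreover have "e / 2 * ?q \<ge> 0"
          using e q0 by simp
        ultimately show ?thesis
          by linarith
      qed
      finally show ?thesis .
    qed
    have Aint: "integrable haar_K (\<lambda>k. \<zeta> (k $ 1 $ 1 / k $ 2 $ 1) * kern s (column 1 k) (K_elt v))"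
      by (rule avg_bound(2)[OF s(1) s1 _ B v(1)]) simp
    have Zint: "integrable haar_K (\<lambda>k. \<zeta> z * of_real (?Q k))"
      using Qint by (intro integrable_mult_right integrable_of_real)
    have "avg s \<zeta> (K_elt v) - \<zeta> z * of_real ?N = (\<integral>k. \<zeta> (k $ 1 $ 1 / k $ 2 $ 1) * kern s (column 1 k) (K_elt v) - \<zeta> z * of_real (?Q k) \<partial>haar_K)"
    proof -
      have ZI: "(\<integral>k. \<zeta> z * of_real (?Q k) \<partial>haar_K) = \<zeta> z * of_real ?N"
        unfolding kern_mass_eq[OF v(1), symmetric]
        by (subst integral_mult_right_zero, subst integral_complex_of_real) (rule refl)
      then show ?thesis
        unfolding avg_def by (simp only: Bochner_Integration.integral_diff[OF Aint Zint] ZI)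
    qed
    also have "norm \<dots> \<le> (\<integral>k. norm (\<zeta> (k $ 1 $ 1 / k $ 2 $ 1) * kern s (column 1 k) (K_elt v) - \<zeta> z * of_real (?Q k)) \<partial>haar_K)"
      by (rule integral_norm_bound)
    also have "\<dots> \<le> (\<integral>k. e / 2 * ?Q k + 2 * B * c \<partial>haar_K)"
    proof (rule integral_mono_AE)
      show "AE k in haar_K. norm (\<zeta> (k $ 1 $ 1 / k $ 2 $ 1) * kern s (column 1 k) (K_elt v) - \<zeta> z * of_real (?Q k)) \<le> e / 2 * ?Q k + 2 * B * c"
        using AE_haar_K_SL2
      proof eventually_elim
        case (elim k)
        then show ?case
          using pt[of "column 1 k"] by (simp add: column_def)
      qed
      show "integrable haar_K (\<lambda>k. e / 2 * ?Q k + 2 * B * c)"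
        using Qint by simp
    qed (intro integrable_norm Bochner_Integration.integrable_diff Aint Zint)
    also have "\<dots> = e / 2 * ?N + 2 * B * c"
      using Qint by (simp add: kern_mass_eq[OF v(1)])
    finally have "norm (avg s \<zeta> (K_elt v) - \<zeta> z * of_real ?N) \<le> e / 2 * ?N + 2 * B * c" .
    then have "norm (avg s \<zeta> (K_elt v) - \<zeta> z * of_real ?N) / ?N \<le> (e / 2 * ?N + 2 * B * c) / ?N"
      using N by (intro divide_right_mono) auto
    moreover have "(e / 2 * ?N + 2 * B * c) / ?N = e / 2 + 2 * B * c / ?N"
      using N by (simp add: add_divide_distrib)
    moreover have "inverse (of_real ?N) * avg s \<zeta> (K_elt v) - \<zeta> z = inverse (of_real ?N) * (avg s \<zeta> (K_elt v) - \<zeta> z * of_real ?N)"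
      using N by (simp add: right_diff_distrib)
    moreover have "norm (inverse (of_real ?N) * x) = norm x / ?N" for x :: complex
      using N by (simp add: norm_mult norm_inverse divide_inverse mult.commute)
    ultimately show ?thesis
      unfolding dist_norm by metis
  qed
  have "(\<lambda>n. e / 2 + 2 * B * c / kern_mass TYPE('a) (eps_seq n)) \<longlonglongrightarrow> e / 2 + 0"
    by (intro tendsto_add tendsto_const tendsto_divide_0[OF tendsto_const] filterlim_at_top_imp_at_infinity kern_mass_at_top)
  then have "\<forall>\<^sub>F n in sequentially. e / 2 + 2 * B * c / kern_mass TYPE('a) (eps_seq n) < e"
    by (rule order_tendstoD(2)) (use e in simp)
  moreover have "\<forall>\<^sub>F n in sequentially. eps_seq n < 1 / 2"
    by (rule order_tendstoD(2)[OF eps_seq(3)]) simp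
  ultimately show "\<forall>\<^sub>F n in sequentially. dist (inverse (of_real (kern_mass TYPE('a) (eps_seq n))) * avg (eps_seq n) \<zeta> (K_elt v)) (\<zeta> (v $ 1 / v $ 2)) < e"
  proof eventually_elim
    case (elim n)
    then show ?case
      using est[OF eps_seq(1), of n] by (simp add: z_def)
  qed
qed

end

text \<open>The adjugate agrees with the inverse on the group, but is polynomial in the entries on
  all matrices. This gives measurability everywhere, as well as the product rule without side
  conditions.\<close>

definition adj2 :: "'a::comm_ring_1^2^2 \<Rightarrow> 'a^2^2" where
  "adj2 k = mat2 (k $ 2 $ 2) (- (k $ 1 $ 2)) (- (k $ 2 $ 1)) (k $ 1 $ 1)"

lemma adj2_eq_inv: "k \<in> SL2 \<Longrightarrow> adj2 k = matrix_inv k" for k :: "'a::field^2^2"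
  by (simp add: adj2_def SL2_inv_eq)

lemma adj2_mult: "adj2 (A ** B) = adj2 B ** adj2 A"
  by (simp add: adj2_def vec2_eq_iff matrix_matrix_mult_2 algebra_simps)

lemma borel_measurable_adj2 [measurable (raw)]:
  fixes f :: "'b \<Rightarrow> 'a::{real_normed_field, euclidean_space}^2^2"
  assumes [measurable]: "f \<in> borel_measurable M"
  shows "(\<lambda>x. adj2 (f x)) \<in> borel_measurable M"
  unfolding adj2_def by measurable

lemma adj2_K_elt:
  fixes u :: "'a::{real_normed_field, euclidean_space}^2"
  assumes "norm u = 1"
  obtains w where "norm w = 1" "adj2 (K_elt u) = K_elt w"
proof
  let ?w = "vector [conj_F (u $ 1), - (u $ 2)] :: 'a^2"
  show "adj2 (K_elt u) = K_elt ?w"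
    using K_elt_inv[OF assms] by (simp add: adj2_eq_inv K_elt_in_SL2 assms)
  have "(norm ?w)\<^sup>2 = 1\<^sup>2"
    using norm_vec2[of ?w] norm_vec2[of u] assms by simp
  then show "norm ?w = 1"
    by (rule power2_eq_imp_eq) simp_all
qed

text \<open>Unimodularity of \<open>K\<close>, deduced from left invariance and Fubini's theorem.\<close>
lemma integral_haar_K_inverse:
  fixes P :: "'a::{real_normed_field, euclidean_space}^2^2 \<Rightarrow> complex"
  assumes int: "integrable haar_K P" and v: "norm v = 1"
  shows "(\<integral>k. P (adj2 k ** K_elt v) \<partial>haar_K) = (\<integral>k. P k \<partial>haar_K)"
proof -
  have [measurable]: "P \<in> borel_measurable borel"
    using borel_measurable_integrable[OF int] by simp
  \<comment> \<open>Replacing \<open>k\<close> by \<open>K_elt u ** k\<close> cancels the right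
    factor \<open>K_elt u\<close>, so the integral with a right translation does not depend on
    it.\<close>
  have eq: "(\<integral>k. P (adj2 k ** K_elt u) \<partial>haar_K) = (\<integral>k. P (adj2 k) \<partial>haar_K)" if u: "norm u = 1" for u
  proof -
    have "adj2 (K_elt u ** k) ** K_elt u = adj2 k" for k
      by (simp add: adj2_mult matrix_mul_assoc[symmetric] adj2_eq_inv[of "K_elt u"] K_elt_in_SL2 u SL2_mult_inv)
    then show ?thesis
      using integral_haar_K_left(1)[OF _ u, of "\<lambda>k. P (adj2 k ** K_elt u)"] by simp
  qed
  interpret HH: pair_sigma_finite "haar_K :: ('a^2^2) measure" "haar_K :: ('a^2^2) measure" ..
  have [measurable]: "(\<lambda>(k, x). P (adj2 k ** x)) \<in> borel_measurable (haar_K \<Otimes>\<^sub>M haar_K)"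
  proof -
    have "(\<lambda>(k, x). P (adj2 k ** x)) \<in> borel_measurable (borel \<Otimes>\<^sub>M borel)"
      by measurable
    moreover have "sets (haar_K \<Otimes>\<^sub>M haar_K :: (('a^2^2) \<times> ('a^2^2)) measure) = sets (borel \<Otimes>\<^sub>M borel)"
      by (rule sets_pair_measure_cong) simp_all
    ultimately show ?thesis
      by (simp cong: measurable_cong_sets)
  qed
  have inner: "(\<integral>x. Q (adj2 k ** x) \<partial>haar_K) = (\<integral>x. Q x \<partial>haar_K)" "integrable haar_K (\<lambda>x. Q (adj2 k ** x)) \<longleftrightarrow> integrable haar_K Q"
    if k: "norm (column 1 k) = 1" "k = K_elt (column 1 k)" and [measurable]: "Q \<in> borel_measurable borel"
    for k and Q :: "'a^2^2 \<Rightarrow> 'c::{banach, second_countable_topology}"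
  proof -
    obtain w where "norm w = 1" "adj2 k = K_elt w"
      using adj2_K_elt[OF k(1)] k(2) by metis
    then show "(\<integral>x. Q (adj2 k ** x) \<partial>haar_K) = (\<integral>x. Q x \<partial>haar_K)" "integrable haar_K (\<lambda>x. Q (adj2 k ** x)) \<longleftrightarrow> integrable haar_K Q"
      by (simp_all add: integral_haar_K_left)
  qed
  have fub: "integrable (haar_K \<Otimes>\<^sub>M haar_K) (\<lambda>(k, x). P (adj2 k ** x))"
  proof (rule HH.Fubini_integrable)
    have "AE k in haar_K. (\<integral>x. norm (P (adj2 k ** x)) \<partial>haar_K) = (\<integral>x. norm (P x) \<partial>haar_K)"
      using AE_haar_K_SL2 by eventually_elim (rule inner(1), auto)
    then have "integrable haar_K (\<lambda>k. \<integral>x. norm (P (adj2 k ** x)) \<partial>haar_K) \<longleftrightarrow> integrable haar_K (\<lambda>k :: 'a^2^2. \<integral>x. norm (P x) \<partial>haar_K)"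
      by (intro integrable_cong_AE haar_K.borel_measurable_lebesgue_integral) simp_all
    then show "integrable haar_K (\<lambda>k. \<integral>x. norm (case (k, x) of (k, x) \<Rightarrow> P (adj2 k ** x)) \<partial>haar_K)"
      by simp
    show "AE k in haar_K. integrable haar_K (\<lambda>x. case (k, x) of (k, x) \<Rightarrow> P (adj2 k ** x))"
      using AE_haar_K_SL2 by eventually_elim (simp add: inner(2) int)
  qed measurable
  \<comment> \<open>A dummy average over \<open>x\<close> is introduced, and \<open>eq\<close>
    inserts \<open>x\<close> as a right factor. In the other order of integration left invariance in
    \<open>x\<close> removes \<open>adj2 k\<close>, and what remains is the integral of
    \<open>P\<close>.\<close>
  have "(\<integral>k. P (adj2 k) \<partial>haar_K) = (\<integral>x. (\<integral>k. P (adj2 k) \<partial>haar_K) \<partial>(haar_K :: ('a^2^2) measure))"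
    by simp
  also have "\<dots> = (\<integral>x. (\<integral>k. P (adj2 k ** x) \<partial>haar_K) \<partial>haar_K)"
  proof (rule integral_cong_AE)
    show "(\<lambda>x. \<integral>k. P (adj2 k ** x) \<partial>haar_K) \<in> borel_measurable haar_K"
      using borel_measurable_integrable[OF HH.integrable_snd[OF fub]] by simp
    show "AE x in haar_K. (\<integral>k. P (adj2 k) \<partial>haar_K) = (\<integral>k. P (adj2 k ** x) \<partial>haar_K)"
      using AE_haar_K_SL2
    proof eventually_elim
      case (elim x)
      then show ?case
        using eq[of "column 1 x"] by simp
    qed
  qed simp
  also have "\<dots> = (\<integral>k. (\<integral>x. P (adj2 k ** x) \<partial>haar_K) \<partial>haar_K)"
    by (rule HH.Fubini_integral[OF fub])
  also have "\<dots> = (\<integral>k. (\<integral>x. P x \<partial>haar_K) \<partial>(haar_K :: ('a^2^2) measure))"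
  proof (rule integral_cong_AE)
    show "(\<lambda>k. \<integral>x. P (adj2 k ** x) \<partial>haar_K) \<in> borel_measurable haar_K"
      using borel_measurable_integrable[OF HH.integrable_fst[OF fub]] by simp
    show "AE k in haar_K. (\<integral>x. P (adj2 k ** x) \<partial>haar_K) = (\<integral>x. P x \<partial>haar_K)"
      using AE_haar_K_SL2 by eventually_elim (rule inner(1), auto)
  qed simp
  also have "\<dots> = (\<integral>k. P k \<partial>haar_K)"
    by simp
  finally show ?thesis
    by (simp add: eq[OF v])
qed

context spherical
begin

section \<open>Cyclicity of the spherical vector\<close>

lemma closed_subspace_simps:
  assumes "closed_subspace W"
  shows "W \<subseteq> ps_space \<eta>" "(\<lambda>_. 0) \<in> W" "\<And>f g. f \<in> W \<Longrightarrow> g \<in> W \<Longrightarrow> (\<lambda>x. f x + g x) \<in> W"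
    "\<And>c f. f \<in> W \<Longrightarrow> (\<lambda>x. c * f x) \<in> W"
    "\<And>f. f \<in> ps_space \<eta> \<Longrightarrow> (\<And>e. e > 0 \<Longrightarrow> \<exists>g\<in>W. ps_norm (\<lambda>x. f x - g x) < e) \<Longrightarrow> f \<in> W"
  using assms unfolding closed_subspace_def by auto

lemma closed_subspace_sum:
  assumes W: "closed_subspace W" and "finite S" "\<And>i. i \<in> S \<Longrightarrow> f i \<in> W"
  shows "(\<lambda>x. \<Sum>i\<in>S. f i x) \<in> W"
  using assms(2,3)
proof (induction S rule: finite_induct)
  case empty
  then show ?case
    using closed_subspace_simps(2)[OF W] by simp
next
  case (insert i S)
  then show ?case
    using closed_subspace_simps(3)[OF W, of "f i" "\<lambda>x. \<Sum>i\<in>S. f i x"] by simp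
qed

lemma proj_lift_sum: "proj_lift (\<lambda>z. \<Sum>i\<in>S. c i * \<zeta> i z) = (\<lambda>g. \<Sum>i\<in>S. c i * proj_lift (\<zeta> i) g)"
  by (auto simp: proj_lift_def fun_eq_iff sum_distrib_left mult.left_commute)

lemma proj_lift_limit:
  assumes W: "closed_subspace W" and F: "\<And>n. proj_lift (F n) \<in> W" and \<zeta>: "proj_lift \<zeta> \<in> ps_space \<eta>"
    and lim: "\<And>z. (\<lambda>n. F n z) \<longlonglongrightarrow> \<zeta> z" and w: "\<And>n z. norm (F n z) \<le> c * norm (w z)"
    and int: "integrable haar_K (\<lambda>k. (norm (proj_lift w k))\<^sup>2)"
  shows "proj_lift \<zeta> \<in> W"
proof (rule closed_subspace_limit[OF W F \<zeta>, where w = "\<lambda>k. c * norm (proj_lift w k)"])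
  show "integrable haar_K (\<lambda>k. (c * norm (proj_lift w k))\<^sup>2)"
    using int by (simp add: power_mult_distrib)
  show "AE k in haar_K. (\<lambda>n. proj_lift (F n) k) \<longlonglongrightarrow> proj_lift \<zeta> k"
    by (intro AE_I2) (auto simp: proj_lift_def intro!: tendsto_mult_left lim)
  show "AE k in haar_K. norm (proj_lift (F n) k) \<le> c * norm (proj_lift w k)" for n
  proof (rule AE_I2)
    fix k :: "'a^2^2"
    show "norm (proj_lift (F n) k) \<le> c * norm (proj_lift w k)"
      using mult_left_mono[OF w[of n "k $ 1 $ 1 / k $ 2 $ 1"], of "norm (complex_of_real (inverse (norm (column 1 k) ^ DIM('a))))"]
      by (simp add: proj_lift_def norm_mult mult.left_commute)
  qed
qed

text \<open>The normalised averages lie in \<open>W\<close>, are bounded by \<open>B\<close>, and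
  converge on the affine chart, which has full measure. Dominated convergence keeps the limit in
  \<open>W\<close>.\<close>

lemma cyclic_continuous:
  assumes W: "closed_subspace W" and f0: "\<And>h. h \<in> SL2 \<Longrightarrow> left_translate h (proj_lift (\<lambda>_. 1)) \<in> W"
    and cont: "continuous_on UNIV \<zeta>" and B: "\<And>z. norm (\<zeta> z) \<le> B"
  shows "proj_lift \<zeta> \<in> W"
proof -
  have [measurable]: "\<zeta> \<in> borel_measurable borel"
    using cont by (rule borel_measurable_continuous_onI)
  let ?N = "\<lambda>n. kern_mass TYPE('a) (eps_seq n)"
  have N: "?N n > 0" for n
    using kern_mass_ge_1[OF eps_seq(1,2)[of n], where 'a = 'a] by simp
  show ?thesis
  proof (rule closed_subspace_limit[OF W, where F = "\<lambda>n g. inverse (of_real (?N n)) * avg (eps_seq n) \<zeta> g" and w = "\<lambda>_. B"])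
    show "(\<lambda>g. inverse (of_real (?N n)) * avg (eps_seq n) \<zeta> g) \<in> W" for n
      by (intro closed_subspace_simps(4)[OF W] avg_in_closed_subspace[OF W f0 _ B]) simp_all
    show "proj_lift \<zeta> \<in> ps_space \<eta>"
      by (rule proj_lift_bounded_in_ps_space[OF _ B]) simp
    show "AE k in haar_K. (\<lambda>n. inverse (of_real (?N n)) * avg (eps_seq n) \<zeta> k) \<longlonglongrightarrow> proj_lift \<zeta> k"
      using AE_haar_K_SL2 AE_haar_K_nonzero
    proof eventually_elim
      case (elim k)
      define v where "v = column 1 k"
      have v: "norm v = 1" "v $ 2 \<noteq> 0" "k = K_elt v"
        using elim by (auto simp: v_def column_def)
      show ?case
        unfolding v(3) proj_lift_K_elt[OF v(1)] by (rule avg_tendsto[OF cont B v(1,2)])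
    qed
    show "AE k in haar_K. norm (inverse (of_real (?N n)) * avg (eps_seq n) \<zeta> k) \<le> B" for n
      using AE_haar_K_SL2
    proof eventually_elim
      case (elim k)
      then have "norm (avg (eps_seq n) \<zeta> k) \<le> B * ?N n"
        using avg_bound(1)[OF eps_seq(1,2) _ B, where v = "column 1 k"] by simp
      then show ?case
        using N[of n] by (simp add: norm_mult norm_inverse norm_divide inverse_eq_divide divide_le_eq)
    qed
  qed simp
qed

text \<open>The sets whose lifted indicators lie in \<open>W\<close> form a Dynkin system. It
  contains the open sets, whose indicators are pointwise limits of bounded continuous functions, and
  these generate the Borel sets and are stable under intersection.\<close>

lemma cyclic_indicator:
  assumes W: "closed_subspace W" and f0: "\<And>h. h \<in> SL2 \<Longrightarrow> left_translate h (proj_lift (\<lambda>_. 1)) \<in> W"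
    and A: "A \<in> sets borel"
  shows "proj_lift (indicator A) \<in> W"
proof -
  have one: "proj_lift (\<lambda>_ :: 'a. 1) \<in> W"
    by (rule cyclic_continuous[OF W f0, where B = 1]) auto
  have int1: "integrable haar_K (\<lambda>k. (norm (proj_lift (\<lambda>_ :: 'a. 1) k))\<^sup>2)"
    using one closed_subspace_simps(1)[OF W] by (auto intro: ps_space_integrable)
  have ind: "proj_lift (indicator A) \<in> ps_space \<eta>" if "A \<in> sets borel" for A
    by (rule proj_lift_bounded_in_ps_space[where B = 1]) (use that in \<open>auto simp: indicator_def\<close>)
  have "Int_stable {S :: 'a set. open S}" "{S :: 'a set. open S} \<subseteq> Pow UNIV" "A \<in> sigma_sets UNIV {S. open S}"
    using A by (auto simp: borel_def Int_stable_def)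
  then show ?thesis
  proof (induction rule: sigma_sets_induct_disjoint)
    case (basic S)
    show ?case
    \<comment> \<open>The whole space is separate because \<open>infdist\<close> to the empty
      complement is 0, so the approximating functions would vanish identically.\<close>
    proof (cases "S = UNIV")
      case True
      then show ?thesis
        using one by (simp add: indicator_def)
    next
      case False
      have "open S" using basic by simp
      define F where "F n z = (of_real (min 1 (real n * infdist z (- S))) :: complex)" for n z
      show ?thesis
      proof (rule proj_lift_limit[OF W, where F = F and w = "\<lambda>_. 1" and c = 1])
        show "proj_lift (F n) \<in> W" for n
        proof (rule cyclic_continuous[OF W f0, where B = 1])
          show "continuous_on UNIV (F n)"
            unfolding F_def[abs_def] by (intro continuous_intros)
          show "norm (F n z) \<le> 1" for z
            by (simp add: F_def infdist_nonneg)
        qed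
        show "(\<lambda>n. F n z) \<longlonglongrightarrow> indicator S z" for z
        proof (cases "z \<in> S")
          case True
          then have "infdist z (- S) > 0"
            using False \<open>open S\<close> by (intro infdist_pos_not_in_closed) auto
          then have "filterlim (\<lambda>n. real n * infdist z (- S)) at_top sequentially"
            by (intro filterlim_at_top_mult_tendsto_pos[OF tendsto_const] filterlim_real_sequentially) 
          then have "\<forall>\<^sub>F n in sequentially. 1 \<le> real n * infdist z (- S)"
            by (simp add: filterlim_at_top)
          then have "\<forall>\<^sub>F n in sequentially. F n z = indicator S z"
            by eventually_elim (simp add: F_def True)
          then show ?thesis
            by (rule tendsto_eventually)
        next
          case False
          then show ?thesis
            by (simp add: F_def)
        qed
        show "norm (F n z) \<le> 1 * norm (1 :: complex)" for n z
          by (simp add: F_def infdist_nonneg)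
        show "proj_lift (indicator S) \<in> ps_space \<eta>"
          using \<open>open S\<close> by (intro ind) simp
      qed (rule int1)
    qed
  next
    case empty
    have "proj_lift (indicator ({} :: 'a set)) = (\<lambda>_. 0)"
      by (simp add: proj_lift_def fun_eq_iff)
    then show ?case
      using closed_subspace_simps(2)[OF W] by metis
  next
    case (compl A)
    have "proj_lift (indicator (UNIV - A)) = (\<lambda>g. proj_lift (\<lambda>_. 1) g + -1 * proj_lift (indicator A) g)"
      by (auto simp: proj_lift_def fun_eq_iff indicator_def)
    then show ?case
      using closed_subspace_simps(3)[OF W one closed_subspace_simps(4)[OF W compl(2), of "-1"]] by simp
  next
    case (union A)
    have A: "A i \<in> sets borel" for i
      using union by (auto simp: borel_def)
    show ?case
    proof (rule proj_lift_limit[OF W, where F = "\<lambda>n z. \<Sum>i<n. 1 * indicator (A i) z" and w = "\<lambda>_. 1" and c = 1])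
      show "proj_lift (\<lambda>z. \<Sum>i<n. 1 * indicator (A i) z) \<in> W" for n
        unfolding proj_lift_sum using union by (intro closed_subspace_sum[OF W] closed_subspace_simps(4)[OF W]) auto
      show "proj_lift (indicator (\<Union> (range A))) \<in> ps_space \<eta>"
        using A by (intro ind) auto
      have eq: "(\<Sum>i<n. 1 * indicator (A i) z) = (indicator (\<Union>i<n. A i) z :: complex)" for n z
        using union(1) by (subst indicator_UN_disjoint) (auto simp: disjoint_family_on_def)
      show "(\<lambda>n. \<Sum>i<n. 1 * indicator (A i) z) \<longlonglongrightarrow> (indicator (\<Union> (range A)) z :: complex)" for z
        unfolding eq by (rule LIMSEQ_indicator_UN)
      show "norm (\<Sum>i<n. 1 * indicator (A i) z :: complex) \<le> 1 * norm (1 :: complex)" for n z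
        unfolding eq by (simp add: indicator_def)
    qed (rule int1)
  qed
qed

text \<open>Two unit vectors on the same line differ by a phase \<open>l\<close>, and the
  corresponding elements of \<open>K\<close> by a diagonal matrix with \<open>norm l = 1\<close>.
  There both the modulus and \<open>\<eta>\<close> are 1, so a vector of the space descends to the
  projective line.\<close>

lemma ps_space_AE_proj_lift:
  assumes f: "f \<in> ps_space \<eta>"
  defines "\<zeta> \<equiv> \<lambda>z. f (K_elt (sgn (vector [z, 1])))"
  shows "\<zeta> \<in> borel_measurable borel" "AE k in haar_K. f k = proj_lift \<zeta> k"
proof -
  have [measurable]: "f \<in> borel_measurable borel"
    by (rule ps_space_measurable[OF f])
  show "\<zeta> \<in> borel_measurable borel"
    unfolding \<zeta>_def by measurable
  show "AE k in haar_K. f k = proj_lift \<zeta> k"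
    using AE_haar_K_SL2 AE_haar_K_nonzero
  proof eventually_elim
    case (elim k)
    define v where "v = column 1 k"
    have v: "norm v = 1" "v $ 2 \<noteq> 0" "k = K_elt v"
      using elim by (auto simp: v_def column_def)
    define w where "w = sgn (vector [v $ 1 / v $ 2, 1] :: 'a^2)"
    \<comment> \<open>The phase of the second coordinate: dividing \<open>v\<close> by it yields the
      representative \<open>w\<close> whose second coordinate is a positive real.\<close>
    define l where "l = v $ 2 / of_real (norm (v $ 2))"
    have e: "vector [v $ 1 / v $ 2, 1] = inverse (v $ 2) *s v"
      using v by (simp add: vec2_eq_iff divide_inverse mult.commute)
    have "v \<noteq> 0"
      using v(2) by auto
    then have w: "norm w = 1"
      unfolding w_def e using v by (simp add: norm_sgn)
    have "w = norm (v $ 2) *\<^sub>R (inverse (v $ 2) *s v)"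
      unfolding w_def e sgn_div_norm norm_vector_smult using v by (simp add: norm_inverse)
    then have "w $ i = of_real (norm (v $ 2)) * (inverse (v $ 2) * v $ i)" for i
      by (simp add: of_real_def)
    then have vw: "v = l *s w"
      using v by (simp add: vec2_eq_iff l_def)
    have l: "norm l = 1" "l \<noteq> 0"
      using v by (auto simp: l_def norm_divide)
    have "mat2 l 0 0 (conj_F l) \<in> upper_P" "levi (mat2 l 0 0 (conj_F l)) = l"
      using l by (simp_all add: upper_P_def mat2_in_SL2 mult_conj_F levi_def)
    moreover have "K_elt v = K_elt w ** mat2 l 0 0 (conj_F l)"
      unfolding vw by (simp add: vec2_eq_iff matrix_matrix_mult_2 K_elt_def conj_F_mult mult.commute)
    ultimately have "f (K_elt v) = f (K_elt w)"
      using ps_space_cov[OF f K_elt_in_SL2[OF w]] l by (simp add: \<eta>_one)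
    then show ?case
      unfolding v(3) proj_lift_K_elt[OF v(1)] by (simp add: \<zeta>_def w_def)
  qed
qed

lemma cyclic:
  assumes W: "closed_subspace W" and f0: "\<And>h. h \<in> SL2 \<Longrightarrow> left_translate h (proj_lift (\<lambda>_. 1)) \<in> W"
  shows "W = ps_space \<eta>"
proof
  show "W \<subseteq> ps_space \<eta>"
    by (rule closed_subspace_simps(1)[OF W])
  show "ps_space \<eta> \<subseteq> W"
  proof
    fix f assume f: "f \<in> ps_space \<eta>"
    obtain \<zeta> where \<zeta> [measurable]: "\<zeta> \<in> borel_measurable borel" and ae: "AE k in haar_K. f k = proj_lift \<zeta> k"
      using ps_space_AE_proj_lift[OF f] by blast
    have [measurable]: "f \<in> borel_measurable borel"
      by (rule ps_space_measurable[OF f])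
    have int: "integrable haar_K (\<lambda>k. (norm (proj_lift \<zeta> k))\<^sup>2)"
    proof -
      have "integrable haar_K (\<lambda>k. (norm (f k))\<^sup>2) \<longleftrightarrow> integrable haar_K (\<lambda>k. (norm (proj_lift \<zeta> k))\<^sup>2)"
        by (rule integrable_cong_AE) (use ae in \<open>auto elim: eventually_mono\<close>)
      then show ?thesis
        using ps_space_integrable[OF f] by simp
    qed
    have V: "proj_lift \<zeta> \<in> ps_space \<eta>"
      by (rule proj_lift_in_ps_space[OF \<zeta> int])
    \<comment> \<open>The bound by twice \<open>\<zeta>\<close> supplies a square-integrable
      majorant although \<open>\<zeta>\<close> itself may be unbounded.\<close>
    obtain F where F: "\<And>n. simple_function borel (F n)" "\<And>z. (\<lambda>n. F n z) \<longlonglongrightarrow> \<zeta> z" "\<And>n z. norm (F n z) \<le> 2 * norm (\<zeta> z)"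
      using borel_measurable_implies_sequence_metric[OF \<zeta>, of 0] by (auto simp: dist_norm)
    have FW: "proj_lift (F n) \<in> W" for n
    proof -
      have fin: "finite (F n ` UNIV)"
        using F(1)[of n] by (simp add: simple_function_def)
      have "F n = (\<lambda>z. \<Sum>y\<in>F n ` UNIV. y * indicator (F n -` {y}) z)"
        using fin by (auto simp: fun_eq_iff indicator_def if_distrib sum.delta' cong: if_cong)
      moreover have "proj_lift (\<lambda>z. \<Sum>y\<in>F n ` UNIV. y * indicator (F n -` {y}) z) \<in> W"
        unfolding proj_lift_sum
      proof (intro closed_subspace_sum[OF W fin] closed_subspace_simps(4)[OF W] cyclic_indicator[OF W f0])
        fix y assume "y \<in> F n ` UNIV"
        then show "F n -` {y} \<in> sets borel"
          using F(1)[of n] by (auto simp: simple_function_def)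
      qed
      ultimately show ?thesis
        by simp
    qed
    have \<zeta>W: "proj_lift \<zeta> \<in> W"
      by (rule proj_lift_limit[OF W FW V F(2) F(3) int])
    show "f \<in> W"
    \<comment> \<open>\<open>f\<close> and the lift agree only almost everywhere, so their distance
      is zero; closedness for the seminorm absorbs the difference.\<close>
    proof (rule closed_subspace_simps(5)[OF W f])
      fix e :: real assume "e > 0"
      have "ps_norm (\<lambda>x. f x - proj_lift \<zeta> x) = ps_norm (\<lambda>_ :: 'a^2^2. 0)"
        by (rule ps_norm_cong_AE) (use ae in \<open>auto elim: eventually_mono\<close>)
      also have "\<dots> < e"
        using \<open>e > 0\<close> by (simp add: ps_norm_def)
      finally show "\<exists>g\<in>W. ps_norm (\<lambda>x. f x - g x) < e"
        by (rule bexI[OF _ \<zeta>W])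
    qed
  qed
qed

text \<open>The average over \<open>k\<close> of the translates of \<open>f\<close> is constant on
  \<open>K\<close>, and unimodularity identifies the constant with the integral of \<open>f\<close>.
  A nonzero constant can be divided out.\<close>

lemma spherical_vector_in_subspace:
  assumes W: "closed_subspace W" and inv: "\<And>h f. h \<in> SL2 \<Longrightarrow> f \<in> W \<Longrightarrow> left_translate h f \<in> W"
    and f: "f \<in> W" and nz: "(\<integral>k. f k \<partial>haar_K) \<noteq> 0"
  shows "proj_lift (\<lambda>_. 1) \<in> W"
proof -
  let ?a = "\<integral>k. f k \<partial>haar_K"
  have fV: "f \<in> ps_space \<eta>"
    using f closed_subspace_simps(1)[OF W] by auto
  have [measurable]: "f \<in> borel_measurable borel"
    by (rule ps_space_measurable[OF fV])
  have oneV: "proj_lift (\<lambda>_. 1) \<in> ps_space \<eta>"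
    by (rule proj_lift_bounded_in_ps_space[where B = 1]) auto
  have "integrable haar_K (\<lambda>k. f k * proj_lift (\<lambda>_. 1) k)"
    by (rule ps_space_integrable_mult(1)[OF fV oneV])
  also have "?this \<longleftrightarrow> integrable haar_K f"
  proof (rule integrable_cong_AE)
    show "AE k in haar_K. f k * proj_lift (\<lambda>_. 1) k = f k"
      using AE_haar_K_SL2 by eventually_elim (simp add: proj_lift_def)
  qed simp_all
  finally have int: "integrable haar_K f" .
  have tr: "(\<lambda>x. f (adj2 (K_elt u) ** x)) = left_translate (K_elt u) f" if "norm u = 1" for u
    using that by (simp add: left_translate_def adj2_eq_inv K_elt_in_SL2)
  have "(\<lambda>x. ?a * proj_lift (\<lambda>_. 1) x) \<in> W"
  proof (rule closed_subspace_integral[OF W, where \<Phi> = "\<lambda>k x. f (adj2 k ** x)"])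
    show "(\<lambda>p. f (adj2 (fst p) ** snd p)) \<in> borel_measurable (borel \<Otimes>\<^sub>M borel)"
      by measurable
    show "(\<lambda>x. f (adj2 (K_elt u) ** x)) \<in> W" if "norm u = 1" for u
      unfolding tr[OF that] by (rule inv[OF K_elt_in_SL2[OF that] f])
    show "ps_norm (\<lambda>x. f (adj2 (K_elt u) ** x)) \<le> ps_norm f" if "norm u = 1" for u
      unfolding ps_norm_def
      using K_homogeneous_translate(2)[OF K_homogeneous_norm_square[OF ps_space_K_homogeneous[OF fV]] _
          SL2_inv[OF K_elt_in_SL2[OF that]]]
      by (simp add: adj2_eq_inv K_elt_in_SL2 that)
    show "(\<lambda>x. ?a * proj_lift (\<lambda>_. 1) x) \<in> ps_space \<eta>"
      by (rule ps_space_scale[OF oneV])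
    show "AE x in haar_K. ?a * proj_lift (\<lambda>_. 1) x = (\<integral>k. f (adj2 k ** x) \<partial>haar_K)"
      using AE_haar_K_SL2
    proof eventually_elim
      case (elim x)
      then show ?case
        using integral_haar_K_inverse[OF int, of "column 1 x"] by (simp add: proj_lift_def)
    qed
  qed
  from closed_subspace_simps(4)[OF W this, of "inverse ?a"] show ?thesis
    using nz by (simp add: mult.assoc[symmetric])
qed

theorem irreducible: "\<not> reducible_rep SL2 left_translate (ps_space \<eta>) ps_norm"
proof
  assume "reducible_rep SL2 left_translate (ps_space \<eta>) ps_norm"
  then obtain W f where W: "closed_subspace W" and inv: "\<And>h f. h \<in> SL2 \<Longrightarrow> f \<in> W \<Longrightarrow> left_translate h f \<in> W"
    and f: "f \<in> W" "ps_norm f \<noteq> 0" and ne: "W \<noteq> ps_space \<eta>"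
    unfolding reducible_rep_iff by blast
  have fV: "f \<in> ps_space \<eta>"
    using f closed_subspace_simps(1)[OF W] by auto
  let ?f0 = "proj_lift (\<lambda>_. 1) :: 'a^2^2 \<Rightarrow> complex"
  have f0V: "?f0 \<in> ps_space \<eta>"
    by (rule proj_lift_bounded_in_ps_space[where B = 1]) auto
  \<comment> \<open>Otherwise all translates of the spherical vector lie in the orthogonal
    complement of \<open>f\<close>. By cyclicity that complement is everything, so \<open>f\<close>
    is orthogonal to itself.\<close>
  obtain h where h: "h \<in> SL2" "pairing (left_translate h ?f0) (\<lambda>x. cnj (f x)) \<noteq> 0"
  proof (rule ccontr)
    assume "\<not> thesis"
    then have z: "pairing (left_translate h ?f0) (\<lambda>x. cnj (f x)) = 0" if "h \<in> SL2" for h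
      using that \<open>\<And>h. h \<in> SL2 \<Longrightarrow> pairing (left_translate h ?f0) (\<lambda>x. cnj (f x)) \<noteq> 0 \<Longrightarrow> thesis\<close> by blast
    let ?W0 = "{x \<in> ps_space \<eta>. \<forall>g\<in>{f}. pairing x (\<lambda>y. cnj (g y)) = 0}"
    have "?W0 = ps_space \<eta>"
      by (rule cyclic[OF closed_subspace_annihilator(2)]) (use fV z f0V ps_space_left_translate in auto)
    with fV have "pairing f (\<lambda>y. cnj (f y)) = 0"
      by auto
    then show False
      using f(2) by (simp add: pairing_cnj_self)
  qed
  define f' where "f' = left_translate (matrix_inv h) f"
  have h': "matrix_inv h \<in> SL2"
    by (rule SL2_inv[OF h(1)])
  have f': "f' \<in> W"
    unfolding f'_def by (rule inv[OF h' f(1)])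
  \<comment> \<open>Unitarity moves the translation from the spherical vector to \<open>f\<close>.
    As the spherical vector is 1 on \<open>K\<close>, the product becomes the conjugate of the
    integral of \<open>f'\<close>.\<close>
  have "pairing (left_translate (matrix_inv h) (left_translate h ?f0)) (left_translate (matrix_inv h) (\<lambda>x. cnj (f x)))
      = pairing (left_translate h ?f0) (\<lambda>x. cnj (f x))"
    using fV ps_space_left_translate[OF f0V h(1)]
    by (intro pairing_left_translate h' K_homogeneous_cnj ps_space_K_homogeneous) (auto intro: ps_space_measurable borel_measurable_cnj)
  moreover have "left_translate (matrix_inv h) (\<lambda>x. cnj (f x)) = (\<lambda>x. cnj (f' x))"
    by (simp add: f'_def left_translate_def)
  ultimately have "pairing ?f0 (\<lambda>x. cnj (f' x)) \<noteq> 0"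
    using h(2) by (simp add: left_translate_inv[OF h(1)])
  moreover have "pairing ?f0 (\<lambda>x. cnj (f' x)) = cnj (\<integral>k. f' k \<partial>haar_K)"
  proof -
    have f'V: "f' \<in> ps_space \<eta>"
      using f' closed_subspace_simps(1)[OF W] by auto
    have "pairing ?f0 (\<lambda>x. cnj (f' x)) = (\<integral>k. cnj (f' k) \<partial>haar_K)"
      unfolding pairing_def
    proof (rule integral_cong_AE)
      show "AE k in haar_K. ?f0 k * cnj (f' k) = cnj (f' k)"
        using AE_haar_K_SL2 by eventually_elim (simp add: proj_lift_def)
    qed (use ps_space_measurable[OF f'V] in auto)
    then show ?thesis
      by (simp add: integral_cnj)
  qed
  ultimately have "(\<integral>k. f' k \<partial>haar_K) \<noteq> 0"
    by auto
  with W inv f' have "?f0 \<in> W"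
    by (intro spherical_vector_in_subspace[of W f']) auto
  then have "W = ps_space \<eta>"
    by (intro cyclic[OF W] inv) auto
  with ne show False ..
qed

end

subsection \<open>Reducibility for the sign character\<close>

lemma nu_0: "nu 0 a = (if a = 0 then 0 else 1)"
  by (simp add: nu_def)

lemma L_char_sgn: "L_char (\<lambda>m. complex_of_real m) 0 l = of_real (sgn l)"
  by (simp add: L_char_def nu_0)

lemma ps_char_sgn: "ps_char (L_char (\<lambda>m. complex_of_real m) 0)"
  by unfold_locales (simp add: L_char_sgn)

text \<open>Over the reals the required covariance factor is
  \<open>1 / (norm l * sgn l) = 1 / l\<close>, so any function of the first column that is
  homogeneous of degree \<open>- 1\<close> qualifies. For nonzero \<open>a\<close>, the sign of
  \<open>Im (b * cnj a)\<close> is that of the imaginary part of \<open>b / a\<close> and selects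
  the half-plane.\<close>

definition pole_fun :: "complex \<Rightarrow> complex \<Rightarrow> real^2^2 \<Rightarrow> complex" where
  "pole_fun a b g = (if g \<in> SL2 then inverse (a * of_real (g $ 1 $ 1) + b * of_real (g $ 2 $ 1)) else 0)"

lemma borel_measurable_pole_fun [measurable]: "pole_fun a b \<in> borel_measurable borel"
  unfolding pole_fun_def[abs_def] by measurable

text \<open>\<open>Im (b * cnj a)\<close> is the determinant of \<open>a\<close> and
  \<open>b\<close> viewed as real vectors. Cramer's rule recovers \<open>x\<close> and
  \<open>y\<close> from the value of the linear form, so the form is bounded away from 0 on the
  circle when the determinant is nonzero.\<close>

lemma pole_fun_bound:
  assumes xy: "x\<^sup>2 + y\<^sup>2 = 1"
  shows "(Im (b * cnj a))\<^sup>2 \<le> ((norm a)\<^sup>2 + (norm b)\<^sup>2) * (norm (a * of_real x + b * of_real y))\<^sup>2"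
proof -
  define D where "D = Im (b * cnj a)"
  define z where "z = a * of_real x + b * of_real y"
  have 1: "D * y = Im (cnj a * z)" "- D * x = Im (cnj b * z)"
    by (simp_all add: D_def z_def algebra_simps)
  have "\<bar>D * y\<bar> \<le> norm (cnj a * z)" "\<bar>- D * x\<bar> \<le> norm (cnj b * z)"
    unfolding 1 by (rule abs_Im_le_cmod)+
  then have "\<bar>D * y\<bar>\<^sup>2 \<le> (norm a * norm z)\<^sup>2" "\<bar>- D * x\<bar>\<^sup>2 \<le> (norm b * norm z)\<^sup>2"
    unfolding norm_mult complex_mod_cnj by (intro power_mono; simp)+
  moreover have "\<bar>D * y\<bar>\<^sup>2 + \<bar>- D * x\<bar>\<^sup>2 = D\<^sup>2 * (x\<^sup>2 + y\<^sup>2)"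
    by (simp add: power_mult_distrib algebra_simps)
  ultimately have "D\<^sup>2 \<le> ((norm a)\<^sup>2 + (norm b)\<^sup>2) * (norm z)\<^sup>2"
    by (simp add: xy power_mult_distrib distrib_right)
  then show ?thesis
    by (simp only: D_def z_def)
qed

lemma norm_column_1_real: "(norm (column 1 (k :: real^2^2)))\<^sup>2 = (k $ 1 $ 1)\<^sup>2 + (k $ 2 $ 1)\<^sup>2"
  by (simp add: norm_vec2 column_def)

lemma pole_fun_in_ps_space:
  assumes D: "Im (b * cnj a) \<noteq> 0"
  shows "pole_fun a b \<in> ps_space (L_char (\<lambda>m. complex_of_real m) 0)"
proof -
  have "integrable haar_K (\<lambda>k. (norm (pole_fun a b k))\<^sup>2)"
  proof (rule haar_K.integrable_const_bound)
    show "AE k in haar_K. norm ((norm (pole_fun a b k))\<^sup>2) \<le> ((norm a)\<^sup>2 + (norm b)\<^sup>2) / (Im (b * cnj a))\<^sup>2"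
      using AE_haar_K_SL2
    proof eventually_elim
      case (elim k)
      let ?z = "a * of_real (k $ 1 $ 1) + b * of_real (k $ 2 $ 1)"
      have le: "(Im (b * cnj a))\<^sup>2 \<le> ((norm a)\<^sup>2 + (norm b)\<^sup>2) * (norm ?z)\<^sup>2"
        using pole_fun_bound elim norm_column_1_real[of k] by simp
      have D2: "(Im (b * cnj a))\<^sup>2 > 0"
        using D by simp
      then have "(norm ?z)\<^sup>2 > 0"
        using le by (metis mult_zero_right not_le zero_less_power2 power2_eq_iff_nonneg zero_eq_power2)
      then have "inverse ((norm ?z)\<^sup>2) \<le> ((norm a)\<^sup>2 + (norm b)\<^sup>2) / (Im (b * cnj a))\<^sup>2"
        using le D2 by (simp add: field_simps)
      then show ?case
        using elim by (simp add: pole_fun_def norm_inverse power_inverse)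
    qed
  qed simp
  moreover have "pole_fun a b (g ** p) = inverse (of_real (norm (levi p) ^ DIM(real))) *
      inverse (L_char (\<lambda>m. complex_of_real m) 0 (levi p)) * pole_fun a b g"
    if "g \<in> SL2" "p \<in> upper_P" for g p
  proof -
    note c = column_mult_upper_P[OF that(2)]
    have e: "(g ** p) $ i $ 1 = levi p * g $ i $ 1" for i
      using arg_cong[OF c(1)[of g], of "\<lambda>v. v $ i"] by (simp add: column_def)
    have "norm (levi p) * sgn (levi p) = levi p"
      by (simp add: sgn_real_def)
    then have "inverse (complex_of_real (norm (levi p) ^ DIM(real))) * inverse (of_real (sgn (levi p))) = inverse (of_real (levi p))"
      by (simp add: inverse_mult_distrib[symmetric] of_real_mult[symmetric] del: of_real_mult inverse_mult_distrib)
    moreover have "a * of_real (levi p * x) + b * of_real (levi p * y) = of_real (levi p) * (a * of_real x + b * of_real y)" for x y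
      by (simp add: algebra_simps)
    ultimately show ?thesis
      using that(1) SL2_mult[OF that(1) c(3)] unfolding L_char_sgn by (simp add: pole_fun_def e inverse_mult_distrib)
  qed
  ultimately show ?thesis
    by (simp add: ps_space_def) (simp add: pole_fun_def)
qed

text \<open>Translation acts on the coefficient pair by a real matrix of determinant 1. It preserves
  the determinant of \<open>a\<close> and \<open>b\<close>, and with it the half-plane.\<close>

lemma left_translate_pole_fun:
  assumes h: "h \<in> SL2"
  obtains a' b' where "left_translate h (pole_fun a b) = pole_fun a' b'" "Im (b' * cnj a') = Im (b * cnj a)"
proof
  let ?a = "a * of_real (h $ 2 $ 2) - b * of_real (h $ 2 $ 1)"
  let ?b = "b * of_real (h $ 1 $ 1) - a * of_real (h $ 1 $ 2)"
  have d: "h $ 1 $ 1 * h $ 2 $ 2 - h $ 1 $ 2 * h $ 2 $ 1 = 1"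
    using h by (simp add: SL2_iff)
  have "Im (?b * cnj ?a) = (h $ 1 $ 1 * h $ 2 $ 2 - h $ 1 $ 2 * h $ 2 $ 1) * Im (b * cnj a)"
    by (simp add: algebra_simps)
  then show "Im (?b * cnj ?a) = Im (b * cnj a)"
    by (simp add: d)
  show "left_translate h (pole_fun a b) = pole_fun ?a ?b"
  proof
    fix g
    have "matrix_inv h ** g \<in> SL2 \<longleftrightarrow> g \<in> SL2"
      using SL2_mult[OF SL2_inv[OF h], of g] SL2_mult[OF h, of "matrix_inv h ** g"] SL2_mult_cancel[OF h] by metis
    then show "left_translate h (pole_fun a b) g = pole_fun ?a ?b g"
      by (simp add: left_translate_def pole_fun_def SL2_inv_eq[OF h] matrix_matrix_mult_2 algebra_simps)
  qed
qed

text \<open>The conjugate of the usual circle coordinate, chosen so that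
  \<open>pole_fun 1 \<i>\<close> equals \<open>K_coord\<close> on \<open>K\<close> and the
  expansions below involve positive powers.\<close>

definition K_coord :: "real^2^2 \<Rightarrow> complex" where
  "K_coord k = of_real (k $ 1 $ 1) - \<i> * of_real (k $ 2 $ 1)"

lemma borel_measurable_K_coord [measurable]: "K_coord \<in> borel_measurable borel"
  unfolding K_coord_def[abs_def] by measurable

lemma norm_K_coord: "norm (column 1 k) = 1 \<Longrightarrow> norm (K_coord k) = 1"
proof -
  assume "norm (column 1 k) = 1"
  then have "(norm (K_coord k))\<^sup>2 = 1\<^sup>2"
    using norm_column_1_real[of k] by (simp add: K_coord_def cmod_power2)
  then show ?thesis
    by (rule power2_eq_imp_eq) simp_all
qed

lemma integral_K_coord_power:
  assumes "m > 0"
  shows "(\<integral>k. K_coord k ^ (2 * m) \<partial>haar_K) = 0"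
proof -
  \<comment> \<open>Rotation by this angle multiplies the power \<open>2 * m\<close> of the
    coordinate by \<open>- 1\<close>, so invariance makes the integral equal to its
    negative.\<close>
  define \<theta> where "\<theta> = pi / (2 * real m)"
  define w :: "real^2" where "w = vector [cos \<theta>, sin \<theta>]"
  have "(norm w)\<^sup>2 = 1\<^sup>2"
    by (simp add: norm_vec2 w_def)
  then have w: "norm w = 1"
    by (rule power2_eq_imp_eq) simp_all
  have rot: "K_coord (K_elt w ** k) = cis (- \<theta>) * K_coord k" for k
    by (simp add: complex_eq_iff K_coord_def matrix_matrix_mult_2 K_elt_def w_def algebra_simps)
  have "cis (- \<theta>) ^ (2 * m) = cis (- pi)"
    using assms unfolding Complex.DeMoivre by (simp add: \<theta>_def)
  then have c: "cis (- \<theta>) ^ (2 * m) = - 1"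
    by (simp add: complex_eq_iff)
  have "(\<integral>k. K_coord k ^ (2 * m) \<partial>haar_K) = (\<integral>k. K_coord (K_elt w ** k) ^ (2 * m) \<partial>haar_K)"
    by (rule integral_haar_K_left(1)[OF _ w, symmetric]) measurable
  also have "\<dots> = - (\<integral>k. K_coord k ^ (2 * m) \<partial>haar_K)"
    unfolding rot power_mult_distrib c by simp
  finally show ?thesis
    by simp
qed

text \<open>
  With \<open>z\<close> the coordinate on the circle, the product of the two functions is \<open>z\<^sup>2 / (\<alpha> + \<beta> z\<^sup>2)\<close>,
  where \<open>norm \<beta> < norm \<alpha>\<close>; integrate the geometric series.
\<close>
lemma pairing_pole_fun:
  assumes D: "Im (b * cnj a) > 0"
  shows "pairing (pole_fun 1 \<i>) (pole_fun a b) = 0"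
proof -
  \<comment> \<open>With \<open>z\<close> the coordinate, these are the coefficients in
    \<open>a * x + b * y = \<alpha> * cnj z + \<beta> * z\<close>.\<close>
  define \<alpha> where "\<alpha> = (a - \<i> * b) / 2"
  define \<beta> where "\<beta> = (a + \<i> * b) / 2"
  \<comment> \<open>The half-plane condition enters here: it says that \<open>\<alpha>\<close>
    dominates \<open>\<beta>\<close>, which gives the direction of the geometric expansion.\<close>
  have "(norm (a - \<i> * b))\<^sup>2 - (norm (a + \<i> * b))\<^sup>2 = 4 * Im (b * cnj a)"
    unfolding cmod_power2 by (simp add: power2_eq_square algebra_simps)
  then have "(norm \<alpha>)\<^sup>2 - (norm \<beta>)\<^sup>2 = Im (b * cnj a)"
    unfolding \<alpha>_def \<beta>_def norm_divide power_divide by (simp add: field_simps)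
  then have "(norm \<beta>)\<^sup>2 < (norm \<alpha>)\<^sup>2"
    using D by linarith
  then have lt: "norm \<beta> < norm \<alpha>"
    by (rule power2_less_imp_less) simp
  define r where "r = norm \<beta> / norm \<alpha>"
  have \<alpha>: "\<alpha> \<noteq> 0"
    using lt by auto
  have r: "0 \<le> r" "r < 1"
    using lt by (auto simp: r_def divide_less_eq)
  define F where "F k = K_coord k ^ 2 / (\<alpha> + \<beta> * K_coord k ^ 2)" for k
  have F_le: "AE k in haar_K. norm (F k) \<le> 1 / (norm \<alpha> - norm \<beta>)"
    using AE_haar_K_SL2
  proof eventually_elim
    case (elim k)
    then have z: "norm (K_coord k) = 1"
      by (simp add: norm_K_coord)
    have "norm \<alpha> - norm \<beta> \<le> norm (\<alpha> + \<beta> * K_coord k ^ 2)"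
      using norm_triangle_ineq4[of "\<alpha> + \<beta> * K_coord k ^ 2" "\<beta> * K_coord k ^ 2"] z by (simp add: norm_mult norm_power)
    then show ?case
      using lt z by (simp add: F_def norm_divide norm_power frac_le)
  qed
  have F_int: "integrable haar_K F"
    by (rule haar_K.integrable_const_bound[OF F_le]) (simp add: F_def[abs_def])
  have eq: "pairing (pole_fun 1 \<i>) (pole_fun a b) = (\<integral>k. F k \<partial>haar_K)"
    unfolding pairing_def
  proof (rule integral_cong_AE)
    show "AE k in haar_K. pole_fun 1 \<i> k * pole_fun a b k = F k"
      using AE_haar_K_SL2
    proof eventually_elim
      case (elim k)
      define z where "z = K_coord k"
      have z: "norm z = 1"
        unfolding z_def using elim by (simp add: norm_K_coord)
      then have zc: "z * cnj z = 1"
        by (simp add: complex_norm_square[symmetric])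
      have "of_real (k $ 1 $ 1) + \<i> * of_real (k $ 2 $ 1) = cnj z"
        by (simp add: z_def K_coord_def)
      moreover have "a * of_real (k $ 1 $ 1) + b * of_real (k $ 2 $ 1) = \<alpha> * cnj z + \<beta> * z"
        by (simp add: \<alpha>_def \<beta>_def z_def K_coord_def field_simps)
      ultimately have "pole_fun 1 \<i> k * pole_fun a b k = inverse (cnj z * (\<alpha> * cnj z + \<beta> * z))"
        using elim by (simp add: pole_fun_def)
      also have "cnj z * (\<alpha> * cnj z + \<beta> * z) = (\<alpha> + \<beta> * z\<^sup>2) * (cnj z)\<^sup>2"
        using zc by algebra
      also have "inverse \<dots> = z\<^sup>2 / (\<alpha> + \<beta> * z\<^sup>2)"
      proof -
        have "inverse (cnj z) = z"
          using zc by (metis inverse_unique mult.commute)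
        then show ?thesis
          by (simp add: divide_inverse power_inverse[symmetric] mult.commute)
      qed
      finally show ?case
        by (simp add: F_def z_def)
    qed
  qed (simp_all add: F_def[abs_def])
  have bound: "norm (\<integral>k. F k \<partial>haar_K) \<le> r ^ n * (1 / (norm \<alpha> - norm \<beta>))" for n
  proof -
    \<comment> \<open>The series is truncated, so only a finite sum is integrated. The factor
      \<open>z\<^sup>2\<close> in front shifts the exponents to \<open>2 * Suc m\<close>, so no
      constant term survives in \<open>S\<close>; the remainder \<open>R\<close> is \<open>F\<close>
      times the \<open>n\<close>th power of the ratio.\<close>
    define S where "S k = (\<Sum>m<n. ((- \<beta> / \<alpha>) ^ m / \<alpha>) * K_coord k ^ (2 * Suc m))" for k
    define R where "R k = (- \<beta> / \<alpha>) ^ n * K_coord k ^ (2 * n) * F k" for k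
    have FS: "AE k in haar_K. F k = S k + R k"
      using AE_haar_K_SL2
    proof eventually_elim
      case (elim k)
      define q where "q = (- \<beta> / \<alpha>) * K_coord k ^ 2"
      have z: "norm (K_coord k) = 1"
        using elim by (simp add: norm_K_coord)
      have "norm q < 1"
        using r z by (simp add: q_def norm_mult norm_divide norm_power r_def)
      then have q1: "1 - q \<noteq> 0"
        by auto
      have den: "\<alpha> + \<beta> * K_coord k ^ 2 = \<alpha> * (1 - q)"
        using \<alpha> by (simp add: q_def field_simps)
      have "(\<Sum>m<n. q ^ m) = (1 - q ^ n) / (1 - q)"
        using q1 sum_gp_strict[of q n] by auto
      then have "1 / (1 - q) = (\<Sum>m<n. q ^ m) + q ^ n / (1 - q)"
        using q1 by (simp add: field_simps)
      then have "F k = K_coord k ^ 2 / \<alpha> * ((\<Sum>m<n. q ^ m) + q ^ n / (1 - q))"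
        unfolding F_def den by (metis divide_divide_eq_left mult.right_neutral times_divide_eq_right)
      also have "\<dots> = (\<Sum>m<n. K_coord k ^ 2 / \<alpha> * q ^ m) + q ^ n * F k"
        unfolding F_def den by (simp add: distrib_left sum_distrib_left sum_divide_distrib mult.commute[of "q ^ n"])
      also have "(\<Sum>m<n. K_coord k ^ 2 / \<alpha> * q ^ m) = S k"
        unfolding S_def q_def power_mult_distrib by (intro sum.cong refl) (simp add: power_mult power_add power2_eq_square field_simps)
      also have "q ^ n * F k = R k"
        unfolding R_def q_def power_mult_distrib by (simp add: power_mult)
      finally show ?case .
    qed
    have K_int: "integrable haar_K (\<lambda>k. K_coord k ^ j)" for j
    proof (rule haar_K.integrable_const_bound[where B = 1])
      show "AE k in haar_K. norm (K_coord k ^ j) \<le> 1"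
        using AE_haar_K_SL2 by eventually_elim (simp add: norm_power norm_K_coord)
    qed simp
    have S_int: "integrable haar_K S"
      unfolding S_def[abs_def] by (intro Bochner_Integration.integrable_sum integrable_mult_right K_int)
    have S0: "(\<integral>k. S k \<partial>haar_K) = 0"
      unfolding S_def by (subst Bochner_Integration.integral_sum) (auto intro!: integrable_mult_right K_int simp: integral_K_coord_power simp del: mult_Suc_right)
    have R_le: "AE k in haar_K. norm (R k) \<le> r ^ n * (1 / (norm \<alpha> - norm \<beta>))"
      using F_le AE_haar_K_SL2
    proof eventually_elim
      case (elim k)
      then have "norm (R k) = r ^ n * norm (F k)"
        by (simp add: R_def norm_mult norm_power norm_divide norm_K_coord r_def)
      also have "\<dots> \<le> r ^ n * (1 / (norm \<alpha> - norm \<beta>))"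
        using elim r by (intro mult_left_mono) auto
      finally show ?case .
    qed
    have R_int: "integrable haar_K R"
      by (rule haar_K.integrable_const_bound[OF R_le]) (simp add: R_def[abs_def] F_def)
    have "(\<integral>k. F k \<partial>haar_K) = (\<integral>k. S k + R k \<partial>haar_K)"
      by (rule integral_cong_AE) (use FS in \<open>auto simp: F_def[abs_def] S_def[abs_def] R_def[abs_def]\<close>)
    also have "\<dots> = (\<integral>k. R k \<partial>haar_K)"
      using S_int R_int S0 by simp
    also have "norm \<dots> \<le> (\<integral>k. norm (R k) \<partial>haar_K)"
      by (rule integral_norm_bound)
    also have "\<dots> \<le> (\<integral>k. r ^ n * (1 / (norm \<alpha> - norm \<beta>)) \<partial>(haar_K :: (real^2^2) measure))"
      by (rule integral_mono_AE) (use R_int R_le in auto)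
    also have "\<dots> = r ^ n * (1 / (norm \<alpha> - norm \<beta>))"
      by simp
    finally show ?thesis .
  qed
  have "(\<lambda>n. r ^ n * (1 / (norm \<alpha> - norm \<beta>))) \<longlonglongrightarrow> 0 * (1 / (norm \<alpha> - norm \<beta>))"
    by (intro tendsto_intros LIMSEQ_power_zero) (use r in auto)
  then have "norm (\<integral>k. F k \<partial>haar_K) \<le> 0 * (1 / (norm \<alpha> - norm \<beta>))"
    using bound by (intro LIMSEQ_le_const) auto
  then show ?thesis
    unfolding eq by simp
qed

theorem reducible_sgn:
  "reducible_rep SL2 left_translate (ps_space (L_char (\<lambda>m. complex_of_real m) 0)) ps_norm"
proof -
  interpret ps_char "L_char (\<lambda>m. complex_of_real m) 0"
    by (rule ps_char_sgn)
  let ?V = "ps_space (L_char (\<lambda>m. complex_of_real m) 0)"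
  define S where "S = {pole_fun a b | a b. Im (b * cnj a) > 0}"
  define W where "W = {f \<in> ?V. \<forall>g\<in>S. pairing f g = 0}"
  have SV: "S \<subseteq> ?V"
    by (auto simp: S_def intro!: pole_fun_in_ps_space)
  have "closed_subspace W"
    unfolding W_def by (rule closed_subspace_annihilator(1)[OF SV])
  moreover have "left_translate h f \<in> W" if h: "h \<in> SL2" and f: "f \<in> W" for h f
  proof -
    have fV: "f \<in> ?V"
      using f by (simp add: W_def)
    have "pairing (left_translate h f) g = 0" if g: "g \<in> S" for g
    proof -
      obtain a b where ab: "g = pole_fun a b" "Im (b * cnj a) > 0"
        using g by (auto simp: S_def)
      \<comment> \<open>Invariance of the annihilator follows by moving \<open>h\<close> to the
        other argument, since \<open>S\<close> is stable under translation by the inverse.\<close>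
      obtain a' b' where "left_translate (matrix_inv h) g = pole_fun a' b'" "Im (b' * cnj a') = Im (b * cnj a)"
        using left_translate_pole_fun[OF SL2_inv[OF h], of a b] ab by metis
      then have g': "left_translate (matrix_inv h) g \<in> S"
        unfolding S_def using ab(2) by (intro CollectI exI[of _ a'] exI[of _ b']) auto
      have "pairing (left_translate h f) g = pairing (left_translate h f) (left_translate h (left_translate (matrix_inv h) g))"
        by (simp add: left_translate_inv[OF h])
      also have "\<dots> = pairing f (left_translate (matrix_inv h) g)"
        using g' SV fV h by (intro pairing_left_translate ps_space_K_homogeneous) (auto intro: ps_space_measurable)
      also have "\<dots> = 0"
        using f g' by (simp add: W_def)
      finally show ?thesis .
    qed
    then show ?thesis
      using ps_space_left_translate[OF fV h] by (simp add: W_def)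
  qed
  moreover have "\<exists>f\<in>W. ps_norm f \<noteq> 0"
  proof
    show "pole_fun 1 \<i> \<in> W"
      by (auto simp: W_def S_def pairing_pole_fun intro!: pole_fun_in_ps_space)
    have "(ps_norm (pole_fun 1 \<i>))\<^sup>2 = (\<integral>k. 1 \<partial>(haar_K :: (real^2^2) measure))"
      unfolding ps_norm_square
    proof (rule integral_cong_AE)
      show "AE k in haar_K. (norm (pole_fun 1 \<i> k))\<^sup>2 = 1"
        using AE_haar_K_SL2
      proof eventually_elim
        case (elim k)
        have "(norm (1 * of_real (k $ 1 $ 1) + \<i> * of_real (k $ 2 $ 1) :: complex))\<^sup>2 = 1"
          using elim norm_column_1_real[of k] by (simp add: cmod_power2)
        then show ?case
          using elim by (simp add: pole_fun_def norm_inverse power_inverse)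
      qed
    qed simp_all
    then show "ps_norm (pole_fun 1 \<i>) \<noteq> 0"
      by auto
  qed
  moreover have "W \<noteq> ?V"
  proof
    assume "W = ?V"
    \<comment> \<open>This function comes from the opposite half-plane. On the circle its product
      with \<open>pole_fun 1 \<i>\<close> is constantly 1, so their pairing is the total
      mass.\<close>
    then have "pole_fun 1 (- \<i>) \<in> W"
      by (auto intro!: pole_fun_in_ps_space)
    moreover have "pole_fun 1 \<i> \<in> S"
      unfolding S_def by (intro CollectI exI[of _ 1] exI[of _ \<i>]) simp
    ultimately have "pairing (pole_fun 1 (- \<i>)) (pole_fun 1 \<i>) = 0"
      by (simp add: W_def)
    moreover have "pairing (pole_fun 1 (- \<i>)) (pole_fun 1 \<i>) = (\<integral>k. 1 \<partial>(haar_K :: (real^2^2) measure))"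
      unfolding pairing_def
    proof (rule integral_cong_AE)
      show "AE k in haar_K. pole_fun 1 (- \<i>) k * pole_fun 1 \<i> k = 1"
        using AE_haar_K_SL2
      proof eventually_elim
        case (elim k)
        let ?x = "complex_of_real (k $ 1 $ 1)" and ?y = "complex_of_real (k $ 2 $ 1)"
        have "(k $ 1 $ 1)\<^sup>2 + (k $ 2 $ 1)\<^sup>2 = 1"
          using elim norm_column_1_real[of k] by simp
        then have "?x\<^sup>2 + ?y\<^sup>2 = 1"
          by (metis of_real_1 of_real_add of_real_power)
        moreover have "(1 * ?x + - \<i> * ?y) * (1 * ?x + \<i> * ?y) = ?x\<^sup>2 + ?y\<^sup>2"
          by (simp add: power2_eq_square algebra_simps)
        ultimately have "inverse (1 * ?x + - \<i> * ?y) * inverse (1 * ?x + \<i> * ?y) = 1"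
          by (metis inverse_1 inverse_mult_distrib)
        then show ?case
          using elim by (simp add: pole_fun_def)
      qed
    qed simp_all
    ultimately show False
      by simp
  qed
  ultimately show ?thesis
    unfolding reducible_rep_iff by blast
qed

subsection \<open>Fourier transform of the residual distribution\<close>

definition bump_base :: "real poly \<Rightarrow> real \<Rightarrow> real" where
  "bump_base p x = (if x > 0 then poly p (inverse x) * exp (- inverse x) else 0)"

lemma tendsto_poly_mult_exp_minus: "((\<lambda>y. poly p y * exp (- y)) \<longlongrightarrow> (0::real)) at_top"
proof -
  have "((\<lambda>y. \<Sum>i\<le>degree p. coeff p i * (y ^ i / exp y)) \<longlongrightarrow> (\<Sum>i\<le>degree p. coeff p i * 0)) at_top"
    by (intro tendsto_intros tendsto_power_div_exp_0)
  then show ?thesis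
    by (simp add: poly_altdef sum_distrib_right exp_minus divide_inverse mult.assoc)
qed

text \<open>The polynomial in \<open>inverse x\<close> is carried along because differentiation maps
  \<open>p\<close> to \<open>[:0, 0, 1:] * (p - pderiv p)\<close> and so stays within the family. At
  0 the difference quotient has the same form in \<open>inverse h\<close>, and the exponential
  defeats the polynomial.\<close>

lemma bump_base_deriv:
  "(bump_base p has_real_derivative bump_base ([:0, 0, 1:] * (p - pderiv p)) x) (at x)"
proof -
  consider "x > 0" | "x < 0" | "x = 0"
    by linarith
  then show ?thesis
  proof cases
    case 1
    have "((\<lambda>x. poly p (inverse x) * exp (- inverse x)) has_real_derivative
        bump_base ([:0, 0, 1:] * (p - pderiv p)) x) (at x)"
      using 1 by (auto intro!: derivative_eq_intros poly_DERIV[THEN DERIV_chain2] simp: bump_base_def power2_eq_square algebra_simps)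
    then show ?thesis
      by (rule has_field_derivative_transform_within_open[of _ _ _ "{0<..}"]) (use 1 in \<open>auto simp: bump_base_def\<close>)
  next
    case 2
    have "((\<lambda>_. 0) has_real_derivative bump_base ([:0, 0, 1:] * (p - pderiv p)) x) (at x)"
      using 2 by (simp add: bump_base_def)
    then show ?thesis
      by (rule has_field_derivative_transform_within_open[of _ _ _ "{..<0}"]) (use 2 in \<open>auto simp: bump_base_def\<close>)
  next
    case 3
    have "((\<lambda>h. bump_base p h / h) \<longlongrightarrow> 0) (at_right 0)"
    proof (rule Lim_transform_eventually)
      show "((\<lambda>h. poly ([:0, 1:] * p) (inverse h) * exp (- inverse h)) \<longlongrightarrow> (0::real)) (at_right 0)"
        by (rule filterlim_compose[OF tendsto_poly_mult_exp_minus filterlim_inverse_at_top_right])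
      show "\<forall>\<^sub>F h in at_right 0. poly ([:0, 1:] * p) (inverse h) * exp (- inverse h) = bump_base p h / h"
        by (auto simp: eventually_at_filter bump_base_def divide_inverse)
    qed
    moreover have "((\<lambda>h. bump_base p h / h) \<longlongrightarrow> 0) (at_left 0)"
      by (rule tendsto_eventually) (auto simp: eventually_at_filter bump_base_def)
    ultimately have "((\<lambda>h. bump_base p h / h) \<longlongrightarrow> 0) (at 0)"
      by (rule filterlim_split_at[rotated])
    then show ?thesis
      using 3 by (simp add: DERIV_def bump_base_def)
  qed
qed

text \<open>The smallest convenient class closed under differentiation: the product rule produces
  one term from the outer polynomial and one from the inner function, hence closure under sums. It
  makes smoothness a single induction step.\<close>

inductive_set bumps :: "real \<Rightarrow> (real \<Rightarrow> complex) set" for \<delta> where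
  base: "(\<lambda>s. of_real (poly r s * bump_base p (\<delta>\<^sup>2 - s\<^sup>2))) \<in> bumps \<delta>"
| add: "f \<in> bumps \<delta> \<Longrightarrow> g \<in> bumps \<delta> \<Longrightarrow> (\<lambda>s. f s + g s) \<in> bumps \<delta>"

lemma bumps_deriv: "f \<in> bumps \<delta> \<Longrightarrow> \<exists>f'\<in>bumps \<delta>. \<forall>x. (f has_vector_derivative f' x) (at x)"
proof (induction rule: bumps.induct)
  case (base r p)
  let ?p' = "[:0, 0, 1:] * (p - pderiv p)"
  let ?f' = "\<lambda>s. of_real (poly (pderiv r) s * bump_base p (\<delta>\<^sup>2 - s\<^sup>2))
      + of_real (poly (r * [:0, -2:]) s * bump_base ?p' (\<delta>\<^sup>2 - s\<^sup>2)) :: complex"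
  have "((\<lambda>s. of_real (poly r s * bump_base p (\<delta>\<^sup>2 - s\<^sup>2)) :: complex) has_vector_derivative ?f' x) (at x)" for x
  proof -
    have "((\<lambda>s. bump_base p (\<delta>\<^sup>2 - s\<^sup>2)) has_real_derivative bump_base ?p' (\<delta>\<^sup>2 - x\<^sup>2) * (- 2 * x)) (at x)"
      by (rule DERIV_chain2[OF bump_base_deriv]) (auto intro!: derivative_eq_intros)
    from DERIV_mult[OF poly_DERIV[of r x] this]
    have "((\<lambda>s. poly r s * bump_base p (\<delta>\<^sup>2 - s\<^sup>2)) has_real_derivative
        poly (pderiv r) x * bump_base p (\<delta>\<^sup>2 - x\<^sup>2) + poly (r * [:0, -2:]) x * bump_base ?p' (\<delta>\<^sup>2 - x\<^sup>2)) (at x)"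
      by (simp add: algebra_simps)
    from has_vector_derivative_of_real[OF this] show ?thesis
      by simp
  qed
  then show ?case
    by (intro bexI[of _ ?f'] bumps.add bumps.base) auto
next
  case (add f g)
  then obtain f' g' where "f' \<in> bumps \<delta>" "\<forall>x. (f has_vector_derivative f' x) (at x)"
    "g' \<in> bumps \<delta>" "\<forall>x. (g has_vector_derivative g' x) (at x)"
    by blast
  then show ?case
    by (intro bexI[of _ "\<lambda>s. f' s + g' s"] bumps.add) (auto intro: has_vector_derivative_add)
qed

lemma bumps_smooth:
  assumes "f \<in> bumps \<delta>"
  shows "smooth_fun f"
proof -
  define d where "d f = (SOME f'. f' \<in> bumps \<delta> \<and> (\<forall>x. (f has_vector_derivative f' x) (at x)))" for f
  have d: "d f \<in> bumps \<delta> \<and> (\<forall>x. (f has_vector_derivative d f x) (at x))" if "f \<in> bumps \<delta>" for f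
    unfolding d_def by (rule someI_ex[OF bumps_deriv[OF that, unfolded Bex_def]])
  define D where "D n = (d ^^ n) f" for n
  have "D n \<in> bumps \<delta>" for n
    by (induction n) (use assms d in \<open>auto simp: D_def\<close>)
  then have "(D n has_vector_derivative D (Suc n) x) (at x)" for n x
    using d[of "D n"] by (simp add: D_def)
  moreover have "D 0 = f"
    by (simp add: D_def)
  ultimately show ?thesis
    unfolding smooth_fun_def by blast
qed

lemma bumps_support:
  assumes "f \<in> bumps \<delta>" "\<delta> > 0" "\<delta> \<le> \<bar>s\<bar>"
  shows "f s = 0"
proof -
  have "\<delta>\<^sup>2 \<le> \<bar>s\<bar>\<^sup>2"
    using assms(2,3) by (intro power_mono) auto
  then have "\<not> \<delta>\<^sup>2 - s\<^sup>2 > 0"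
    by simp
  with assms(1) show ?thesis
    by (induction rule: bumps.induct) (auto simp: bump_base_def)
qed

lemma bumps_test_fun:
  assumes f: "f \<in> bumps \<delta>" and \<delta>: "\<delta> > 0" and U: "cball 0 \<delta> \<subseteq> U"
  shows "test_fun_on U f"
proof -
  have sub: "{x. f x \<noteq> 0} \<subseteq> cball 0 \<delta>"
    using bumps_support[OF f \<delta>] by (auto simp: not_le intro: ccontr)
  then have "closure {x. f x \<noteq> 0} \<subseteq> cball 0 \<delta>"
    by (intro closure_minimal) auto
  then show ?thesis
    using U bumps_smooth[OF f] bounded_subset[OF bounded_cball sub] unfolding test_fun_on_def
    by (auto simp: compact_closure)
qed

section \<open>Fourier transforms of bump functions\<close>

definition osc :: "real \<Rightarrow> real \<Rightarrow> complex" where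
  "osc y s = exp (- (2 * \<i> * of_real (pi * s * y)))"

lemma norm_osc [simp]: "norm (osc y s) = 1"
  by (simp add: osc_def)

lemma osc_0 [simp]: "osc 0 s = 1"
  by (simp add: osc_def)

lemma osc_deriv:
  "((\<lambda>s. osc y s) has_vector_derivative (- (2 * \<i> * of_real (pi * y)) * osc y s)) (at s within S)"
  "((\<lambda>y. osc y s) has_vector_derivative (- (2 * \<i> * of_real (pi * s)) * osc y s)) (at y within T)"
proof -
  have *: "((\<lambda>s. exp (c * of_real s)) has_vector_derivative c * exp (c * of_real s)) (at s within A)" for c :: complex and s A
    by (rule has_vector_derivative_real_field) (auto intro!: derivative_eq_intros)
  show "((\<lambda>s. osc y s) has_vector_derivative (- (2 * \<i> * of_real (pi * y)) * osc y s)) (at s within S)"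
    using *[of "- (2 * \<i> * of_real (pi * y))" s S] by (simp add: osc_def mult_ac)
  show "((\<lambda>y. osc y s) has_vector_derivative (- (2 * \<i> * of_real (pi * s)) * osc y s)) (at y within T)"
    using *[of "- (2 * \<i> * of_real (pi * s))" y T] by (simp add: osc_def mult_ac)
qed

lemma continuous_on_osc [continuous_intros]:
  "continuous_on A f \<Longrightarrow> continuous_on A g \<Longrightarrow> continuous_on A (\<lambda>x. osc (f x) (g x))"
  unfolding osc_def by (intro continuous_intros)

definition FT :: "real \<Rightarrow> (real \<Rightarrow> complex) \<Rightarrow> real \<Rightarrow> complex" where
  "FT \<delta> f y = integral {- \<delta>..\<delta>} (\<lambda>s. f s * osc y s)"

lemma FT_norm_le:
  assumes f: "continuous_on UNIV f" and \<delta>: "\<delta> > 0"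
  obtains C where "C \<ge> 0" "\<And>y. norm (FT \<delta> f y) \<le> C"
proof -
  have f': "continuous_on {- \<delta>..\<delta>} f"
    using f by (rule continuous_on_subset) auto
  have "norm (FT \<delta> f y) \<le> integral {- \<delta>..\<delta>} (\<lambda>s. norm (f s))" for y
    unfolding FT_def
    by (rule integral_norm_bound_integral)
      (auto intro!: integrable_continuous_real continuous_intros f' simp: norm_mult)
  moreover have "0 \<le> integral {- \<delta>..\<delta>} (\<lambda>s. norm (f s))"
    by (rule integral_nonneg) (auto intro!: integrable_continuous_real continuous_intros f')
  ultimately show ?thesis
    using that by blast
qed

lemma FT_deriv:
  assumes f: "continuous_on UNIV f"
  shows "(FT \<delta> f has_vector_derivative FT \<delta> (\<lambda>s. - (2 * \<i> * of_real (pi * s)) * f s) y) (at y)"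
proof -
  have f': "continuous_on A f" for A
    using f by (rule continuous_on_subset) auto
  have "((\<lambda>y. integral (cbox (- \<delta>) \<delta>) (\<lambda>s. f s * osc y s)) has_vector_derivative
      integral (cbox (- \<delta>) \<delta>) (\<lambda>s. - (2 * \<i> * of_real (pi * s)) * f s * osc y s)) (at y within UNIV)"
  proof (rule leibniz_rule_vector_derivative[where fx = "\<lambda>y s. - (2 * \<i> * of_real (pi * s)) * f s * osc y s"])
    show "((\<lambda>y. f s * osc y s) has_vector_derivative - (2 * \<i> * of_real (pi * s)) * f s * osc y s) (at y within UNIV)" for y s
      by (rule has_vector_derivative_eq_rhs, rule has_vector_derivative_mult_right, rule osc_deriv(2)) (simp add: mult.left_commute mult.assoc)
    show "(\<lambda>s. f s * osc y s) integrable_on cbox (- \<delta>) \<delta>" for y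
      unfolding cbox_interval by (intro integrable_continuous_real continuous_intros f')
    show "continuous_on (UNIV \<times> cbox (- \<delta>) \<delta>) (\<lambda>(y, s). - (2 * \<i> * of_real (pi * s)) * f s * osc y s)"
      unfolding case_prod_beta by (intro continuous_intros continuous_on_compose2[OF f]) auto
  qed auto
  then show ?thesis
    unfolding FT_def[abs_def] by simp
qed

lemma FT_by_parts:
  assumes f: "\<And>x. (f has_vector_derivative f' x) (at x)" and f': "continuous_on UNIV f'"
    and \<delta>: "\<delta> > 0" "f \<delta> = 0" "f (- \<delta>) = 0"
  shows "FT \<delta> f' y = 2 * \<i> * of_real (pi * y) * FT \<delta> f y"
proof -
  have fc: "continuous_on A f" for A
    using f by (meson continuous_at_imp_continuous_on has_vector_derivative_continuous)
  have f'c: "continuous_on A f'" for A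
    using f' by (rule continuous_on_subset) auto
  have "((\<lambda>s. f s * (- (2 * \<i> * of_real (pi * y)) * osc y s) + f' s * osc y s) has_integral f \<delta> * osc y \<delta> - f (- \<delta>) * osc y (- \<delta>)) {- \<delta>..\<delta>}"
    by (rule fundamental_theorem_of_calculus)
      (use \<delta> in simp, rule has_vector_derivative_mult[OF has_vector_derivative_at_within[OF f] osc_deriv(1)])
  then have "integral {- \<delta>..\<delta>} (\<lambda>s. f s * (- (2 * \<i> * of_real (pi * y)) * osc y s) + f' s * osc y s) = 0"
    using \<delta> by (simp add: integral_unique)
  moreover have "integral {- \<delta>..\<delta>} (\<lambda>s. f s * (- (2 * \<i> * of_real (pi * y)) * osc y s) + f' s * osc y s)
      = integral {- \<delta>..\<delta>} (\<lambda>s. - (2 * \<i> * of_real (pi * y)) * (f s * osc y s)) + FT \<delta> f' y"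
    unfolding FT_def
    by (subst Henstock_Kurzweil_Integration.integral_add[symmetric])
      (auto intro!: integrable_continuous_real continuous_intros fc f'c simp: mult.left_commute)
  ultimately show ?thesis
    unfolding FT_def by (simp add: eq_neg_iff_add_eq_0)
qed

lemma bumps_continuous: "f \<in> bumps \<delta> \<Longrightarrow> continuous_on UNIV f"
  using bumps_deriv[of f \<delta>] by (meson continuous_at_imp_continuous_on has_vector_derivative_continuous)

text \<open>Two integrations by parts without boundary terms give a factor \<open>y\<^sup>2\<close>;
  adding the trivial bound covers small \<open>y\<close>. Quadratic decay provides integrability on
  the half-line and the limit 0 at infinity.\<close>

lemma FT_bumps_decay:
  assumes f: "f \<in> bumps \<delta>" and \<delta>: "\<delta> > 0"
  obtains C where "\<And>y. norm (FT \<delta> f y) \<le> C / (1 + y\<^sup>2)"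
proof -
  have by_parts: "\<exists>f'\<in>bumps \<delta>. \<forall>y. FT \<delta> f' y = 2 * \<i> * of_real (pi * y) * FT \<delta> f y" if f: "f \<in> bumps \<delta>" for f
  proof -
    obtain f' where f': "f' \<in> bumps \<delta>" "\<And>x. (f has_vector_derivative f' x) (at x)"
      using bumps_deriv[OF f] by blast
    then show ?thesis
      using FT_by_parts[OF f'(2) bumps_continuous[OF f'(1)] \<delta>] bumps_support[OF f \<delta>] \<delta> by auto
  qed
  obtain f1 where f1: "f1 \<in> bumps \<delta>" "\<And>y. FT \<delta> f1 y = 2 * \<i> * of_real (pi * y) * FT \<delta> f y"
    using by_parts[OF f] by blast
  obtain f2 where f2: "f2 \<in> bumps \<delta>" "\<And>y. FT \<delta> f2 y = 2 * \<i> * of_real (pi * y) * FT \<delta> f1 y"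
    using by_parts[OF f1(1)] by blast
  obtain A where A: "\<And>y. norm (FT \<delta> f y) \<le> A"
    using FT_norm_le[OF bumps_continuous[OF f] \<delta>] by blast
  obtain B where B: "\<And>y. norm (FT \<delta> f2 y) \<le> B"
    using FT_norm_le[OF bumps_continuous[OF f2(1)] \<delta>] by blast
  have "norm (FT \<delta> f y) \<le> (A + B) / (1 + y\<^sup>2)" for y
  proof -
    have "norm (FT \<delta> f2 y) = (2 * pi)\<^sup>2 * y\<^sup>2 * norm (FT \<delta> f y)"
      unfolding f2(2) f1(2) by (simp add: norm_mult power2_eq_square abs_mult)
    moreover have "1 * (y\<^sup>2 * norm (FT \<delta> f y)) \<le> (2 * pi)\<^sup>2 * (y\<^sup>2 * norm (FT \<delta> f y))"
    proof (rule mult_right_mono)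
      have "1\<^sup>2 \<le> (2 * pi)\<^sup>2"
        using pi_gt3 by (intro power_mono) auto
      then show "1 \<le> (2 * pi)\<^sup>2" by simp
    qed simp
    ultimately have "y\<^sup>2 * norm (FT \<delta> f y) \<le> B"
      using B[of y] by (simp add: mult.assoc)
    then have "norm (FT \<delta> f y) * (1 + y\<^sup>2) \<le> A + B"
      using A[of y] by (simp add: algebra_simps)
    moreover have "1 + y\<^sup>2 > 0"
      by (simp add: add_pos_nonneg)
    ultimately show ?thesis
      by (simp add: le_divide_eq)
  qed
  then show ?thesis
    using that by blast
qed

lemma set_integrable_inverse_square: "set_integrable lborel {0<..} (\<lambda>y::real. C / (1 + y\<^sup>2))"
proof -
  have "(\<integral>\<^sup>+y. ennreal (1 / (1 + y\<^sup>2) * indicator {0..} y) \<partial>lborel)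
      = (\<integral>\<^sup>+y. ennreal (1 / (1 + y\<^sup>2)) * indicator {0..} y \<partial>lborel)"
    by (rule nn_integral_cong) (simp add: indicator_def)
  also have "\<dots> = ennreal (pi / 2 - arctan 0)"
  proof (rule nn_integral_FTC_atLeast)
    show "(arctan has_real_derivative 1 / (1 + x\<^sup>2)) (at x)" for x
      using DERIV_arctan[of x] by (simp add: inverse_eq_divide)
  qed (auto intro: tendsto_arctan_at_top)
  also have "\<dots> < \<infinity>"
    by simp
  finally have "integrable lborel (\<lambda>y. 1 / (1 + y\<^sup>2) * indicator {0..} y :: real)"
    by (rule integrableI_nonneg[rotated 2]) simp_all
  then have "set_integrable lborel {0..} (\<lambda>y::real. 1 / (1 + y\<^sup>2))"
    unfolding set_integrable_def by (simp add: mult.commute)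
  then have "set_integrable lborel {0<..} (\<lambda>y::real. 1 / (1 + y\<^sup>2))"
    by (rule set_integrable_subset) auto
  then have "set_integrable lborel {0<..} (\<lambda>y::real. C * (1 / (1 + y\<^sup>2)))"
    by (intro set_integrable_mult_right)
  then show ?thesis
    by simp
qed

text \<open>
  The test function is \<open>s\<close> times a bump \<open>\<beta>\<close>: its Fourier transform is, up to a factor, the derivative
  of that of \<open>\<beta>\<close>, so its integral over the half-line is a multiple of \<open>\<integral> \<beta>\<close>.
\<close>
lemma integral_FT_bump:
  assumes \<delta>: "\<delta> > 0"
  defines "\<psi> \<equiv> \<lambda>s. complex_of_real (poly [:0, 1:] s * bump_base 1 (\<delta>\<^sup>2 - s\<^sup>2))"
  shows "set_integrable lborel {0<..} (FT \<delta> \<psi>)" "(LINT y:{0<..}|lborel. FT \<delta> \<psi> y) \<noteq> 0"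
proof -
  define \<beta> where "\<beta> = (\<lambda>s. complex_of_real (poly 1 s * bump_base 1 (\<delta>\<^sup>2 - s\<^sup>2)))"
  have \<psi>: "\<psi> \<in> bumps \<delta>" and \<beta>: "\<beta> \<in> bumps \<delta>"
    unfolding \<psi>_def \<beta>_def by (rule bumps.base)+
  obtain C where C: "\<And>y. norm (FT \<delta> \<psi> y) \<le> C / (1 + y\<^sup>2)"
    using FT_bumps_decay[OF \<psi> \<delta>] by blast
  have C0: "0 \<le> C"
    using order_trans[OF norm_ge_zero C[of 0]] by simp
  have cont: "isCont (FT \<delta> f) y" if "f \<in> bumps \<delta>" for f y
    using FT_deriv[OF bumps_continuous[OF that]] by (rule has_vector_derivative_continuous)
  have [measurable]: "FT \<delta> \<psi> \<in> borel_measurable borel"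
    by (intro borel_measurable_continuous_onI continuous_at_imp_continuous_on) (use cont[OF \<psi>] in auto)
  show int: "set_integrable lborel {0<..} (FT \<delta> \<psi>)"
    unfolding set_integrable_def
  proof (rule Bochner_Integration.integrable_bound)
    show "integrable lborel (\<lambda>y. indicator {0<..} y *\<^sub>R (C / (1 + y\<^sup>2)))"
      using set_integrable_inverse_square[of C] by (simp add: set_integrable_def)
    show "AE y in lborel. norm (indicator {0<..} y *\<^sub>R FT \<delta> \<psi> y) \<le> norm (indicator {0<..} y *\<^sub>R (C / (1 + y\<^sup>2)))"
      using C C0 by (intro AE_I2) (auto simp: indicator_def)
  qed simp
  have deriv: "(FT \<delta> \<beta> has_vector_derivative (- (2 * \<i> * of_real pi)) * FT \<delta> \<psi> y) (at y)" for y
  proof -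
    have "FT \<delta> (\<lambda>s. - (2 * \<i> * of_real (pi * s)) * \<beta> s) y = (- (2 * \<i> * of_real pi)) * FT \<delta> \<psi> y"
      unfolding FT_def integral_mult_right[symmetric]
      by (rule integral_cong) (simp add: \<beta>_def \<psi>_def)
    then show ?thesis
      using FT_deriv[OF bumps_continuous[OF \<beta>], of \<delta> y] by simp
  qed
  obtain B where B: "\<And>y. norm (FT \<delta> \<beta> y) \<le> B / (1 + y\<^sup>2)"
    using FT_bumps_decay[OF \<beta> \<delta>] by blast
  \<comment> \<open>The transform of \<open>\<psi>\<close> is a derivative, so its integral over the
    half-line only sees the endpoint 0.\<close>
  have FTC: "(LBINT y=0..\<infinity>. (- (2 * \<i> * of_real pi)) * FT \<delta> \<psi> y) = 0 - FT \<delta> \<beta> 0"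
  proof (rule interval_integral_FTC_integrable)
    show "(FT \<delta> \<beta> has_vector_derivative (- (2 * \<i> * of_real pi)) * FT \<delta> \<psi> y) (at y)" for y
      by (rule deriv)
    show "isCont (\<lambda>y. (- (2 * \<i> * of_real pi)) * FT \<delta> \<psi> y) y" for y
      by (intro continuous_intros cont[OF \<psi>])
    show "set_integrable lborel (einterval 0 \<infinity>) (\<lambda>y. (- (2 * \<i> * of_real pi)) * FT \<delta> \<psi> y)"
    proof -
      have e: "einterval 0 \<infinity> = {0<..}"
        by (auto simp: einterval_def zero_ereal_def)
      show ?thesis
        unfolding e by (rule set_integrable_mult_right[OF int])
    qed
    show "((FT \<delta> \<beta> \<circ> real_of_ereal) \<longlongrightarrow> FT \<delta> \<beta> 0) (at_right 0)"
      unfolding zero_ereal_def ereal_tendsto_simps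
      using cont[OF \<beta>, of 0] by (simp add: isCont_def tendsto_within_subset[where S = UNIV])
    show "((FT \<delta> \<beta> \<circ> real_of_ereal) \<longlongrightarrow> 0) (at_left \<infinity>)"
      unfolding ereal_tendsto_simps
    proof (rule Lim_null_comparison)
      show "\<forall>\<^sub>F y in at_top. norm (FT \<delta> \<beta> y) \<le> B / (1 + y\<^sup>2)"
        using B by simp
      have "filterlim (\<lambda>y::real. 1 + y\<^sup>2) at_top at_top"
        by (intro filterlim_tendsto_add_at_top[OF tendsto_const] filterlim_pow_at_top filterlim_ident) simp
      then show "((\<lambda>y::real. B / (1 + y\<^sup>2)) \<longlongrightarrow> 0) at_top"
        by (intro tendsto_divide_0[OF tendsto_const] filterlim_at_top_imp_at_infinity)
    qed
  qed simp
  have "(LBINT y=0..\<infinity>. (- (2 * \<i> * of_real pi)) * FT \<delta> \<psi> y) = (- (2 * \<i> * of_real pi)) * (LINT y:{0<..}|lborel. FT \<delta> \<psi> y)"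
    unfolding interval_lebesgue_integral_0_infty by (rule set_integral_mult_right)
  \<comment> \<open>At frequency 0 the transform is the plain integral of a continuous nonnegative
    function that is positive at 0.\<close>
  moreover have "FT \<delta> \<beta> 0 \<noteq> 0"
  proof
    assume 0: "FT \<delta> \<beta> 0 = 0"
    define g where "g s = bump_base 1 (\<delta>\<^sup>2 - s\<^sup>2)" for s
    have \<beta>g: "\<beta> = (\<lambda>s. of_real (g s))"
      by (simp add: \<beta>_def g_def)
    have cg: "continuous_on {- \<delta>..\<delta>} g"
    proof -
      have "continuous_on {- \<delta>..\<delta>} \<beta>"
        using bumps_continuous[OF \<beta>] by (rule continuous_on_subset) auto
      then have "continuous_on {- \<delta>..\<delta>} (\<lambda>s. Re (\<beta> s))"
        by (intro continuous_intros)
      then show ?thesis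
        by (simp add: \<beta>g)
    qed
    have "integral {- \<delta>..\<delta>} (Re \<circ> \<beta>) = Re (integral {- \<delta>..\<delta>} \<beta>)"
      by (rule integral_linear[OF _ bounded_linear_Re])
        (intro integrable_continuous_real continuous_on_subset[OF bumps_continuous[OF \<beta>]], auto)
    then have "integral {- \<delta>..\<delta>} g = 0"
      using 0 by (simp add: FT_def \<beta>g o_def)
    moreover have "g s \<ge> 0" for s
      by (simp add: g_def bump_base_def)
    ultimately have "\<forall>s\<in>{- \<delta>..\<delta>}. g s = 0"
      using \<delta> by (subst (asm) integral_eq_0_iff[OF cg]) auto
    then have "g 0 = 0"
      using \<delta> by auto
    then show False
      using \<delta> by (simp add: g_def bump_base_def)
  qed
  ultimately show "(LINT y:{0<..}|lborel. FT \<delta> \<psi> y) \<noteq> 0"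
    using FTC by auto
qed

text \<open>With \<open>\<sigma>\<close> trivial on \<open>M\<close> the character depends on
  \<open>ln (norm l)\<close> alone, so the transform on the multiplicative group is the additive one
  in the logarithmic variable.\<close>

lemma fourier_L_transpose_trivial:
  fixes l :: "'a::real_normed_field"
  assumes f: "f \<in> bumps \<delta>" and \<delta>: "\<delta> > 0" and l: "l \<noteq> 0" and \<sigma>: "\<And>m. norm m = 1 \<Longrightarrow> \<sigma> m = 1"
  shows "fourier_L_transpose \<sigma> f l = FT \<delta> f (ln (norm l))"
proof -
  have char: "cnj (L_char \<sigma> t l) = osc (ln (norm l)) t" for t
  proof -
    have "L_char \<sigma> t l = exp (2 * \<i> * of_real (pi * t * ln (norm l)))"
      using l by (simp add: L_char_def \<sigma> norm_sgn nu_def powr_def Ln_of_real mult.assoc)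
    then show ?thesis
      by (simp add: osc_def exp_cnj)
  qed
  have c: "continuous_on {- \<delta>..\<delta>} (\<lambda>t. f t * osc (ln (norm l)) t)"
    by (intro continuous_intros continuous_on_subset[OF bumps_continuous[OF f]]) auto
  have "fourier_L_transpose \<sigma> f l = (LINT t:{- \<delta>..\<delta>}|lborel. f t * osc (ln (norm l)) t)"
    unfolding fourier_L_transpose_def char set_lebesgue_integral_def
  proof (rule Bochner_Integration.integral_cong)
    fix t
    show "f t * osc (ln (norm l)) t = indicator {- \<delta>..\<delta>} t *\<^sub>R (f t * osc (ln (norm l)) t)"
      using bumps_support[OF f \<delta>, of t] by (auto simp: indicator_def)
  qed simp
  also have "\<dots> = FT \<delta> f (ln (norm l))"
    unfolding FT_def by (rule set_borel_integral_eq_integral(2)[OF borel_integrable_atLeastAtMost'[OF c]])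
  finally show ?thesis .
qed

lemma AE_haar_L_nonzero: "AE t in (haar_L :: ('a::{real_normed_field, euclidean_space}) measure). t \<noteq> 0"
  unfolding haar_L_def by (subst AE_density) (auto intro: AE_mp[OF AE_lborel_singleton[of 0]])

text \<open>In the variable \<open>- ln (norm t)\<close> the set \<open>norm t < 1\<close> is, up to
  the origin, the positive half-line, and \<open>haar_L\<close> is a multiple of Lebesgue measure.
  The distribution becomes integration of the Fourier transform over that half-line, and a bump of
  arbitrarily small support detects it.\<close>

theorem fourier_L_Tw_trivial_not_vanishing:
  fixes \<sigma> :: "'a::{real_normed_field, euclidean_space} \<Rightarrow> complex"
  assumes \<sigma>: "\<And>m. norm m = 1 \<Longrightarrow> \<sigma> m = 1"
  shows "\<not> distribution_vanishes_at (fourier_L_Tw \<sigma>) 0"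
proof
  assume "distribution_vanishes_at (fourier_L_Tw \<sigma>) 0"
  then obtain U where U: "open U" "0 \<in> U" "\<And>\<psi>. test_fun_on U \<psi> \<Longrightarrow> fourier_L_Tw \<sigma> \<psi> = 0"
    unfolding distribution_vanishes_at_def by blast
  obtain \<delta> where \<delta>: "\<delta> > 0" "cball 0 \<delta> \<subseteq> U"
    using open_contains_cball_eq[OF U(1)] U(2) by blast
  define \<psi> where "\<psi> = (\<lambda>s. complex_of_real (poly [:0, 1:] s * bump_base 1 (\<delta>\<^sup>2 - s\<^sup>2)))"
  have \<psi>: "\<psi> \<in> bumps \<delta>"
    unfolding \<psi>_def by (rule bumps.base)
  let ?c = "unit_ball_vol (real DIM('a)) * real DIM('a)"
  have [measurable]: "FT \<delta> \<psi> \<in> borel_measurable borel"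
    using FT_deriv[OF bumps_continuous[OF \<psi>]] has_vector_derivative_continuous
    by (intro borel_measurable_continuous_onI continuous_at_imp_continuous_on) blast
  have lnm: "(\<lambda>t :: 'a. - ln (norm t)) \<in> borel_measurable haar_L"
    by (simp add: haar_L_def)
  let ?G = "\<lambda>y. indicator {0<..} y *\<^sub>R FT \<delta> \<psi> y"
  have Gm: "?G \<in> borel_measurable borel"
    by measurable
  have "0 = fourier_L_Tw \<sigma> \<psi>"
    using U(3)[OF bumps_test_fun[OF \<psi> \<delta>]] by simp
  also have "\<dots> = (\<integral>t. indicator {t. norm t < 1} t *\<^sub>R fourier_L_transpose \<sigma> \<psi> (inverse t) \<partial>(haar_L :: 'a measure))"
    by (simp add: fourier_L_Tw_def T_w_eq set_lebesgue_integral_def)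
  also have "\<dots> = (\<integral>t. ?G (- ln (norm t)) \<partial>(haar_L :: 'a measure))"
  proof -
    have eq: "indicator {t. norm t < 1} t *\<^sub>R fourier_L_transpose \<sigma> \<psi> (inverse t) = ?G (- ln (norm t))" if "t \<noteq> 0" for t :: 'a
      using that fourier_L_transpose_trivial[OF \<psi> \<delta>(1) _ \<sigma>, of "inverse t"]
      by (simp add: indicator_def norm_inverse ln_inverse)
    have Gm': "(\<lambda>t :: 'a. ?G (- ln (norm t))) \<in> borel_measurable haar_L"
      by (rule measurable_compose[OF lnm Gm])
    have "(\<lambda>t :: 'a. indicator {t. norm t < 1} t *\<^sub>R fourier_L_transpose \<sigma> \<psi> (inverse t)) \<in> borel_measurable haar_L"
    proof -
      \<comment> \<open>Measurability is transported from the logarithmic expression, which agrees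
        with the original integrand except at the origin; the value there is pinned by a case
        distinction.\<close>
      have "(\<lambda>t :: 'a. if t = 0 then indicator {t. norm t < 1} 0 *\<^sub>R fourier_L_transpose \<sigma> \<psi> (inverse 0) else ?G (- ln (norm t))) \<in> borel_measurable haar_L"
        by (rule measurable_If[OF measurable_const Gm']) (simp_all add: haar_L_def)
      also have "(\<lambda>t :: 'a. if t = 0 then indicator {t. norm t < 1} 0 *\<^sub>R fourier_L_transpose \<sigma> \<psi> (inverse 0) else ?G (- ln (norm t)))
          = (\<lambda>t. indicator {t. norm t < 1} t *\<^sub>R fourier_L_transpose \<sigma> \<psi> (inverse t))"
        using eq by (auto simp: fun_eq_iff)
      finally show ?thesis .
    qed
    then show ?thesis
      by (rule integral_cong_AE[OF _ Gm']) (use AE_haar_L_nonzero in eventually_elim, rule eq)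
  qed
  also have "\<dots> = (\<integral>y. ?G y \<partial>distr haar_L borel (\<lambda>t :: 'a. - ln (norm t)))"
    by (rule integral_distr[symmetric, OF lnm Gm])
  also have "\<dots> = (\<integral>y. ?c *\<^sub>R ?G y \<partial>lborel)"
    unfolding distr_haar_L by (rule integral_density) (use Gm in auto)
  also have "\<dots> = ?c *\<^sub>R (LINT y:{0<..}|lborel. FT \<delta> \<psi> y)"
    unfolding set_lebesgue_integral_def by (rule integral_scaleR_right)
  finally have "(LINT y:{0<..}|lborel. FT \<delta> \<psi> y) = 0"
    using less_imp_neq[OF unit_ball_vol_pos[of "real DIM('a)"]] by auto
  moreover have "(LINT y:{0<..}|lborel. FT \<delta> \<psi> y) \<noteq> 0"
    unfolding \<psi>_def by (rule integral_FT_bump(2)[OF \<delta>(1)])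
  ultimately show False
    by simp
qed

text \<open>The sign character makes the transposed function odd on the real line, whereas the
  residual measure is invariant under \<open>uminus\<close>.\<close>

lemma fourier_L_Tw_sgn: "fourier_L_Tw (\<lambda>m. complex_of_real m) \<psi> = 0"
proof -
  let ?\<phi> = "\<lambda>t. indicator {t. norm t < 1} t *\<^sub>R fourier_L_transpose (\<lambda>m. complex_of_real m) \<psi> (inverse t)"
  have odd: "?\<phi> (- t) = - ?\<phi> t" for t :: real
    by (simp add: fourier_L_transpose_def L_char_def indicator_def sgn_minus)
  have haar: "distr haar_L borel uminus = (haar_L :: real measure)"
  proof (rule measure_eqI)
    fix A :: "real set" assume "A \<in> sets (distr haar_L borel uminus)"
    then have [measurable]: "A \<in> sets borel"
      by simp
    have "emeasure (distr haar_L borel uminus) A = (\<integral>\<^sup>+t. indicator A t \<partial>distr haar_L borel uminus)"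
      by simp
    also have "\<dots> = (\<integral>\<^sup>+t. indicator A (- t) \<partial>haar_L)"
      by (rule nn_integral_distr) (simp_all add: haar_L_def)
    also have "\<dots> = (\<integral>\<^sup>+t. ennreal (1 / norm t ^ DIM(real)) * indicator A (- t) \<partial>lborel)"
      unfolding haar_L_def by (rule nn_integral_density) simp_all
    also have "\<dots> = (\<integral>\<^sup>+t. ennreal (1 / norm (- t) ^ DIM(real)) * indicator A (- t) \<partial>lborel)"
      by simp
    also have "\<dots> = (\<integral>\<^sup>+t. ennreal (1 / norm t ^ DIM(real)) * indicator A t \<partial>distr lborel borel uminus)"
      by (rule nn_integral_distr[symmetric]) simp_all
    also have "\<dots> = emeasure haar_L A"
      unfolding lborel_distr_uminus haar_L_def by (rule emeasure_density[symmetric]) simp_all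
    finally show "emeasure (distr haar_L borel uminus) A = emeasure haar_L A" .
  qed simp
  show ?thesis
  proof (cases "integrable haar_L ?\<phi>")
    case True
    have "(\<integral>t. ?\<phi> t \<partial>haar_L) = (\<integral>t. ?\<phi> t \<partial>distr haar_L borel uminus)"
      by (simp only: haar)
    also have "\<dots> = (\<integral>t. ?\<phi> (- t) \<partial>haar_L)"
      by (rule integral_distr) (use borel_measurable_integrable[OF True] in \<open>simp_all add: haar_L_def\<close>)
    also have "\<dots> = - (\<integral>t. ?\<phi> t \<partial>haar_L)"
      unfolding odd by simp
    finally have "(\<integral>t. ?\<phi> t \<partial>haar_L) = 0"
      by simp
    then show ?thesis
      by (simp add: fourier_L_Tw_def T_w_eq set_lebesgue_integral_def)
  next
    \<comment> \<open>The statement covers arbitrary \<open>\<psi>\<close>, hence also integrands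
      that are not integrable; the integral is then 0 by convention.\<close>
    case False
    then show ?thesis
      by (simp add: fourier_L_Tw_def T_w_eq set_lebesgue_integral_def not_integrable_integral_eq)
  qed
qed

section \<open>Weyl-fixed characters\<close>

lemma nu_fixed_imp_0:
  assumes "\<And>a. a > 0 \<Longrightarrow> nu t (inverse a) = nu t a"
  shows "t = 0"
proof (rule ccontr)
  assume t: "t \<noteq> 0"
  have e: "nu t (exp x) = exp (\<i> * of_real (2 * pi * t * x))" for x
    by (simp add: nu_def powr_def Ln_of_real mult_ac)
  \<comment> \<open>The point is chosen so that the exponent is a quarter turn: the two values are
    \<open>\<i>\<close> and its negative.\<close>
  have "nu t (exp (- (1 / (4 * t)))) = nu t (exp (1 / (4 * t)))"
    using assms[of "exp (1 / (4 * t))"] by (simp add: exp_minus)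
  then have "exp (\<i> * of_real (- (pi / 2))) = exp (\<i> * of_real (pi / 2))"
    unfolding e using t by (simp add: field_simps)
  then have "cis (- (pi / 2)) = cis (pi / 2)"
    by (simp only: cis_conv_exp)
  then show False
    by (simp add: complex_eq_iff)
qed

text \<open>The Weyl element acts by inversion. On positive reals the compact part contributes
  \<open>\<sigma> 1 = 1\<close>, which isolates the condition on \<open>nu\<close>.\<close>

lemma weyl_fixed_L_char_imp_0:
  fixes \<sigma> :: "'a::real_normed_field \<Rightarrow> complex"
  assumes "weyl_fixed (L_char \<sigma> t)" "\<sigma> 1 = 1"
  shows "t = 0"
proof (rule nu_fixed_imp_0)
  fix a :: real assume "a > 0"
  then show "nu t (inverse a) = nu t a"
    using assms unfolding weyl_fixed_def weyl_act_eq
    by (auto dest!: spec[of _ "of_real a"] simp: L_char_def sgn_of_real norm_inverse)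
      (simp add: sgn_div_norm norm_inverse scaleR_conv_of_real)
qed

lemma weyl_fixed_powi_imp_0:
  assumes "weyl_fixed (L_char (\<lambda>z. z powi n) 0)"
  shows "n = (0 :: int)"
proof (rule ccontr)
  assume n: "n \<noteq> 0"
  \<comment> \<open>Again a quarter turn, now after raising to the power \<open>n\<close>.\<close>
  define \<theta> where "\<theta> = pi / (2 * of_int n)"
  have l: "cis \<theta> \<noteq> 0" "inverse (cis \<theta>) = cis (- \<theta>)"
    by simp_all
  have s: "sgn (cis x) = cis x" for x
    by (simp add: sgn_div_norm)
  have "L_char (\<lambda>z. z powi n) 0 (cis (- \<theta>)) = L_char (\<lambda>z. z powi n) 0 (cis \<theta>)"
    using assms l unfolding weyl_fixed_def weyl_act_eq by metis
  then have "cis (- \<theta>) powi n = cis \<theta> powi n"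
    by (simp add: L_char_def nu_0 s)
  then have "cis (- (pi / 2)) = cis (pi / 2)"
    using n by (simp add: cis_power_int \<theta>_def)
  then show False
    by (simp add: complex_eq_iff)
qed

lemma principal_series_irreducible_trivial:
  fixes \<sigma> :: "'a::{real_normed_field, euclidean_space} \<Rightarrow> complex"
  assumes "\<And>m. norm m = 1 \<Longrightarrow> \<sigma> m = 1"
  shows "\<not> principal_series_reducible \<sigma> 0"
proof -
  interpret spherical "L_char \<sigma> 0"
    by unfold_locales (simp add: L_char_def nu_0 assms norm_sgn)
  show ?thesis
    unfolding principal_series_reducible_def by (rule irreducible)
qed

theorem theorem4p3:
  "(\<forall>\<sigma>\<in>M_dual_real. \<forall>t::real. weyl_fixed (L_char \<sigma> t) \<longrightarrow>
      (principal_series_reducible \<sigma> t \<longleftrightarrow> distribution_vanishes_at (fourier_L_Tw \<sigma>) t)) \<and>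
   (\<forall>\<sigma>\<in>M_dual_complex. \<forall>t::real. weyl_fixed (L_char \<sigma> t) \<longrightarrow>
      (principal_series_reducible \<sigma> t \<longleftrightarrow> distribution_vanishes_at (fourier_L_Tw \<sigma>) t))"
proof (intro conjI ballI allI impI)
  fix \<sigma> :: "real \<Rightarrow> complex" and t :: real
  assume \<sigma>: "\<sigma> \<in> M_dual_real" and fixed: "weyl_fixed (L_char \<sigma> t)"
  then have t: "t = 0"
    using weyl_fixed_L_char_imp_0[OF fixed] by (auto simp: M_dual_real_def)
  consider "\<sigma> = (\<lambda>_. 1)" | "\<sigma> = (\<lambda>m. complex_of_real m)"
    using \<sigma> by (auto simp: M_dual_real_def)
  then show "principal_series_reducible \<sigma> t \<longleftrightarrow> distribution_vanishes_at (fourier_L_Tw \<sigma>) t"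
  proof cases
    case 1
    then show ?thesis
      unfolding t using principal_series_irreducible_trivial[of \<sigma>] fourier_L_Tw_trivial_not_vanishing[of \<sigma>] by simp
  next
    case 2
    have "principal_series_reducible \<sigma> t"
      unfolding principal_series_reducible_def t 2 by (rule reducible_sgn)
    moreover have "distribution_vanishes_at (fourier_L_Tw \<sigma>) t"
      unfolding distribution_vanishes_at_def 2 by (rule exI[of _ UNIV]) (simp add: fourier_L_Tw_sgn)
    ultimately show ?thesis
      by simp
  qed
next
  fix \<sigma> :: "complex \<Rightarrow> complex" and t :: real
  assume \<sigma>: "\<sigma> \<in> M_dual_complex" and fixed: "weyl_fixed (L_char \<sigma> t)"
  then have t: "t = 0"
    using weyl_fixed_L_char_imp_0[OF fixed] by (auto simp: M_dual_complex_def)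
  obtain n :: int where n: "\<sigma> = (\<lambda>z. z powi n)"
    using \<sigma> by (auto simp: M_dual_complex_def)
  have "n = 0"
    using fixed unfolding t n by (rule weyl_fixed_powi_imp_0)
  then have "\<sigma> = (\<lambda>_. 1)"
    by (simp add: n)
  then show "principal_series_reducible \<sigma> t \<longleftrightarrow> distribution_vanishes_at (fourier_L_Tw \<sigma>) t"
    unfolding t using principal_series_irreducible_trivial[of \<sigma>] fourier_L_Tw_trivial_not_vanishing[of \<sigma>] by simp
qed

end
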